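(* In the exponential model, suppose that $\underline{\alpha}+\underline{\beta}>0$. Then the shape function $g$ satisfies $$g(s,t)=\inf_{z\in(-\underline{\alpha},\underline{\beta})}\left\{s\,\mathrm{E}\left[\frac{1}{a+z}\right]+t\,\mathrm{E}\left[\frac{1}{b-z}\right]\right\}\quad\text{for all } s,t>0.$$
   Context: Let $\mathbb N=\{1,2,\dots\}$. Exponential model: Let $\mathbf a=(a_n)_{n\in\mathbb N}$ and $\mathbf b=(b_n)_{n\in\mathbb N}$ be stationary random sequences with terms in $(0,\infty)$, with joint distribution $\mu$. Let $\tau_k$ denote the shift $(c_n)_{n\in\mathbb N}\mapsto(c_{n+k})_{n\in\mathbb N}$. It is assumed that $\mu$ is totally ergodic: for each $k,l\in\mathbb N$ separately, $\mu$ is (stationary and) ergodic under $\tau_k\times\tau_l$, which acts by $(\mathbf a,\mathbf b)\mapsto(\tau_k\mathbf a,\tau_l\mathbf b)$. Given $(\mathbf a,\mathbf b)$, the weights $\{W(i,j):i,j\in\mathbb N\}$ are independent under the conditional law $\mathbf P_{\mathbf a,\mathbf b}$ with $\mathbf P_{\mathbf a,\mathbf b}(W(i,j)\ge x)=e^{-(a_i+b_j)x}$ for $x\ge0$. Let $\mathbb P(\cdot)=\int\mathbf P_{\mathbf a,\mathbf b}(\cdot)\,\mu(d\mathbf a,d\mathbf b)$ be the unconditional law of the weights. Last-passage times: $G(m,n)=\max_\pi\sum_{(i,j)\in\pi}W(i,j)$, the maximum being over all directed paths $\pi$ from $(1,1)$ to $(m,n)$ in $\mathbb Z^2$ (finite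 sequences of sites with steps in $\{(1,0),(0,1)\}$). Shape function: $g:(0,\infty)^2\to[0,\infty]$ is the deterministic function such that, $\mathbb P$-a.s., $\lim_{n\to\infty}n^{-1}G(\lfloor ns\rfloor,\lfloor nt\rfloor)=g(s,t)$ for all $s,t>0$ (such a function exists). Notation: $\alpha$ and $\beta$ are the distributions of $a=a_1$ and $b=b_1$; $\underline{\alpha}$ and $\underline{\beta}$ are the left endpoints of their supports (the essential infima of $a_1$ and $b_1$); $\mathrm E$ is expectation under $\mu$. *)

theory Defs
  imports "HOL-Probability.Probability"
begin

section \<open>The random parameters\<close>

text \<open>Sequences are indexed by \<open>{1, 2, \<dots>}\<close>, as extensional functions on \<open>{1..}\<close>.
  Positivity of the terms is built into the measurable space.\<close>

definition pos_seqs :: "(nat \<Rightarrow> real) measure" where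
  "pos_seqs = (\<Pi>\<^sub>M n\<in>{1..}. restrict_space borel {0<..})"

definition seq_shift :: "nat \<Rightarrow> (nat \<Rightarrow> real) \<Rightarrow> (nat \<Rightarrow> real)" where
  "seq_shift k c = (\<lambda>n\<in>{1..}. c (n + k))"

definition ergodic_under :: "'a measure \<Rightarrow> ('a \<Rightarrow> 'a) \<Rightarrow> bool" where
  "ergodic_under M T \<longleftrightarrow>
     T \<in> M \<rightarrow>\<^sub>M M \<and> distr M M T = M \<and>
     (\<forall>A\<in>sets M. T -` A \<inter> space M = A \<longrightarrow> measure M A = 0 \<or> measure M A = 1)"

definition totally_ergodic :: "((nat \<Rightarrow> real) \<times> (nat \<Rightarrow> real)) measure \<Rightarrow> bool" where
  "totally_ergodic \<mu> \<longleftrightarrow>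
     (\<forall>k\<ge>1. \<forall>l\<ge>1. ergodic_under \<mu> (map_prod (seq_shift k) (seq_shift l)))"

text \<open>Stationarity of each of the two sequences is contained in the invariance of \<open>\<mu>\<close>
  under the shifts.\<close>

locale parameter_law = prob_space \<mu> for \<mu> :: "((nat \<Rightarrow> real) \<times> (nat \<Rightarrow> real)) measure" +
  assumes sets_\<mu>: "sets \<mu> = sets (pos_seqs \<Otimes>\<^sub>M pos_seqs)"
    and totally_ergodic: "totally_ergodic \<mu>"

definition a_distr :: "((nat \<Rightarrow> real) \<times> (nat \<Rightarrow> real)) measure \<Rightarrow> real measure" where
  "a_distr \<mu> = distr \<mu> borel (\<lambda>(a, b). a 1)"

definition b_distr :: "((nat \<Rightarrow> real) \<times> (nat \<Rightarrow> real)) measure \<Rightarrow> real measure" where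
  "b_distr \<mu> = distr \<mu> borel (\<lambda>(a, b). b 1)"

definition measure_support :: "'a::topological_space measure \<Rightarrow> 'a set" where
  "measure_support M = {x. \<forall>U. open U \<longrightarrow> x \<in> U \<longrightarrow> emeasure M U > 0}"

definition left_endpoint :: "real measure \<Rightarrow> real" where
  "left_endpoint M = Inf (measure_support M)"


section \<open>The weights\<close>

abbreviation sites :: "(nat \<times> nat) set" where
  "sites \<equiv> {1..} \<times> {1..}"

definition quenched_law ::
  "(nat \<Rightarrow> real) \<times> (nat \<Rightarrow> real) \<Rightarrow> (nat \<times> nat \<Rightarrow> real) measure" where
  "quenched_law = (\<lambda>(a, b). \<Pi>\<^sub>M (i, j)\<in>sites. density lborel (exponential_density (a i + b j)))"

definition annealed_law ::
  "((nat \<Rightarrow> real) \<times> (nat \<Rightarrow> real)) measure \<Rightarrow> (nat \<times> nat \<Rightarrow> real) measure" where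
  "annealed_law \<mu> = \<mu> \<bind> quenched_law"

text \<open>The monadic bind is only meaningful for a measurable kernel.\<close>

lemma quenched_law_measurable:
  "quenched_law \<in> (pos_seqs \<Otimes>\<^sub>M pos_seqs) \<rightarrow>\<^sub>M prob_algebra (\<Pi>\<^sub>M p\<in>sites. borel)"
proof -
  let ?D = "\<lambda>x (i, j). density lborel (exponential_density (fst x i + snd x j))"
  let ?N = "\<Pi>\<^sub>M p\<in>sites. (borel :: real measure)"
  have pos: "fst x i + snd x j > 0"
    if "x \<in> space (pos_seqs \<Otimes>\<^sub>M pos_seqs)" "i \<in> {1..}" "j \<in> {1..}" for x i j
    using that by (intro add_pos_pos)
      (auto simp: pos_seqs_def space_pair_measure space_PiM space_restrict_space PiE_iff)
  have ql: "quenched_law x = PiM sites (?D x)" for x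
    by (simp add: quenched_law_def case_prod_beta)
  have P: "prob_space (?D x p)" if "x \<in> space (pos_seqs \<Otimes>\<^sub>M pos_seqs)" "p \<in> sites" for x p
    using pos[OF that(1)] that(2) by (auto intro!: prob_space_exponential_density)
  show ?thesis
  proof (rule measurable_prob_algebra_generated[OF sets_PiM Int_stable_prod_algebra prod_algebra_sets_into_space])
    fix x assume x: "x \<in> space (pos_seqs \<Otimes>\<^sub>M pos_seqs)"
    show "prob_space (quenched_law x)"
      unfolding ql by (rule prob_space_PiM) (rule P[OF x])
    show "sets (quenched_law x) = sets ?N"
      unfolding ql by (intro sets_PiM_cong) auto
  next
    fix A assume "A \<in> prod_algebra sites (\<lambda>_. borel :: real measure)"
    from prod_algebraE[OF this] obtain J X where
      A: "A = prod_emb sites (\<lambda>_. borel) J (Pi\<^sub>E J X)" and J: "finite J" "J \<subseteq> sites"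
      and X: "\<And>p. p \<in> J \<Longrightarrow> X p \<in> sets borel" by metis
    have eq: "emeasure (quenched_law x) A =
        (\<Prod>p\<in>J. \<integral>\<^sup>+y. ennreal (exponential_density (fst x (fst p) + snd x (snd p)) y) * indicator (X p) y \<partial>lborel)"
      if x: "x \<in> space (pos_seqs \<Otimes>\<^sub>M pos_seqs)" for x
    proof -
      have "A = prod_emb sites (?D x) J (Pi\<^sub>E J X)"
        unfolding A prod_emb_def by (auto simp: case_prod_beta)
      then have "emeasure (quenched_law x) A = (\<Prod>p\<in>J. emeasure (?D x p) (X p))"
        unfolding ql using J X P[OF x]
        by (simp add: emeasure_PiM_emb case_prod_beta)
      also have "\<dots> = (\<Prod>p\<in>J. \<integral>\<^sup>+y. ennreal (exponential_density (fst x (fst p) + snd x (snd p)) y) * indicator (X p) y \<partial>lborel)"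
        using X by (intro prod.cong refl) (simp add: case_prod_beta emeasure_density)
      finally show ?thesis .
    qed
    have comp: "(\<lambda>c. c i) \<in> borel_measurable pos_seqs" if "i \<in> {1..}" for i
    proof -
      have "(\<lambda>c. c i) \<in> pos_seqs \<rightarrow>\<^sub>M restrict_space borel {0<..}"
        unfolding pos_seqs_def by (rule measurable_component_singleton[OF that])
      then show ?thesis by (rule measurable_restrict_space2_iff[THEN iffD1, THEN conjunct1])
    qed
    have "(\<lambda>x. \<Prod>p\<in>J. \<integral>\<^sup>+y. ennreal (exponential_density (fst x (fst p) + snd x (snd p)) y) * indicator (X p) y \<partial>lborel)
        \<in> borel_measurable (pos_seqs \<Otimes>\<^sub>M pos_seqs)"
    proof (rule borel_measurable_prod_ennreal)
      fix p assume p: "p \<in> J"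
      then have [measurable]: "(\<lambda>c. c (fst p)) \<in> borel_measurable pos_seqs"
          "(\<lambda>c. c (snd p)) \<in> borel_measurable pos_seqs" "X p \<in> sets borel"
        using J(2) X by (auto intro!: comp)
      show "(\<lambda>x. \<integral>\<^sup>+y. ennreal (exponential_density (fst x (fst p) + snd x (snd p)) y) * indicator (X p) y \<partial>lborel)
        \<in> borel_measurable (pos_seqs \<Otimes>\<^sub>M pos_seqs)"
        unfolding exponential_density_def by measurable
    qed
    then show "(\<lambda>x. emeasure (quenched_law x) A) \<in> borel_measurable (pos_seqs \<Otimes>\<^sub>M pos_seqs)"
      by (subst measurable_cong[OF eq])
  qed
qed

lemma emeasure_annealed_law:
  assumes "parameter_law \<mu>" and "A \<in> sets (\<Pi>\<^sub>M p\<in>sites. borel)"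
  shows "emeasure (annealed_law \<mu>) A = (\<integral>\<^sup>+ab. emeasure (quenched_law ab) A \<partial>\<mu>)"
proof -
  interpret parameter_law \<mu> by fact
  have "quenched_law \<in> \<mu> \<rightarrow>\<^sub>M prob_algebra (\<Pi>\<^sub>M p\<in>sites. borel)"
    using quenched_law_measurable sets_\<mu> by (simp cong: measurable_cong_sets)
  then show ?thesis
    unfolding annealed_law_def
    by (intro emeasure_bind[OF not_empty _ assms(2)] measurable_prob_algebraD)
qed


section \<open>Last-passage times and the shape function\<close>

definition directed_path :: "nat \<times> nat \<Rightarrow> nat \<times> nat \<Rightarrow> (nat \<times> nat) list \<Rightarrow> bool" where
  "directed_path u v \<pi> \<longleftrightarrow>
     \<pi> \<noteq> [] \<and> hd \<pi> = u \<and> last \<pi> = v \<and>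
     (\<forall>k. Suc k < length \<pi> \<longrightarrow>
        \<pi> ! Suc k = (fst (\<pi> ! k) + 1, snd (\<pi> ! k)) \<or>
        \<pi> ! Suc k = (fst (\<pi> ! k), snd (\<pi> ! k) + 1))"

text \<open>Only meaningful for \<open>m, n \<ge> 1\<close>: otherwise there is no path and \<open>Max\<close> is unspecified.\<close>

definition last_passage :: "(nat \<times> nat \<Rightarrow> real) \<Rightarrow> nat \<Rightarrow> nat \<Rightarrow> real" where
  "last_passage W m n = Max ((\<lambda>\<pi>. \<Sum>p\<in>set \<pi>. W p) ` {\<pi>. directed_path (1, 1) (m, n) \<pi>})"

text \<open>The values of \<open>g\<close> off the open quadrant are irrelevant. For given \<open>s, t > 0\<close> the
  coordinates \<open>\<lfloor>n * s\<rfloor>\<close> and \<open>\<lfloor>n * t\<rfloor>\<close> vanish for only finitely many \<open>n\<close>.\<close>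

definition is_shape_function ::
  "((nat \<Rightarrow> real) \<times> (nat \<Rightarrow> real)) measure \<Rightarrow> (real \<Rightarrow> real \<Rightarrow> ennreal) \<Rightarrow> bool" where
  "is_shape_function \<mu> g \<longleftrightarrow>
     (AE W in annealed_law \<mu>. \<forall>s>0. \<forall>t>0.
        (\<lambda>n. ennreal (last_passage W (nat \<lfloor>real n * s\<rfloor>) (nat \<lfloor>real n * t\<rfloor>) / real n))
          \<longlonglongrightarrow> g s t)"

end

theory Submission
  imports Defs "HOL-Real_Asymp.Real_Asymp"
begin

text \<open>
  Write \<open>\<alpha>\<close>, \<open>\<beta>\<close> for the left endpoints, \<open>A z = E[1/(a + z)]\<close> and \<open>B z = E[1/(b - z)]\<close>. The proof
  compares last-passage times with a stationary version of the model. Given the parameters, put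
  weights of rate \<open>a\<^sub>i + z\<close> on the horizontal axis and of rate \<open>b\<^sub>j - z\<close> on the vertical axis, and
  let \<open>G\<^sup>z(m, n)\<close> be the last-passage time from the origin (\<open>boundary_lpp\<close>). The rates on the axes
  add up to the rate \<open>a\<^sub>i + b\<^sub>j\<close> of the bulk weight, so Burke's theorem applies: the update of one
  lattice square preserves the joint law of horizontal increment, vertical increment and weight
  (\<open>burke_triple\<close>, \<open>queue_step_preserves\<close>). Hence the horizontal increments of \<open>G\<^sup>z\<close> along every
  row are again independent exponentials, and \<open>G\<^sup>z(m, n)\<close> is a sum of two sums of independent
  exponentials. By Chebyshev's inequality it is close to the sum of all \<open>1/(a\<^sub>i + z)\<close> and
  \<open>1/(b\<^sub>j - z)\<close> (\<open>boundary_lpp_concentration\<close>), which on the scale \<open>(Ns, Nt)\<close> grows like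
  \<open>N (s A(z) + t B(z))\<close> by the ergodic theorem.

  Upper bound: \<open>G \<le> G\<^sup>z\<close> for every \<open>z\<close> in \<open>(-\<alpha>, \<beta>)\<close>.

  Lower bound: suppose that \<open>z\<close> is a critical point of \<open>s A + t B\<close>. If the path that is optimal for
  \<open>G\<^sup>z\<close> follows the horizontal axis for more than \<open>\<epsilon>N\<close> steps, then lowering the parameter to
  \<open>w1 < z\<close> makes the same path longer by about \<open>\<epsilon>N (A(w1) - A(z))\<close>, a gain of first order in
  \<open>z - w1\<close>, whereas \<open>G\<close> with parameter \<open>w1\<close> exceeds \<open>G\<^sup>z\<close> only to second order. The vertical axis is
  excluded in the same way with some \<open>w2 > z\<close>. So the path leaves the axes after at most \<open>\<epsilon>N\<close>
  steps, and \<open>G \<ge> G\<^sup>z - O(\<epsilon>N)\<close>. The alternative is put in a form that is preserved by the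
  last-passage recursion, \<open>boundary_lpp_exit_bound\<close>, so that no exit points have to be handled.

  The function \<open>s A + t B\<close> may have no critical point, its infimum being approached at \<open>-\<alpha>\<close> or \<open>\<beta>\<close>.
  Therefore the parameters are first replaced by \<open>max a\<^sub>i (\<alpha> + \<delta>)\<close> and \<open>max b\<^sub>j (\<beta> + \<delta>)\<close>, which
  only decreases the weights. The new parameters have atoms at their left endpoints, the function
  blows up at both ends of its interval, and a critical point exists (\<open>critical_parameter\<close>). The
  error of this replacement vanishes as \<open>\<delta> \<rightarrow> 0\<close> (\<open>reciprocal_comparison\<close>).
\<close>


section \<open>The Burke property of independent exponentials\<close>

abbreviation exponential_law :: "real \<Rightarrow> real measure" where
  "exponential_law r \<equiv> density lborel (exponential_density r)"

lemma nn_integral_exponential_law: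
  fixes f :: "real \<Rightarrow> ennreal"
  assumes "f \<in> borel_measurable borel"
  shows "(\<integral>\<^sup>+x. f x \<partial>exponential_law r) = (\<integral>\<^sup>+x. exponential_density r x * f x \<partial>lborel)"
  using assms by (subst nn_integral_density) (auto simp: exponential_density_def)

lemma measurable_exponential_density[measurable]:
  "exponential_density r \<in> borel_measurable borel"
  unfolding exponential_density_def by measurable

text \<open>The density identity behind Burke's theorem: on the region \<open>w \<le> v\<close> the exchange of \<open>u\<close> and \<open>w\<close>,
  with \<open>v\<close> moved along, leaves the joint density unchanged. Positivity of the arguments is part of
  the densities, and \<open>w \<le> v\<close> makes the two positivity conditions agree.\<close>

lemma exponential_density_exchange:
  assumes "w \<le> v" "p > 0" "q > 0"
  shows "exponential_density p u * exponential_density q (v + u - w) * exponential_density (p + q) w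
       = exponential_density p w * exponential_density q v * exponential_density (p + q) u"
  using assms
  by (auto simp: exponential_density_def algebra_simps simp flip: exp_add)

lemma nn_integral_shift:
  fixes f :: "real \<Rightarrow> ennreal"
  assumes "f \<in> borel_measurable borel"
  shows "(\<integral>\<^sup>+x. f x \<partial>lborel) = (\<integral>\<^sup>+x. f (x + c) \<partial>lborel)"
  using nn_integral_real_affine[of f 1 c] assms by (simp add: add.commute)

lemma nn_integral_lborel_swap:
  fixes f :: "real \<Rightarrow> real \<Rightarrow> ennreal"
  assumes "case_prod f \<in> borel_measurable (borel \<Otimes>\<^sub>M borel)"
  shows "(\<integral>\<^sup>+x. \<integral>\<^sup>+y. f x y \<partial>lborel \<partial>lborel) = (\<integral>\<^sup>+y. \<integral>\<^sup>+x. f x y \<partial>lborel \<partial>lborel)"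
  using assms by (intro lborel_pair.Fubini'[symmetric]) simp

lemma sets_le_lt_pair:
  "{(x::real, y). x \<le> y} \<in> sets (borel \<Otimes>\<^sub>M borel)"
  "{(x::real, y). x < y} \<in> sets (borel \<Otimes>\<^sub>M borel)"
proof -
  have "{z \<in> space (borel \<Otimes>\<^sub>M borel). fst z \<le> (snd z :: real)} \<in> sets (borel \<Otimes>\<^sub>M borel)"
    "{z \<in> space (borel \<Otimes>\<^sub>M borel). fst z < (snd z :: real)} \<in> sets (borel \<Otimes>\<^sub>M borel)"
    by measurable
  then show "{(x::real, y). x \<le> y} \<in> sets (borel \<Otimes>\<^sub>M borel)"
    "{(x::real, y). x < y} \<in> sets (borel \<Otimes>\<^sub>M borel)"
    by (simp_all add: space_pair_measure case_prod_beta')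
qed

text \<open>On \<open>u \<le> v\<close> the Burke map is \<open>(u, v, w) \<mapsto> (w, v - u + w, u)\<close>, a translation in \<open>v\<close> followed by
  an exchange of the other two variables. Strict and weak inequality are both covered because the
  complementary region is treated by the same statement with the roles of \<open>u\<close> and \<open>v\<close> exchanged.\<close>

lemma burke_half:
  fixes F :: "real \<times> real \<times> real \<Rightarrow> ennreal"
  assumes [measurable]: "F \<in> borel_measurable (borel \<Otimes>\<^sub>M borel \<Otimes>\<^sub>M borel)"
    and "p > 0" "q > 0" and S: "S = {(x, y). x \<le> y} \<or> S = {(x,y). x < (y::real)}"
  shows "(\<integral>\<^sup>+w. \<integral>\<^sup>+u. \<integral>\<^sup>+v. ennreal (exponential_density p u * exponential_density q v * exponential_density (p + q) w)
            * (indicator S (u, v) * F (w, v - u + w, u)) \<partial>lborel \<partial>lborel \<partial>lborel)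
       = (\<integral>\<^sup>+w. \<integral>\<^sup>+u. \<integral>\<^sup>+v. ennreal (exponential_density p u * exponential_density q v * exponential_density (p + q) w)
            * (indicator S (u, v) * F (u, v, w)) \<partial>lborel \<partial>lborel \<partial>lborel)"
proof -
  have [measurable]: "S \<in> sets (borel \<Otimes>\<^sub>M borel)"
    using S sets_le_lt_pair by auto
  let ?d = "\<lambda>u v w. ennreal (exponential_density p u * exponential_density q v * exponential_density (p + q) w)"
  have "(\<integral>\<^sup>+v. ?d u v w * (indicator S (u, v) * F (w, v - u + w, u)) \<partial>lborel)
     = (\<integral>\<^sup>+v. ?d w v u * (indicator S (w, v) * F (w, v, u)) \<partial>lborel)" for u w
  proof -
    \<comment> \<open>the translation makes the second argument of \<open>F\<close> the integration variable\<close>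
    have "(\<integral>\<^sup>+v. ?d u v w * (indicator S (u, v) * F (w, v - u + w, u)) \<partial>lborel)
      = (\<integral>\<^sup>+v. ?d u (v + (u - w)) w * (indicator S (u, v + (u - w)) * F (w, v + (u - w) - u + w, u)) \<partial>lborel)"
      by (rule nn_integral_shift) measurable
    also have "\<dots> = (\<integral>\<^sup>+v. ?d w v u * (indicator S (w, v) * F (w, v, u)) \<partial>lborel)"
    proof (rule nn_integral_cong)
      fix v
      have "(u, v + (u - w)) \<in> S \<longleftrightarrow> (w, v) \<in> S" using S by auto
      moreover have "?d u (v + (u - w)) w = ?d w v u" if "(w, v) \<in> S"
        using that S exponential_density_exchange[of w v p q u] assms(2,3) by (auto simp: algebra_simps)
      ultimately show "?d u (v + (u - w)) w * (indicator S (u, v + (u - w)) * F (w, v + (u - w) - u + w, u))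
          = ?d w v u * (indicator S (w, v) * F (w, v, u))"
        by (auto simp: indicator_def)
    qed
    finally show ?thesis .
  qed
  then show ?thesis
    by (simp only:) (rule nn_integral_lborel_swap, measurable)
qed

text \<open>Burke's theorem for one lattice square: \<open>u\<close> and \<open>v\<close> are the increments on the lower and left edge,
  \<open>w\<close> is the weight, and the first two components of the image are the increments on the upper and
  right edge. Keeping \<open>min u v\<close> as third component turns the update into a measure-preserving map
  of the product space, so that updates can be composed without any independence bookkeeping.\<close>

lemma burke_triple:
  fixes F :: "real \<times> real \<times> real \<Rightarrow> ennreal"
  assumes [measurable]: "F \<in> borel_measurable (borel \<Otimes>\<^sub>M borel \<Otimes>\<^sub>M borel)"
    and pq: "p > 0" "q > 0"
  shows "(\<integral>\<^sup>+w. \<integral>\<^sup>+v. \<integral>\<^sup>+u. F (u - min u v + w, v - min u v + w, min u v)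
            \<partial>exponential_law p \<partial>exponential_law q \<partial>exponential_law (p + q))
       = (\<integral>\<^sup>+w. \<integral>\<^sup>+v. \<integral>\<^sup>+u. F (u, v, w)
            \<partial>exponential_law p \<partial>exponential_law q \<partial>exponential_law (p + q))"
proof -
  let ?d = "\<lambda>u v w. ennreal (exponential_density p u * exponential_density q v * exponential_density (p + q) w)"
  let ?le = "{(x::real, y). x \<le> y}" and ?lt = "{(x::real, y). x < y}"
  have nonneg: "exponential_density p u \<ge> 0" "exponential_density q u \<ge> 0" "exponential_density (p + q) u \<ge> 0" for u
    using pq by (auto simp: exponential_density_def)
  have [measurable]: "?le \<in> sets (borel \<Otimes>\<^sub>M borel)" "?lt \<in> sets (borel \<Otimes>\<^sub>M borel)"
    by (rule sets_le_lt_pair)+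
  have expand: "(\<integral>\<^sup>+w. \<integral>\<^sup>+v. \<integral>\<^sup>+u. H (u, v, w) \<partial>exponential_law p \<partial>exponential_law q \<partial>exponential_law (p + q))
     = (\<integral>\<^sup>+w. \<integral>\<^sup>+u. \<integral>\<^sup>+v. ?d u v w * (indicator ?le (u, v) * H (u, v, w)) \<partial>lborel \<partial>lborel \<partial>lborel)
     + (\<integral>\<^sup>+w. \<integral>\<^sup>+v. \<integral>\<^sup>+u. ?d u v w * (indicator ?lt (v, u) * H (u, v, w)) \<partial>lborel \<partial>lborel \<partial>lborel)"
    if [measurable]: "H \<in> borel_measurable (borel \<Otimes>\<^sub>M borel \<Otimes>\<^sub>M borel)" for H :: "real \<times> real \<times> real \<Rightarrow> ennreal"
  proof -
    have "(\<integral>\<^sup>+w. \<integral>\<^sup>+v. \<integral>\<^sup>+u. H (u, v, w) \<partial>exponential_law p \<partial>exponential_law q \<partial>exponential_law (p + q))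
      = (\<integral>\<^sup>+w. \<integral>\<^sup>+v. \<integral>\<^sup>+u. ?d u v w * H (u, v, w) \<partial>lborel \<partial>lborel \<partial>lborel)"
      by (simp add: nn_integral_exponential_law nn_integral_cmult[symmetric] ennreal_mult' nonneg mult_ac)
    also have "\<dots> = (\<integral>\<^sup>+w. \<integral>\<^sup>+v. \<integral>\<^sup>+u. ?d u v w * (indicator ?le (u, v) * H (u, v, w))
        + ?d u v w * (indicator ?lt (v, u) * H (u, v, w)) \<partial>lborel \<partial>lborel \<partial>lborel)"
      by (intro nn_integral_cong) (auto simp: indicator_def)
    also have "\<dots> = (\<integral>\<^sup>+w. \<integral>\<^sup>+v. \<integral>\<^sup>+u. ?d u v w * (indicator ?le (u, v) * H (u, v, w)) \<partial>lborel \<partial>lborel \<partial>lborel)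
        + (\<integral>\<^sup>+w. \<integral>\<^sup>+v. \<integral>\<^sup>+u. ?d u v w * (indicator ?lt (v, u) * H (u, v, w)) \<partial>lborel \<partial>lborel \<partial>lborel)"
      by (simp add: nn_integral_add)
    also have "(\<integral>\<^sup>+w. \<integral>\<^sup>+v. \<integral>\<^sup>+u. ?d u v w * (indicator ?le (u, v) * H (u, v, w)) \<partial>lborel \<partial>lborel \<partial>lborel)
      = (\<integral>\<^sup>+w. \<integral>\<^sup>+u. \<integral>\<^sup>+v. ?d u v w * (indicator ?le (u, v) * H (u, v, w)) \<partial>lborel \<partial>lborel \<partial>lborel)"
      by (intro nn_integral_cong nn_integral_lborel_swap) measurable
    finally show ?thesis .
  qed
  have le: "(\<integral>\<^sup>+w. \<integral>\<^sup>+u. \<integral>\<^sup>+v. ?d u v w * (indicator ?le (u, v) * F (u - min u v + w, v - min u v + w, min u v)) \<partial>lborel \<partial>lborel \<partial>lborel)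
     = (\<integral>\<^sup>+w. \<integral>\<^sup>+u. \<integral>\<^sup>+v. ?d u v w * (indicator ?le (u, v) * F (u, v, w)) \<partial>lborel \<partial>lborel \<partial>lborel)"
    unfolding burke_half[OF assms(1) pq, of ?le, simplified, symmetric]
    by (intro nn_integral_cong) (auto simp: indicator_def)
  have swapF: "(\<lambda>(x, y, k). F (y, x, k)) \<in> borel_measurable (borel \<Otimes>\<^sub>M borel \<Otimes>\<^sub>M borel)"
    by measurable
  have lt: "(\<integral>\<^sup>+w. \<integral>\<^sup>+v. \<integral>\<^sup>+u. ?d u v w * (indicator ?lt (v, u) * F (u - min u v + w, v - min u v + w, min u v)) \<partial>lborel \<partial>lborel \<partial>lborel)
     = (\<integral>\<^sup>+w. \<integral>\<^sup>+v. \<integral>\<^sup>+u. ?d u v w * (indicator ?lt (v, u) * F (u, v, w)) \<partial>lborel \<partial>lborel \<partial>lborel)"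
    using burke_half[OF swapF pq(2,1), of ?lt, simplified]
    by (auto intro!: nn_integral_cong simp: indicator_def ac_simps cong: nn_integral_cong
          elim!: trans[rotated] trans[rotated, OF sym])
  show ?thesis
    using expand[of "\<lambda>(u, v, w). F (u - min u v + w, v - min u v + w, min u v)"] expand[OF assms(1)] le lt
    by simp
qed

lemma prob_space_exponential_law: "r > 0 \<Longrightarrow> prob_space (exponential_law r)"
  by (rule prob_space_exponential_density)

text \<open>The Burke map applied to three coordinates of a configuration: slots \<open>a\<close> and \<open>b\<close> hold the current
  horizontal and vertical increment, slot \<open>c\<close> the weight of the square that is being processed.\<close>

definition queue_step :: "'k \<Rightarrow> 'k \<Rightarrow> 'k \<Rightarrow> ('k \<Rightarrow> real) \<Rightarrow> 'k \<Rightarrow> real" where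
  "queue_step a b c x =
     x(a := x a - min (x a) (x b) + x c, b := x b - min (x a) (x b) + x c, c := min (x a) (x b))"

lemma measurable_queue_step:
  assumes "a \<in> K" "b \<in> K" "c \<in> K"
  shows "queue_step a b c \<in> (\<Pi>\<^sub>M k\<in>K. borel) \<rightarrow>\<^sub>M (\<Pi>\<^sub>M k\<in>K. borel)"
proof -
  have [measurable]: "(\<lambda>x. x k) \<in> borel_measurable (\<Pi>\<^sub>M k\<in>K. borel :: real measure)" if "k \<in> K" for k
    using that by (rule measurable_component_singleton)
  note [measurable] = this[OF assms(1)] this[OF assms(2)] this[OF assms(3)]
  show ?thesis
    unfolding queue_step_def
    using assms by (intro measurable_fun_upd[where J = K] measurable_ident) (auto simp: insert_absorb)
qed

lemma queue_step_preserves: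
  assumes "finite K" and abc: "a \<in> K" "b \<in> K" "c \<in> K" "a \<noteq> b" "a \<noteq> c" "b \<noteq> c"
    and r: "\<And>k. r k > 0" and rc: "r c = r a + r b"
  shows "distr (\<Pi>\<^sub>M k\<in>K. exponential_law (r k)) (\<Pi>\<^sub>M k\<in>K. borel) (queue_step a b c)
       = (\<Pi>\<^sub>M k\<in>K. exponential_law (r k))"
proof (rule measure_eqI)
  show "sets (distr (\<Pi>\<^sub>M k\<in>K. exponential_law (r k)) (\<Pi>\<^sub>M k\<in>K. borel) (queue_step a b c))
     = sets (\<Pi>\<^sub>M k\<in>K. exponential_law (r k))"
    by (simp cong: sets_PiM_cong)
  fix A assume "A \<in> sets (distr (\<Pi>\<^sub>M k\<in>K. exponential_law (r k)) (\<Pi>\<^sub>M k\<in>K. borel) (queue_step a b c))"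
  then have A: "A \<in> sets (\<Pi>\<^sub>M k\<in>K. borel)" by simp
  have meas_eq: "measurable (\<Pi>\<^sub>M k\<in>J. exponential_law (r k)) N = measurable (\<Pi>\<^sub>M k\<in>J. borel) N" for J and N :: "'z measure"
    by (intro measurable_cong_sets sets_PiM_cong) auto
  interpret product_prob_space "\<lambda>k. exponential_law (r k)"
    using prob_space_exponential_law[OF r]
    by (simp add: product_prob_space_def product_prob_space_axioms_def product_sigma_finite_def
        prob_space_imp_sigma_finite)
  define K' where "K' = K - {a, b, c}"
  have K: "K = insert a (insert b (insert c K'))" and K': "finite K'" "a \<notin> K'" "b \<notin> K'" "c \<notin> K'"
    using assms by (auto simp: K'_def)
  have split: "(\<integral>\<^sup>+x. f x \<partial>(\<Pi>\<^sub>M k\<in>K. exponential_law (r k)))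
     = (\<integral>\<^sup>+x. \<integral>\<^sup>+w. \<integral>\<^sup>+v. \<integral>\<^sup>+u. f (x(c := w, b := v, a := u))
         \<partial>exponential_law (r a) \<partial>exponential_law (r b) \<partial>exponential_law (r c) \<partial>(\<Pi>\<^sub>M k\<in>K'. exponential_law (r k)))"
    if "f \<in> borel_measurable (\<Pi>\<^sub>M k\<in>K. borel)" for f :: "('a \<Rightarrow> real) \<Rightarrow> ennreal"
  proof -
    have [measurable]: "f \<in> borel_measurable (\<Pi>\<^sub>M k\<in>insert a (insert b (insert c K')). exponential_law (r k))"
      using that unfolding meas_eq K[symmetric] .
    show ?thesis
      unfolding K using K' abc
      by (simp add: product_nn_integral_insert)
  qed
  have meas_ind: "(\<lambda>x. indicator A x :: ennreal) \<in> borel_measurable (\<Pi>\<^sub>M k\<in>K. borel)"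
    using A by simp
  have Q: "queue_step a b c \<in> (\<Pi>\<^sub>M k\<in>K. borel) \<rightarrow>\<^sub>M (\<Pi>\<^sub>M k\<in>K. borel)"
    using abc by (intro measurable_queue_step)
  have "emeasure (distr (\<Pi>\<^sub>M k\<in>K. exponential_law (r k)) (\<Pi>\<^sub>M k\<in>K. borel) (queue_step a b c)) A
     = (\<integral>\<^sup>+x. indicator A (queue_step a b c x) \<partial>(\<Pi>\<^sub>M k\<in>K. exponential_law (r k)))"
    using A Q meas_ind
      nn_integral_distr[of "queue_step a b c" "\<Pi>\<^sub>M k\<in>K. exponential_law (r k)" "\<Pi>\<^sub>M k\<in>K. borel" "indicator A"]
    by (simp add: meas_eq)
  also have "\<dots> = (\<integral>\<^sup>+x. \<integral>\<^sup>+w. \<integral>\<^sup>+v. \<integral>\<^sup>+u. indicator A (queue_step a b c (x(c := w, b := v, a := u)))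
         \<partial>exponential_law (r a) \<partial>exponential_law (r b) \<partial>exponential_law (r c) \<partial>(\<Pi>\<^sub>M k\<in>K'. exponential_law (r k)))"
    by (rule split, rule measurable_compose[OF Q meas_ind])
  also have "\<dots> = (\<integral>\<^sup>+x. \<integral>\<^sup>+w. \<integral>\<^sup>+v. \<integral>\<^sup>+u. indicator A (x(c := w, b := v, a := u))
         \<partial>exponential_law (r a) \<partial>exponential_law (r b) \<partial>exponential_law (r c) \<partial>(\<Pi>\<^sub>M k\<in>K'. exponential_law (r k)))"
  proof (rule nn_integral_cong)
    fix x assume "x \<in> space (\<Pi>\<^sub>M k\<in>K'. exponential_law (r k))"
    then have [measurable]: "x \<in> space (\<Pi>\<^sub>M k\<in>K'. borel)" by (simp add: space_PiM)
    let ?F = "\<lambda>(u, v, w). indicator A (x(c := w, b := v, a := u)) :: ennreal"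
    have "(\<lambda>(u, v, w). x(c := w, b := v, a := u)) \<in> (borel \<Otimes>\<^sub>M borel \<Otimes>\<^sub>M borel) \<rightarrow>\<^sub>M (\<Pi>\<^sub>M k\<in>K. borel)"
      unfolding K by measurable
    from measurable_compose[OF this meas_ind]
    have F: "?F \<in> borel_measurable (borel \<Otimes>\<^sub>M borel \<Otimes>\<^sub>M borel)"
      by (simp add: case_prod_beta')
    have upd: "queue_step a b c (x(c := w, b := v, a := u))
       = x(c := min u v, b := v - min u v + w, a := u - min u v + w)" for u v w
      using abc by (auto simp: queue_step_def fun_eq_iff)
    show "(\<integral>\<^sup>+w. \<integral>\<^sup>+v. \<integral>\<^sup>+u. indicator A (queue_step a b c (x(c := w, b := v, a := u)))
         \<partial>exponential_law (r a) \<partial>exponential_law (r b) \<partial>exponential_law (r c))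
       = (\<integral>\<^sup>+w. \<integral>\<^sup>+v. \<integral>\<^sup>+u. indicator A (x(c := w, b := v, a := u))
         \<partial>exponential_law (r a) \<partial>exponential_law (r b) \<partial>exponential_law (r c))"
      using burke_triple[OF F r[of a] r[of b]] unfolding upd rc by simp
  qed
  also have "\<dots> = (\<integral>\<^sup>+x. indicator A x \<partial>(\<Pi>\<^sub>M k\<in>K. exponential_law (r k)))"
    by (rule split[symmetric], rule meas_ind)
  also have "\<dots> = emeasure (\<Pi>\<^sub>M k\<in>K. exponential_law (r k)) A"
    using A by (intro nn_integral_indicator) (simp cong: sets_PiM_cong)
  finally show "emeasure (distr (\<Pi>\<^sub>M k\<in>K. exponential_law (r k)) (\<Pi>\<^sub>M k\<in>K. borel) (queue_step a b c)) A
     = emeasure (\<Pi>\<^sub>M k\<in>K. exponential_law (r k)) A" .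
qed

section \<open>Last-passage recursions with and without boundary\<close>

text \<open>For nonnegative weights the value \<open>0\<close> on the axes makes the recursion agree with the maximum over
  directed paths from \<open>(1, 1)\<close>.\<close>

fun lpp :: "(nat \<times> nat \<Rightarrow> real) \<Rightarrow> nat \<Rightarrow> nat \<Rightarrow> real" where
  "lpp W 0 n = 0"
| "lpp W m 0 = 0"
| "lpp W (Suc m) (Suc n) = max (lpp W m (Suc n)) (lpp W (Suc m) n) + W (Suc m, Suc n)"

text \<open>Last-passage times from the origin with weights on both axes; the weight at the origin is ignored.\<close>

fun boundary_lpp :: "(nat \<times> nat \<Rightarrow> real) \<Rightarrow> nat \<Rightarrow> nat \<Rightarrow> real" where
  "boundary_lpp V 0 0 = 0"
| "boundary_lpp V (Suc m) 0 = boundary_lpp V m 0 + V (Suc m, 0)"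
| "boundary_lpp V 0 (Suc n) = boundary_lpp V 0 n + V (0, Suc n)"
| "boundary_lpp V (Suc m) (Suc n) =
     max (boundary_lpp V m (Suc n)) (boundary_lpp V (Suc m) n) + V (Suc m, Suc n)"

lemma lpp_0_right [simp]: "lpp W m 0 = 0"
  by (cases m) auto

lemma boundary_lpp_axis:
  "boundary_lpp V m 0 = (\<Sum>i=1..m. V (i, 0))" "boundary_lpp V 0 n = (\<Sum>j=1..n. V (0, j))"
proof -
  show "boundary_lpp V m 0 = (\<Sum>i=1..m. V (i, 0))" by (induction m) auto
  show "boundary_lpp V 0 n = (\<Sum>j=1..n. V (0, j))" by (induction n) auto
qed

lemma lpp_nonneg:
  assumes "\<And>i j. 1 \<le> i \<Longrightarrow> i \<le> m \<Longrightarrow> 1 \<le> j \<Longrightarrow> j \<le> n \<Longrightarrow> W (i, j) \<ge> 0"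
  shows "lpp W m n \<ge> 0"
  using assms by (induction W m n rule: lpp.induct) (auto simp: le_max_iff_disj intro!: add_nonneg_nonneg)

lemma lpp_mono:
  assumes "\<And>i j. 1 \<le> i \<Longrightarrow> i \<le> m \<Longrightarrow> 1 \<le> j \<Longrightarrow> j \<le> n \<Longrightarrow> W (i, j) \<le> W' (i, j)"
  shows "lpp W m n \<le> lpp W' m n"
  using assms by (induction W m n rule: lpp.induct) (auto intro!: add_mono max.mono)

lemma lpp_cong:
  assumes "\<And>i j. 1 \<le> i \<Longrightarrow> i \<le> m \<Longrightarrow> 1 \<le> j \<Longrightarrow> j \<le> n \<Longrightarrow> W (i, j) = W' (i, j)"
  shows "lpp W m n = lpp W' m n"
  using assms by (intro antisym lpp_mono) auto

lemma lpp_le_boundary_lpp: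
  assumes "\<And>i j. i \<le> m \<Longrightarrow> j \<le> n \<Longrightarrow> V (i, j) \<ge> 0"
  shows "lpp V m n \<le> boundary_lpp V m n"
  using assms
  by (induction V m n rule: lpp.induct)
    (auto simp: boundary_lpp_axis intro!: add_mono max.mono sum_nonneg add_nonneg_nonneg)

lemma grid_induct [case_names left bottom step]:
  assumes "\<And>n. P 0 n" "\<And>m. P (Suc m) 0"
    and step: "\<And>m n. P m (Suc n) \<Longrightarrow> P (Suc m) n \<Longrightarrow> P (Suc m) (Suc n)"
  shows "P m n"
proof (induction m arbitrary: n)
  case (Suc m)
  show ?case by (induction n) (use assms Suc in auto)
qed (use assms in auto)

text \<open>The substitute for exit-point estimates. Either the optimal path leaves the axes by step \<open>k\<close>
  respectively \<open>l\<close>, and then removing its boundary part bounds the time by the first alternative; or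
  it stays longer on one axis, and then it also profits from the larger boundary weights of \<open>V1\<close> or
  \<open>V2\<close>. All three alternatives satisfy the last-passage recursion in the bulk, so only the axes need
  an argument.\<close>

lemma boundary_lpp_exit_bound:
  assumes nn: "\<And>i j. i \<le> m \<Longrightarrow> j \<le> n \<Longrightarrow> V (i, j) \<ge> 0"
    and bulk1: "\<And>i j. 1 \<le> i \<Longrightarrow> i \<le> m \<Longrightarrow> 1 \<le> j \<Longrightarrow> j \<le> n \<Longrightarrow> V1 (i, j) = V (i, j)"
    and bulk2: "\<And>i j. 1 \<le> i \<Longrightarrow> i \<le> m \<Longrightarrow> 1 \<le> j \<Longrightarrow> j \<le> n \<Longrightarrow> V2 (i, j) = V (i, j)"
    and ge1: "\<And>i. 1 \<le> i \<Longrightarrow> i \<le> m \<Longrightarrow> V (i, 0) \<le> V1 (i, 0)"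
    and ge2: "\<And>j. 1 \<le> j \<Longrightarrow> j \<le> n \<Longrightarrow> V (0, j) \<le> V2 (0, j)"
    and kl: "k \<le> m" "l \<le> n"
  shows "boundary_lpp V m n \<le> max (max (\<Sum>i=1..k. V (i, 0)) (\<Sum>j=1..l. V (0, j)) + lpp V m n)
     (max (boundary_lpp V1 m n - (\<Sum>i=1..k. V1 (i, 0) - V (i, 0)))
          (boundary_lpp V2 m n - (\<Sum>j=1..l. V2 (0, j) - V (0, j))))"
proof -
  define C where "C = max (\<Sum>i=1..k. V (i, 0)) (\<Sum>j=1..l. V (0, j))"
  define D1 where "D1 = (\<Sum>i=1..k. V1 (i, 0) - V (i, 0))"
  define D2 where "D2 = (\<Sum>j=1..l. V2 (0, j) - V (0, j))"
  have "boundary_lpp V m' n' \<le> max (C + lpp V m' n') (max (boundary_lpp V1 m' n' - D1) (boundary_lpp V2 m' n' - D2))"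
    if "m' \<le> m" "n' \<le> n" for m' n'
    using that
  proof (induction m' n' rule: grid_induct)
    case (step m' n')
    let ?w = "V (Suc m', Suc n')"
    have w: "V1 (Suc m', Suc n') = ?w" "V2 (Suc m', Suc n') = ?w"
      using step bulk1[of "Suc m'" "Suc n'"] bulk2[of "Suc m'" "Suc n'"] by auto
    \<comment> \<open>each alternative is compatible with adding a weight and with taking the larger predecessor\<close>
    have mono: "u + ?w \<le> max (C + (p + ?w)) (max (q + ?w - D1) (r + ?w - D2))"
      if "u \<le> max (C + p') (max (q' - D1) (r' - D2))" "p' \<le> p" "q' \<le> q" "r' \<le> r" for u p p' q q' r r'
      using that by (simp add: le_max_iff_disj) linarith
    have "boundary_lpp V m' (Suc n') + ?w \<le> max (C + lpp V (Suc m') (Suc n'))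
        (max (boundary_lpp V1 (Suc m') (Suc n') - D1) (boundary_lpp V2 (Suc m') (Suc n') - D2))"
      using step unfolding lpp.simps boundary_lpp.simps w by (intro mono[OF step(1)]) auto
    moreover have "boundary_lpp V (Suc m') n' + ?w \<le> max (C + lpp V (Suc m') (Suc n'))
        (max (boundary_lpp V1 (Suc m') (Suc n') - D1) (boundary_lpp V2 (Suc m') (Suc n') - D2))"
      using step unfolding lpp.simps boundary_lpp.simps w by (intro mono[OF step(2)]) auto
    ultimately show ?case by (simp only: boundary_lpp.simps(4) max_add_distrib_left max.bounded_iff)
  next
    case (bottom m')
    show ?case
    proof (cases "Suc m' \<le> k")
      case True
      then have "(\<Sum>i=1..Suc m'. V (i, 0)) \<le> (\<Sum>i=1..k. V (i, 0))"
        using kl by (intro sum_mono2) (auto intro!: nn)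
      then show ?thesis unfolding boundary_lpp_axis by (simp add: C_def)
    next
      case False
      then have "D1 \<le> (\<Sum>i=1..Suc m'. V1 (i, 0) - V (i, 0))"
        unfolding D1_def using bottom by (intro sum_mono2) (auto intro!: ge1)
      then show ?thesis unfolding boundary_lpp_axis by (auto simp: sum_subtractf)
    qed
  next
    case (left n')
    show ?case
    proof (cases "n' \<le> l")
      case True
      then have "(\<Sum>i=1..n'. V (0, i)) \<le> (\<Sum>i=1..l. V (0, i))"
        using kl by (intro sum_mono2) (auto intro!: nn)
      then show ?thesis unfolding boundary_lpp_axis by (simp add: C_def)
    next
      case False
      then have "D2 \<le> (\<Sum>i=1..n'. V2 (0, i) - V (0, i))"
        unfolding D2_def using left by (intro sum_mono2) (auto intro!: ge2)
      then show ?thesis unfolding boundary_lpp_axis by (auto simp: sum_subtractf)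
    qed
  qed
  from this[of m n] show ?thesis by (simp add: C_def D1_def D2_def)
qed

text \<open>Processing the squares of a row from left to right: after step \<open>i\<close>, slot \<open>(i', 0)\<close> with \<open>i' \<le> i\<close>
  holds the increment on the upper edge of square \<open>(i', j)\<close>, and slot \<open>(0, j)\<close> the increment on the
  right edge of square \<open>(i, j)\<close>.\<close>

fun process_row :: "nat \<Rightarrow> nat \<Rightarrow> (nat \<times> nat \<Rightarrow> real) \<Rightarrow> nat \<times> nat \<Rightarrow> real" where
  "process_row j 0 x = x"
| "process_row j (Suc i) x = queue_step (Suc i, 0) (0, j) (Suc i, j) (process_row j i x)"

fun process_rows :: "nat \<Rightarrow> nat \<Rightarrow> (nat \<times> nat \<Rightarrow> real) \<Rightarrow> nat \<times> nat \<Rightarrow> real" where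
  "process_rows m 0 x = x"
| "process_rows m (Suc j) x = process_row (Suc j) m (process_rows m j x)"

lemma process_row_other:
  assumes "j \<ge> 1"
  shows "i < i' \<Longrightarrow> process_row j i x (i', 0) = x (i', 0)"
    and "j' \<noteq> j \<Longrightarrow> j' \<ge> 1 \<Longrightarrow> process_row j i x (i', j') = x (i', j')"
    and "i < i' \<Longrightarrow> process_row j i x (i', j) = x (i', j)"
  using assms by (induction i) (auto simp: queue_step_def)

lemma process_rows_other:
  "j < j' \<Longrightarrow> process_rows m j x (i, j') = x (i, j')"
  by (induction j) (auto simp: process_row_other)

lemma process_row_increments:
  fixes x :: "nat \<times> nat \<Rightarrow> real"
  assumes y: "\<And>i. 1 \<le> i \<Longrightarrow> i \<le> m \<Longrightarrow> y (i, 0) = boundary_lpp x i j - boundary_lpp x (i - 1) j"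
    and y': "\<And>i. y (i, Suc j) = x (i, Suc j)"
  shows "i \<le> m \<Longrightarrow> process_row (Suc j) i y (0, Suc j) = boundary_lpp x i (Suc j) - boundary_lpp x i j"
    and "i \<le> m \<Longrightarrow> 1 \<le> i' \<Longrightarrow> i' \<le> i \<Longrightarrow>
      process_row (Suc j) i y (i', 0) = boundary_lpp x i' (Suc j) - boundary_lpp x (i' - 1) (Suc j)"
proof (induction i arbitrary: i')
  case 0
  { case 1 then show ?case using y' by simp }
  { case 2 then show ?case by simp }
next
  case (Suc i)
  let ?u = "process_row (Suc j) i y"
  have u: "?u (Suc i, 0) = boundary_lpp x (Suc i) j - boundary_lpp x i j"
    "?u (Suc i, Suc j) = x (Suc i, Suc j)" if "Suc i \<le> m"
    using that y[of "Suc i"] y' by (auto simp: process_row_other)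
  {
    case 1
    then show ?case using u Suc.IH(1) by (simp add: queue_step_def)
  next
    case 2
    show ?case
    proof (cases "i' = Suc i")
      case True
      then show ?thesis using 2 u Suc.IH(1) by (simp add: queue_step_def)
    next
      case False
      then show ?thesis using 2 Suc.IH(2)[of i'] by (simp add: queue_step_def)
    qed
  }
qed

lemma process_rows_increments:
  "1 \<le> i \<Longrightarrow> i \<le> m \<Longrightarrow> process_rows m j x (i, 0) = boundary_lpp x i j - boundary_lpp x (i - 1) j"
proof (induction j arbitrary: i)
  case 0
  then show ?case by (cases i) auto
next
  case (Suc j)
  have "process_row (Suc j) m (process_rows m j x) (i, 0)
      = boundary_lpp x i (Suc j) - boundary_lpp x (i - 1) (Suc j)"
    using Suc by (intro process_row_increments(2)[where m = m]) (auto simp: process_rows_other)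
  then show ?case by simp
qed

text \<open>Walking from the origin up the vertical axis and then along row \<open>n\<close> sees original boundary weights
  first and processed increments afterwards.\<close>

lemma boundary_lpp_eq_sum:
  "boundary_lpp x m n = (\<Sum>j=1..n. x (0, j)) + (\<Sum>i=1..m. process_rows m n x (i, 0))"
proof -
  have "(\<Sum>i=1..m. process_rows m n x (i, 0)) = (\<Sum>i=1..m. boundary_lpp x i n - boundary_lpp x (i - 1) n)"
    by (intro sum.cong) (auto simp: process_rows_increments)
  also have "\<dots> = boundary_lpp x m n - boundary_lpp x 0 n"
    by (induction m) auto
  finally show ?thesis by (simp add: boundary_lpp_axis)
qed

section \<open>Maxima over directed paths\<close>

text \<open>Splitting off the last site of a path; this matches the recursion of \<open>lpp\<close>.\<close>

lemma directed_path_Suc_cases: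
  assumes "directed_path u v \<pi>"
  shows "\<pi> = [v] \<and> u = v \<or> (\<exists>\<pi>' w. \<pi> = \<pi>' @ [v] \<and> directed_path u w \<pi>' \<and>
      (v = (fst w + 1, snd w) \<or> v = (fst w, snd w + 1)))"
proof (cases \<pi> rule: rev_cases)
  case Nil
  then show ?thesis using assms by (simp add: directed_path_def)
next
  case (snoc \<pi>' v')
  have v': "v' = v" using assms snoc by (simp add: directed_path_def)
  have step: "\<And>k. Suc k < length \<pi> \<Longrightarrow>
        \<pi> ! Suc k = (fst (\<pi> ! k) + 1, snd (\<pi> ! k)) \<or> \<pi> ! Suc k = (fst (\<pi> ! k), snd (\<pi> ! k) + 1)"
    using assms by (auto simp: directed_path_def)
  show ?thesis
  proof (cases "\<pi>' = []")
    case True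
    then show ?thesis using snoc v' assms by (simp add: directed_path_def)
  next
    case False
    have "directed_path u (last \<pi>') \<pi>'"
      unfolding directed_path_def
    proof (intro conjI allI impI)
      show "hd \<pi>' = u" using assms snoc False by (simp add: directed_path_def)
      fix k assume "Suc k < length \<pi>'"
      then show "\<pi>' ! Suc k = (fst (\<pi>' ! k) + 1, snd (\<pi>' ! k)) \<or> \<pi>' ! Suc k = (fst (\<pi>' ! k), snd (\<pi>' ! k) + 1)"
        using step[of k] snoc by (simp add: nth_append)
    qed (use False in auto)
    moreover have "v = (fst (last \<pi>') + 1, snd (last \<pi>')) \<or> v = (fst (last \<pi>'), snd (last \<pi>') + 1)"
      using step[of "length \<pi>' - 1"] snoc False v' by (auto simp: nth_append last_conv_nth)
    ultimately show ?thesis using snoc v' by blast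
  qed
qed

lemma directed_path_snoc:
  assumes "directed_path u w \<pi>" "v = (fst w + 1, snd w) \<or> v = (fst w, snd w + 1)"
  shows "directed_path u v (\<pi> @ [v])"
  unfolding directed_path_def
proof (intro conjI allI impI)
  fix k assume k: "Suc k < length (\<pi> @ [v])"
  show "(\<pi> @ [v]) ! Suc k = (fst ((\<pi> @ [v]) ! k) + 1, snd ((\<pi> @ [v]) ! k)) \<or>
        (\<pi> @ [v]) ! Suc k = (fst ((\<pi> @ [v]) ! k), snd ((\<pi> @ [v]) ! k) + 1)"
  proof (cases "Suc k < length \<pi>")
    case True
    then show ?thesis using assms(1) by (auto simp: directed_path_def nth_append)
  next
    case False
    then have "k = length \<pi> - 1" "\<pi> \<noteq> []" using k assms(1) by (auto simp: directed_path_def)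
    then show ?thesis using assms by (auto simp: directed_path_def nth_append last_conv_nth)
  qed
qed (use assms in \<open>auto simp: directed_path_def\<close>)

lemma directed_path_mem_le:
  assumes "directed_path u v \<pi>" "p \<in> set \<pi>"
  shows "fst u \<le> fst p \<and> snd u \<le> snd p \<and> fst p \<le> fst v \<and> snd p \<le> snd v"
  using assms
proof (induction \<pi> arbitrary: v p rule: rev_induct)
  case Nil
  then show ?case by simp
next
  case (snoc v' \<pi>)
  have v': "v' = v" using snoc.prems by (simp add: directed_path_def)
  from directed_path_Suc_cases[OF snoc.prems(1)] show ?case
  proof
    assume "\<exists>\<pi>' w. \<pi> @ [v'] = \<pi>' @ [v] \<and> directed_path u w \<pi>' \<and>
      (v = (fst w + 1, snd w) \<or> v = (fst w, snd w + 1))"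
    then obtain \<pi>' w where *: "\<pi> @ [v'] = \<pi>' @ [v]" "directed_path u w \<pi>'"
      "v = (fst w + 1, snd w) \<or> v = (fst w, snd w + 1)" by blast
    then have "\<pi>' = \<pi>" by simp
    have w: "w \<in> set \<pi>" using * \<open>\<pi>' = \<pi>\<close> by (auto simp: directed_path_def)
    show ?thesis
      using snoc.IH[of w p] snoc.IH[of w w] *(2,3) w snoc.prems(2) v' \<open>\<pi>' = \<pi>\<close>
      by (cases "p \<in> set \<pi>") (auto dest: le_SucI)
  qed (use snoc.prems in auto)
qed

lemma directed_path_length:
  "directed_path u v \<pi> \<Longrightarrow> length \<pi> + fst u + snd u = fst v + snd v + 1"
proof (induction \<pi> arbitrary: v rule: rev_induct)
  case Nil
  then show ?case by (simp add: directed_path_def)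
next
  case (snoc v' \<pi>)
  from directed_path_Suc_cases[OF snoc.prems] show ?case
  proof
    assume "\<exists>\<pi>' w. \<pi> @ [v'] = \<pi>' @ [v] \<and> directed_path u w \<pi>' \<and>
      (v = (fst w + 1, snd w) \<or> v = (fst w, snd w + 1))"
    then obtain w where w: "directed_path u w \<pi>" "v = (fst w + 1, snd w) \<or> v = (fst w, snd w + 1)"
      by auto
    show ?case using snoc.IH[OF w(1)] w(2) by auto
  qed auto
qed

lemma finite_directed_paths: "finite {\<pi>. directed_path u v \<pi>}"
proof (rule finite_subset)
  show "{\<pi>. directed_path u v \<pi>} \<subseteq> {\<pi>. set \<pi> \<subseteq> {..fst v} \<times> {..snd v} \<and> length \<pi> \<le> fst v + snd v + 1}"
  proof
    fix \<pi> assume "\<pi> \<in> {\<pi>. directed_path u v \<pi>}"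
    then have *: "directed_path u v \<pi>" by simp
    show "\<pi> \<in> {\<pi>. set \<pi> \<subseteq> {..fst v} \<times> {..snd v} \<and> length \<pi> \<le> fst v + snd v + 1}"
      using directed_path_length[OF *] directed_path_mem_le[OF *] by auto
  qed
  show "finite {\<pi>. set \<pi> \<subseteq> {..fst v} \<times> {..snd v} \<and> length \<pi> \<le> fst v + snd v + 1}"
    by (intro finite_lists_length_le) auto
qed

lemma directed_path_weight_le:
  assumes "\<And>p. p \<in> sites \<Longrightarrow> W p \<ge> 0" "directed_path (1, 1) (m, n) \<pi>"
  shows "(\<Sum>p\<in>set \<pi>. W p) \<le> lpp W m n"
  using assms(2)
proof (induction \<pi> arbitrary: m n rule: rev_induct)
  case Nil
  then show ?case by (simp add: directed_path_def)
next
  case (snoc v' \<pi>)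
  have v': "v' = (m, n)" using snoc.prems by (simp add: directed_path_def)
  have mn: "m \<ge> 1" "n \<ge> 1" using directed_path_mem_le[OF snoc.prems, of v'] v' by auto
  have nn: "lpp W m' n' \<ge> 0" for m' n' using assms(1) by (intro lpp_nonneg) auto
  from directed_path_Suc_cases[OF snoc.prems] show ?case
  proof (elim disjE exE conjE)
    assume "\<pi> @ [v'] = [(m, n)]" "(1, 1) = (m, n)"
    then show ?thesis using nn by (auto simp: numeral_eq_Suc)
  next
    fix \<pi>' w assume *: "\<pi> @ [v'] = \<pi>' @ [(m, n)]" "directed_path (1, 1) w \<pi>'" "(m, n) = (fst w + 1, snd w)"
    then have w: "w = (m - 1, n)" and [simp]: "\<pi>' = \<pi>" by (cases w, auto)
    have "v' \<notin> set \<pi>" using directed_path_mem_le[OF *(2), of v'] w v' mn by auto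
    then have "(\<Sum>p\<in>set (\<pi> @ [v']). W p) \<le> lpp W (m - 1) n + W (m, n)"
      using snoc.IH[of "m - 1" n] *(2) w v' by simp
    then show ?thesis using mn by (cases m; cases n) (auto simp: max_def)
  next
    fix \<pi>' w assume *: "\<pi> @ [v'] = \<pi>' @ [(m, n)]" "directed_path (1, 1) w \<pi>'" "(m, n) = (fst w, snd w + 1)"
    then have w: "w = (m, n - 1)" and [simp]: "\<pi>' = \<pi>" by (cases w, auto)
    have "v' \<notin> set \<pi>" using directed_path_mem_le[OF *(2), of v'] w v' mn by auto
    then have "(\<Sum>p\<in>set (\<pi> @ [v']). W p) \<le> lpp W m (n - 1) + W (m, n)"
      using snoc.IH[of m "n - 1"] *(2) w v' by simp
    then show ?thesis using mn by (cases m; cases n) (auto simp: max_def)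
  qed
qed

lemma directed_path_attains_lpp:
  "(\<And>p. p \<in> sites \<Longrightarrow> W p \<ge> 0) \<Longrightarrow> m \<ge> 1 \<Longrightarrow> n \<ge> 1 \<Longrightarrow> \<exists>\<pi>. directed_path (1, 1) (m, n) \<pi> \<and> (\<Sum>p\<in>set \<pi>. W p) = lpp W m n"
proof (induction W m n rule: lpp.induct)
  case (3 W m n)
  have nn: "lpp W m' n' \<ge> 0" for m' n' using 3(3) by (intro lpp_nonneg) auto
  have ext: ?case if "directed_path (1, 1) w \<pi>" "(\<Sum>p\<in>set \<pi>. W p) = max (lpp W m (Suc n)) (lpp W (Suc m) n)"
    "w = (m, Suc n) \<or> w = (Suc m, n)" for w \<pi>
  proof -
    have "(Suc m, Suc n) \<notin> set \<pi>" using directed_path_mem_le[OF that(1), of "(Suc m, Suc n)"] that(3) by auto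
    moreover have "directed_path (1, 1) (Suc m, Suc n) (\<pi> @ [(Suc m, Suc n)])"
      using that by (intro directed_path_snoc[OF that(1)]) auto
    ultimately show ?thesis using that(2) by (intro exI[of _ "\<pi> @ [(Suc m, Suc n)]"]) simp
  qed
  show ?case
  proof (cases "m = 0 \<and> n = 0")
    case True
    then show ?thesis by (intro exI[of _ "[(1, 1)]"]) (auto simp: directed_path_def)
  next
    case False
    have "\<exists>w \<pi>. directed_path (1, 1) w \<pi> \<and> (\<Sum>p\<in>set \<pi>. W p) = max (lpp W m (Suc n)) (lpp W (Suc m) n)
       \<and> (w = (m, Suc n) \<or> w = (Suc m, n))"
    proof (cases "m \<ge> 1 \<and> (lpp W m (Suc n) \<ge> lpp W (Suc m) n \<or> n = 0)")
      case True
      then have "max (lpp W m (Suc n)) (lpp W (Suc m) n) = lpp W m (Suc n)"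
        using nn[of m "Suc n"] by (auto simp: max_def)
      then show ?thesis using 3(1)[OF 3(3)] True by fastforce
    next
      case F: False
      then have "n \<ge> 1" and "max (lpp W m (Suc n)) (lpp W (Suc m) n) = lpp W (Suc m) n"
        using nn[of "Suc m" n] False by (auto simp: max_def not_le)
      then show ?thesis using 3(2)[OF 3(3)] by fastforce
    qed
    then show ?thesis using ext by blast
  qed
qed auto

lemma last_passage_eq_lpp:
  assumes "\<And>p. p \<in> sites \<Longrightarrow> W p \<ge> 0" "m \<ge> 1" "n \<ge> 1"
  shows "last_passage W m n = lpp W m n"
  unfolding last_passage_def
proof (rule Max_eqI)
  show "finite ((\<lambda>\<pi>. \<Sum>p\<in>set \<pi>. W p) ` {\<pi>. directed_path (1, 1) (m, n) \<pi>})"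
    by (intro finite_imageI finite_directed_paths)
  show "lpp W m n \<in> (\<lambda>\<pi>. \<Sum>p\<in>set \<pi>. W p) ` {\<pi>. directed_path (1, 1) (m, n) \<pi>}"
    using directed_path_attains_lpp[OF assms(1), where m=m and n=n] assms(2,3) by force
qed (use directed_path_weight_le[OF assms(1)] in auto)

section \<open>Concentration of the boundary model\<close>

lemma exponential_law_moments:
  assumes "r > 0"
  shows "integrable (exponential_law r) (\<lambda>x. x - 1 / r)"
    and "(\<integral>x. x - 1 / r \<partial>exponential_law r) = 0"
    and "integrable (exponential_law r) (\<lambda>x. (x - 1 / r)\<^sup>2)"
    and "(\<integral>x. (x - 1 / r)\<^sup>2 \<partial>exponential_law r) = 1 / r\<^sup>2"
proof -
  interpret prob_space "exponential_law r" using assms by (rule prob_space_exponential_law)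
  have D: "distributed (exponential_law r) lborel (\<lambda>x. x) (exponential_density r)"
    by (auto simp: distributed_def distr_id2)
  have 1: "integrable (exponential_law r) (\<lambda>x. x)" "integrable (exponential_law r) (\<lambda>x. x\<^sup>2)"
    using erlang_ith_moment_integrable[OF assms D, of 1] erlang_ith_moment_integrable[OF assms D, of 2] by auto
  have E: "expectation (\<lambda>x. x) = 1 / r"
    using erlang_ith_moment[OF assms D, of 1] by simp
  show "integrable (exponential_law r) (\<lambda>x. x - 1 / r)" using 1 by simp
  show "integrable (exponential_law r) (\<lambda>x. (x - 1 / r)\<^sup>2)" using 1 by (simp add: power2_diff)
  show "(\<integral>x. x - 1 / r \<partial>exponential_law r) = 0" using 1 E prob_space by simp
  show "(\<integral>x. (x - 1 / r)\<^sup>2 \<partial>exponential_law r) = 1 / r\<^sup>2"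
    using exponential_distributed_variance[OF assms D] E by simp
qed

lemma product_prob_space_exponential:
  assumes "\<And>k. r k > 0"
  shows "product_prob_space (\<lambda>k. exponential_law (r k))"
  using prob_space_exponential_law[OF assms]
  by (simp add: product_prob_space_def product_prob_space_axioms_def product_sigma_finite_def
      prob_space_imp_sigma_finite)

lemma measurable_PiM_exponential [simp]:
  "measurable (\<Pi>\<^sub>M k\<in>J. exponential_law (r k)) N = measurable (\<Pi>\<^sub>M k\<in>J. borel) N"
  by (intro measurable_cong_sets sets_PiM_cong) auto

text \<open>Off-diagonal terms vanish because the centred coordinates are independent; both kinds of terms are
  computed as integrals of products over all coordinates, with factor \<open>1\<close> at the other coordinates.\<close>

lemma exponential_sum_second_moment:
  assumes r: "\<And>k. r k > 0" and K: "finite K" and J: "J \<subseteq> K"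
  shows "integrable (\<Pi>\<^sub>M k\<in>K. exponential_law (r k)) (\<lambda>x. (\<Sum>k\<in>J. x k - 1 / r k)\<^sup>2)" (is "integrable ?M _")
    and "(\<integral>x. (\<Sum>k\<in>J. x k - 1 / r k)\<^sup>2 \<partial>(\<Pi>\<^sub>M k\<in>K. exponential_law (r k))) = (\<Sum>k\<in>J. 1 / (r k)\<^sup>2)"
proof -
  interpret product_prob_space "\<lambda>k. exponential_law (r k)"
    using r by (rule product_prob_space_exponential)
  have finJ: "finite J" using K J finite_subset by blast
  have cross: "integrable ?M (\<lambda>x. (x k - 1 / r k) * (x l - 1 / r l)) \<and>
      (\<integral>x. (x k - 1 / r k) * (x l - 1 / r l) \<partial>?M) = (if k = l then 1 / (r k)\<^sup>2 else 0)"
    if "k \<in> J" "l \<in> J" for k l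
  proof (cases "k = l")
    case True
    let ?f = "\<lambda>i y. if i = k then (y - 1 / r k)\<^sup>2 else 1"
    have eq: "(\<Prod>i\<in>K. ?f i (x i)) = (x k - 1 / r k) * (x l - 1 / r l)" for x :: "'a \<Rightarrow> real"
      using K J that True by (simp add: prod.delta power2_eq_square subset_iff)
    have int: "integrable (exponential_law (r i)) (?f i)" for i
      using exponential_law_moments(3)[OF r[of k]]
        prob_space.finite_measure[OF prob_space_exponential_law[OF r[of i]]]
      by (cases "i = k") (auto intro!: finite_measure.integrable_const)
    have val: "(\<integral>y. ?f i y \<partial>exponential_law (r i)) = (if i = k then 1 / (r k)\<^sup>2 else 1)" for i
      using exponential_law_moments(4)[OF r[of k]] prob_space.prob_space[OF prob_space_exponential_law[OF r[of i]]]
      by auto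
    have "(\<Prod>i\<in>K. (if i = k then 1 / (r k)\<^sup>2 else 1)) = 1 / (r k)\<^sup>2"
      using K J that by (simp add: prod.delta subset_iff)
    then show ?thesis
      using product_integrable_prod[OF K int] product_integral_prod[OF K int] True
      unfolding eq val by simp
  next
    case False
    let ?f = "\<lambda>i y. if i = k \<or> i = l then y - 1 / r i else 1"
    have "(\<Prod>i\<in>K. ?f i (x i)) = (\<Prod>i\<in>{k, l}. ?f i (x i))" for x :: "'a \<Rightarrow> real"
      using K J that by (intro prod.mono_neutral_right) auto
    then have eq: "(\<Prod>i\<in>K. ?f i (x i)) = (x k - 1 / r k) * (x l - 1 / r l)" for x :: "'a \<Rightarrow> real"
      using False by simp
    have int: "integrable (exponential_law (r i)) (?f i)" for i
      using exponential_law_moments(1)[OF r[of i]]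
        prob_space.finite_measure[OF prob_space_exponential_law[OF r[of i]]]
      by (cases "i = k \<or> i = l") (auto intro!: finite_measure.integrable_const)
    have val: "(\<integral>y. ?f i y \<partial>exponential_law (r i)) = (if i = k \<or> i = l then 0 else 1)" for i
      using exponential_law_moments(2)[OF r[of i]] prob_space.prob_space[OF prob_space_exponential_law[OF r[of i]]]
      by (cases "i = k \<or> i = l") auto
    have "(\<Prod>i\<in>K. (if i = k \<or> i = l then 0 else 1 :: real)) = 0"
      using K J that by (auto intro!: prod_zero)
    then show ?thesis
      using product_integrable_prod[OF K int] product_integral_prod[OF K int] False
      unfolding eq val by simp
  qed
  have eq: "(\<Sum>k\<in>J. x k - 1 / r k)\<^sup>2 = (\<Sum>k\<in>J. \<Sum>l\<in>J. (x k - 1 / r k) * (x l - 1 / r l))" for x :: "'a \<Rightarrow> real"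
    by (simp add: power2_eq_square sum_product)
  show "integrable ?M (\<lambda>x. (\<Sum>k\<in>J. x k - 1 / r k)\<^sup>2)"
    unfolding eq using cross by (intro Bochner_Integration.integrable_sum) auto
  have "(\<integral>x. (\<Sum>k\<in>J. x k - 1 / r k)\<^sup>2 \<partial>?M)
      = (\<Sum>k\<in>J. \<integral>x. (\<Sum>l\<in>J. (x k - 1 / r k) * (x l - 1 / r l)) \<partial>?M)"
    unfolding eq using cross
    by (intro Bochner_Integration.integral_sum Bochner_Integration.integrable_sum) auto
  also have "\<dots> = (\<Sum>k\<in>J. \<Sum>l\<in>J. \<integral>x. (x k - 1 / r k) * (x l - 1 / r l) \<partial>?M)"
    using cross by (intro sum.cong refl Bochner_Integration.integral_sum) auto
  also have "\<dots> = (\<Sum>k\<in>J. \<Sum>l\<in>J. if k = l then 1 / (r k)\<^sup>2 else 0)"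
    using cross by (intro sum.cong refl) auto
  also have "\<dots> = (\<Sum>k\<in>J. 1 / (r k)\<^sup>2)" using finJ by simp
  finally show "(\<integral>x. (\<Sum>k\<in>J. x k - 1 / r k)\<^sup>2 \<partial>?M) = (\<Sum>k\<in>J. 1 / (r k)\<^sup>2)" .
qed

lemma exponential_sum_concentration:
  assumes r: "\<And>k. r k > 0" and K: "finite K" and J: "J \<subseteq> K"
    and c: "c > 0" "\<And>k. k \<in> J \<Longrightarrow> r k \<ge> c" and e: "e > 0"
  shows "measure (\<Pi>\<^sub>M k\<in>K. exponential_law (r k))
     {x \<in> space (\<Pi>\<^sub>M k\<in>K. borel). \<bar>(\<Sum>k\<in>J. x k) - (\<Sum>k\<in>J. 1 / r k)\<bar> \<ge> e} \<le> card J / (c\<^sup>2 * e\<^sup>2)"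
proof -
  let ?M = "\<Pi>\<^sub>M k\<in>K. exponential_law (r k)"
  interpret P: prob_space ?M
    by (intro prob_space_PiM prob_space_exponential_law r)
  let ?S = "\<lambda>x. \<Sum>k\<in>J. x k - 1 / r k"
  have [measurable]: "(\<lambda>x. x k) \<in> borel_measurable (\<Pi>\<^sub>M k\<in>K. (borel :: real measure))" if "k \<in> J" for k
    using that J by (intro measurable_component_singleton) auto
  have S: "?S \<in> borel_measurable ?M" by simp
  have sp: "space (\<Pi>\<^sub>M k\<in>K. borel) = space ?M" by (simp add: space_PiM)
  have set_eq: "{x \<in> space (\<Pi>\<^sub>M k\<in>K. borel). \<bar>(\<Sum>k\<in>J. x k) - (\<Sum>k\<in>J. 1 / r k)\<bar> \<ge> e}
     = {x \<in> space ?M. e\<^sup>2 \<le> (?S x)\<^sup>2}"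
    unfolding sp using e by (auto simp: sum_subtractf abs_le_square_iff[symmetric])
  have "P.prob {x \<in> space ?M. e\<^sup>2 \<le> (?S x)\<^sup>2} \<le> P.expectation (\<lambda>x. (?S x)\<^sup>2) / e\<^sup>2"
    using e exponential_sum_second_moment(1)[OF r K J]
    by (intro integral_Markov_inequality_measure[where A = "space ?M"]) auto
  also have "\<dots> \<le> (\<Sum>k\<in>J. 1 / c\<^sup>2) / e\<^sup>2"
    unfolding exponential_sum_second_moment(2)[OF r K J]
    using c by (intro divide_right_mono sum_mono frac_le power_mono) auto
  also have "\<dots> = card J / (c\<^sup>2 * e\<^sup>2)" by simp
  finally show ?thesis unfolding set_eq .
qed

text \<open>The boundary increments of row \<open>n'\<close> are coordinates of a configuration with the same product law as
  the original one. The additivity of the rates is what Burke's theorem requires in each square.\<close>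

lemma distr_process_rows:
  fixes r :: "nat \<times> nat \<Rightarrow> real"
  assumes r: "\<And>k. r k > 0"
    and add: "\<And>i j. 1 \<le> i \<Longrightarrow> 1 \<le> j \<Longrightarrow> r (i, j) = r (i, 0) + r (0, j)"
    and n': "n' \<le> n"
  shows "process_rows m n' \<in> (\<Pi>\<^sub>M k\<in>{..m} \<times> {..n}. borel) \<rightarrow>\<^sub>M (\<Pi>\<^sub>M k\<in>{..m} \<times> {..n}. borel)
    \<and> distr (\<Pi>\<^sub>M k\<in>{..m} \<times> {..n}. exponential_law (r k)) (\<Pi>\<^sub>M k\<in>{..m} \<times> {..n}. borel) (process_rows m n')
     = (\<Pi>\<^sub>M k\<in>{..m} \<times> {..n}. exponential_law (r k))" (is "?P (process_rows m n')")
proof -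
  let ?B = "\<Pi>\<^sub>M k\<in>{..m} \<times> {..n}. (borel :: real measure)" and ?E = "\<Pi>\<^sub>M k\<in>{..m} \<times> {..n}. exponential_law (r k)"
  have id: "?P (\<lambda>x. x)" by (auto intro!: distr_id2 sets_PiM_cong)
  have comp: "?P (\<lambda>x. f (g x))" if f: "?P f" and g: "?P g" for f g
  proof
    show "(\<lambda>x. f (g x)) \<in> ?B \<rightarrow>\<^sub>M ?B" using f g by (auto intro: measurable_compose)
    have "distr ?E ?B (\<lambda>x. f (g x)) = distr (distr ?E ?B g) ?B f"
      using f g by (subst distr_distr) (auto simp: comp_def)
    then show "distr ?E ?B (\<lambda>x. f (g x)) = ?E" using f g by simp
  qed
  have row: "?P (process_row j i)" if "1 \<le> j" "j \<le> n" "i \<le> m" for i j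
    using that(3)
  proof (induction i)
    case 0
    then show ?case using id by simp
  next
    case (Suc i)
    have "?P (queue_step (Suc i, 0) (0, j) (Suc i, j))"
      using Suc that r add[of "Suc i" j]
      by (intro conjI measurable_queue_step queue_step_preserves) auto
    then show ?case using comp[of "queue_step (Suc i, 0) (0, j) (Suc i, j)" "process_row j i"] Suc by simp
  qed
  show ?thesis using n'
  proof (induction n')
    case 0
    then show ?case using id by simp
  next
    case (Suc n')
    then show ?case using comp[of "process_row (Suc n') m" "process_rows m n'"] row[of "Suc n'" m] by simp
  qed
qed

lemma boundary_lpp_measurable:
  "m' \<le> m \<Longrightarrow> n' \<le> n \<Longrightarrow> (\<lambda>x. boundary_lpp x m' n') \<in> borel_measurable (\<Pi>\<^sub>M k\<in>{..m} \<times> {..n}. borel)"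
proof (induction m' n' rule: grid_induct)
  case (left n')
  then show ?case unfolding boundary_lpp_axis
    by (intro borel_measurable_sum measurable_component_singleton) auto
next
  case (bottom m')
  then show ?case unfolding boundary_lpp_axis
    by (intro borel_measurable_sum measurable_component_singleton) auto
next
  case (step m' n')
  then show ?case unfolding boundary_lpp.simps
    by (intro borel_measurable_add borel_measurable_max measurable_component_singleton) auto
qed

text \<open>Chebyshev's inequality for the two sums of independent exponentials that make up the time: the
  vertical axis of the configuration and the horizontal slots of the processed configuration. The two
  sums are dependent, hence the union bound.\<close>

lemma boundary_lpp_concentration:
  fixes r :: "nat \<times> nat \<Rightarrow> real"
  assumes r: "\<And>k. r k > 0"
    and add: "\<And>i j. 1 \<le> i \<Longrightarrow> 1 \<le> j \<Longrightarrow> r (i, j) = r (i, 0) + r (0, j)"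
    and c: "c > 0" "\<And>i. 1 \<le> i \<Longrightarrow> r (i, 0) \<ge> c" "\<And>j. 1 \<le> j \<Longrightarrow> r (0, j) \<ge> c" and e: "e > 0"
  shows "measure (\<Pi>\<^sub>M k\<in>{..m} \<times> {..n}. exponential_law (r k))
     {x \<in> space (\<Pi>\<^sub>M k\<in>{..m} \<times> {..n}. borel).
        \<bar>boundary_lpp x m n - ((\<Sum>i=1..m. 1 / r (i, 0)) + (\<Sum>j=1..n. 1 / r (0, j)))\<bar> \<ge> 2 * e}
     \<le> (m + n) / (c\<^sup>2 * e\<^sup>2)"
proof -
  let ?B = "\<Pi>\<^sub>M k\<in>{..m} \<times> {..n}. (borel :: real measure)" and ?E = "\<Pi>\<^sub>M k\<in>{..m} \<times> {..n}. exponential_law (r k)"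
  interpret P: prob_space ?E
    by (intro prob_space_PiM prob_space_exponential_law r)
  let ?H = "(\<lambda>i. (i, 0)) ` {1..m}" and ?V = "Pair 0 ` {1..n}"
  let ?A = "\<lambda>J. {x \<in> space ?B. \<bar>(\<Sum>k\<in>J. x k) - (\<Sum>k\<in>J. 1 / r k)\<bar> \<ge> e}"
  have HV: "?H \<subseteq> {..m} \<times> {..n}" "?V \<subseteq> {..m} \<times> {..n}" by auto
  have card: "card ?H = m" "card ?V = n"
    by (auto simp: card_image inj_on_def)
  have sum_H: "(\<Sum>k\<in>?H. f k) = (\<Sum>i=1..m. f (i, 0))" and sum_V: "(\<Sum>k\<in>?V. f k) = (\<Sum>j=1..n. f (0, j))"
    for f :: "nat \<times> nat \<Rightarrow> real"
    by (subst sum.reindex; auto simp: inj_on_def)+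
  have [measurable]: "(\<lambda>x. x k) \<in> borel_measurable ?B" if "k \<in> {..m} \<times> {..n}" for k
    using that by (intro measurable_component_singleton) auto
  have A_sets: "?A J \<in> sets ?B" if "J \<subseteq> {..m} \<times> {..n}" for J
  proof -
    have [measurable]: "(\<lambda>x. (\<Sum>k\<in>J. x k)) \<in> borel_measurable ?B"
      using that by (intro borel_measurable_sum measurable_component_singleton) auto
    show ?thesis by measurable
  qed
  have sets_eq: "sets ?E = sets ?B" by (intro sets_PiM_cong) auto
  have sp: "space ?E = space ?B" by (simp add: space_PiM)
  have "P.prob (?A J) \<le> card J / (c\<^sup>2 * e\<^sup>2)" if "J = ?H \<or> J = ?V" for J
    using that c by (intro exponential_sum_concentration r e) (auto simp: c)
  from this[of ?H] this[of ?V]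
  have bound: "P.prob (?A ?H) \<le> m / (c\<^sup>2 * e\<^sup>2)" "P.prob (?A ?V) \<le> n / (c\<^sup>2 * e\<^sup>2)"
    unfolding card by blast+
  note rows = distr_process_rows[of r n n m, OF r add order_refl]
  let ?A' = "process_rows m n -` ?A ?H \<inter> space ?B"
  have A'_sets: "?A' \<in> sets ?B" using rows A_sets[OF HV(1)] by (intro measurable_sets[of _ ?B ?B]) auto
  have "P.prob ?A' = measure (distr ?E ?B (process_rows m n)) (?A ?H)"
    using rows A_sets[OF HV(1)] by (subst measure_distr) (auto simp: sp)
  also have "\<dots> = P.prob (?A ?H)" using rows by simp
  finally have A': "P.prob ?A' \<le> m / (c\<^sup>2 * e\<^sup>2)" using bound(1) by linarith
  have "P.prob {x \<in> space ?B. \<bar>boundary_lpp x m n - ((\<Sum>i=1..m. 1 / r (i, 0)) + (\<Sum>j=1..n. 1 / r (0, j)))\<bar> \<ge> 2 * e}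
      \<le> P.prob (?A' \<union> ?A ?V)"
  proof (rule P.finite_measure_mono)
    show "?A' \<union> ?A ?V \<in> P.events" using A'_sets A_sets[OF HV(2)] by (auto simp: sets_eq)
    show "{x \<in> space ?B. \<bar>boundary_lpp x m n - ((\<Sum>i=1..m. 1 / r (i, 0)) + (\<Sum>j=1..n. 1 / r (0, j)))\<bar> \<ge> 2 * e} \<subseteq> ?A' \<union> ?A ?V"
    proof
      fix x assume "x \<in> {x \<in> space ?B. \<bar>boundary_lpp x m n - ((\<Sum>i=1..m. 1 / r (i, 0)) + (\<Sum>j=1..n. 1 / r (0, j)))\<bar> \<ge> 2 * e}"
      then have x: "x \<in> space ?B"
        "\<bar>boundary_lpp x m n - ((\<Sum>i=1..m. 1 / r (i, 0)) + (\<Sum>j=1..n. 1 / r (0, j)))\<bar> \<ge> 2 * e" by auto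
      have "process_rows m n x \<in> space ?B" using rows x(1) measurable_space[of "process_rows m n" ?B ?B x] by auto
      then show "x \<in> ?A' \<union> ?A ?V"
        using x unfolding sum_H sum_V boundary_lpp_eq_sum by auto
    qed
  qed
  also have "\<dots> \<le> P.prob ?A' + P.prob (?A ?V)"
    using A'_sets A_sets[OF HV(2)] by (intro measure_Un_le) (auto simp: sets_eq)
  also have "\<dots> \<le> m / (c\<^sup>2 * e\<^sup>2) + n / (c\<^sup>2 * e\<^sup>2)"
    using A' bound(2) by (intro add_mono) auto
  finally show ?thesis by (simp add: add_divide_distrib)
qed

section \<open>Quenched tail bounds for last-passage times\<close>

lemma distr_exponential_scale:
  assumes "r > 0"
  shows "distr (exponential_law 1) borel (\<lambda>x. x / r) = exponential_law r"
proof -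
  interpret prob_space "exponential_law 1" by (rule prob_space_exponential_law) simp
  have "distributed (exponential_law 1) lborel (\<lambda>x. x) (exponential_density 1)"
    by (auto simp: distributed_def distr_id2)
  from erlang_distributed_mult_const[OF this, of "1 / r"] assms
  have "distributed (exponential_law 1) lborel (\<lambda>x. x / r) (exponential_density r)" by simp
  then have "distr (exponential_law 1) lborel (\<lambda>x. x / r) = exponential_law r"
    by (simp add: distributed_def)
  then show ?thesis by (simp cong: distr_cong)
qed

text \<open>Realising all rates on one space of unit exponentials couples the models with different parameters
  monotonically.\<close>

lemma distr_PiM_exponential_scale:
  assumes r: "\<And>k. r k > 0" and K: "finite K"
  shows "distr (\<Pi>\<^sub>M k\<in>K. exponential_law 1) (\<Pi>\<^sub>M k\<in>K. borel) (\<lambda>x. \<lambda>k\<in>K. x k / r k)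
     = (\<Pi>\<^sub>M k\<in>K. exponential_law (r k))"
proof -
  interpret R: product_prob_space "\<lambda>k. exponential_law (r k)"
    by (rule product_prob_space_exponential[OF r])
  interpret U: product_prob_space "\<lambda>k. exponential_law 1"
    by (rule product_prob_space_exponential) simp
  let ?f = "\<lambda>x. \<lambda>k\<in>K. x k / r k"
  have f: "?f \<in> (\<Pi>\<^sub>M k\<in>K. borel) \<rightarrow>\<^sub>M (\<Pi>\<^sub>M k\<in>K. (borel :: real measure))"
    by measurable
  show ?thesis
  proof (rule R.PiM_eqI[OF K])
    show "sets (distr (\<Pi>\<^sub>M k\<in>K. exponential_law 1) (\<Pi>\<^sub>M k\<in>K. borel) ?f) = sets (\<Pi>\<^sub>M k\<in>K. exponential_law (r k))"
      by (auto intro!: sets_PiM_cong)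
    fix A assume A: "\<And>k. k \<in> K \<Longrightarrow> A k \<in> sets (exponential_law (r k))"
    have PiA: "Pi\<^sub>E K A \<in> sets (\<Pi>\<^sub>M k\<in>K. (borel :: real measure))"
      using A K by (intro sets_PiM_I_finite) auto
    have "?f -` Pi\<^sub>E K A \<inter> space (\<Pi>\<^sub>M k\<in>K. exponential_law 1) = (\<Pi>\<^sub>E k\<in>K. (\<lambda>x. x / r k) -` A k)"
      by (auto simp: space_PiM PiE_iff)
    then have "emeasure (distr (\<Pi>\<^sub>M k\<in>K. exponential_law 1) (\<Pi>\<^sub>M k\<in>K. borel) ?f) (Pi\<^sub>E K A)
       = emeasure (\<Pi>\<^sub>M k\<in>K. exponential_law 1) (\<Pi>\<^sub>E k\<in>K. (\<lambda>x. x / r k) -` A k)"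
      using f PiA by (simp add: emeasure_distr)
    also have "\<dots> = (\<Prod>k\<in>K. emeasure (exponential_law 1) ((\<lambda>x. x / r k) -` A k))"
      using A K by (intro U.emeasure_PiM) (auto intro!: measurable_sets_borel[of _ borel])
    also have "\<dots> = (\<Prod>k\<in>K. emeasure (exponential_law (r k)) (A k))"
    proof (rule prod.cong[OF refl])
      fix k assume "k \<in> K"
      then have "A k \<in> sets borel" using A by simp
      then show "emeasure (exponential_law 1) ((\<lambda>x. x / r k) -` A k) = emeasure (exponential_law (r k)) (A k)"
        unfolding distr_exponential_scale[OF r, symmetric] by (subst emeasure_distr) auto
    qed
    finally show "emeasure (distr (\<Pi>\<^sub>M k\<in>K. exponential_law 1) (\<Pi>\<^sub>M k\<in>K. borel) ?f) (Pi\<^sub>E K A)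
       = (\<Prod>k\<in>K. emeasure (exponential_law (r k)) (A k))" .
  qed
qed

lemma AE_PiM_exponential_nonneg:
  assumes "\<And>k. r k > 0" "countable K"
  shows "AE x in (\<Pi>\<^sub>M k\<in>K. exponential_law (r k)). \<forall>k\<in>K. x k \<ge> 0"
proof (subst AE_ball_countable[OF assms(2)], intro ballI)
  fix k assume k: "k \<in> K"
  interpret product_prob_space "\<lambda>k. exponential_law (r k)"
    by (rule product_prob_space_exponential[OF assms(1)])
  have "AE y in exponential_law (r k). y \<ge> 0"
    by (subst AE_density) (auto simp: exponential_density_def)
  then show "AE x in (\<Pi>\<^sub>M k\<in>K. exponential_law (r k)). x k \<ge> 0"
    by (intro AE_PiM_component[OF _ k] prob_space_exponential_law assms(1))
qed

text \<open>The value at the origin, whose weight never enters, only has to be positive.\<close>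

definition boundary_rate :: "(nat \<Rightarrow> real) \<Rightarrow> (nat \<Rightarrow> real) \<Rightarrow> real \<Rightarrow> nat \<times> nat \<Rightarrow> real" where
  "boundary_rate a b z = (\<lambda>(i, j). if i = 0 then (if j = 0 then 1 else b j - z)
     else if j = 0 then a i + z else a i + b j)"

definition stationary_mean :: "(nat \<Rightarrow> real) \<Rightarrow> (nat \<Rightarrow> real) \<Rightarrow> real \<Rightarrow> nat \<Rightarrow> nat \<Rightarrow> real" where
  "stationary_mean a b z m n = (\<Sum>i=1..m. 1 / (a i + z)) + (\<Sum>j=1..n. 1 / (b j - z))"

lemma boundary_rate_simps [simp]:
  "1 \<le> i \<Longrightarrow> boundary_rate a b z (i, 0) = a i + z"
  "1 \<le> j \<Longrightarrow> boundary_rate a b z (0, j) = b j - z"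
  "1 \<le> i \<Longrightarrow> 1 \<le> j \<Longrightarrow> boundary_rate a b z (i, j) = a i + b j"
  by (auto simp: boundary_rate_def)

lemma boundary_rate_pos:
  assumes "\<And>i. 1 \<le> i \<Longrightarrow> a i + z > 0" "\<And>j. 1 \<le> j \<Longrightarrow> b j - z > 0"
  shows "boundary_rate a b z k > 0"
proof -
  obtain i j where k: "k = (i, j)" by (cases k)
  show ?thesis using assms(1)[of i] assms(2)[of j] by (auto simp: boundary_rate_def k)
qed

lemma lpp_measurable:
  "{1..m} \<times> {1..n} \<subseteq> K \<Longrightarrow> (\<lambda>x. lpp x m n) \<in> borel_measurable (\<Pi>\<^sub>M k\<in>K. borel)"
proof (induction m n rule: grid_induct)
  case (step m n)
  have "{1..m} \<times> {1..Suc n} \<subseteq> K" "{1..Suc m} \<times> {1..n} \<subseteq> K" "(Suc m, Suc n) \<in> K"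
    using step(3) by auto
  then show ?case unfolding lpp.simps using step
    by (intro borel_measurable_add borel_measurable_max measurable_component_singleton) auto
qed simp_all

lemma distr_lpp_restrict:
  assumes r: "\<And>k. r k > 0" and K: "{1..m} \<times> {1..n} \<subseteq> K"
  shows "distr (\<Pi>\<^sub>M k\<in>K. exponential_law (r k)) borel (\<lambda>x. lpp x m n)
       = distr (\<Pi>\<^sub>M k\<in>{1..m} \<times> {1..n}. exponential_law (r k)) borel (\<lambda>x. lpp x m n)"
proof -
  let ?J = "{1..m} \<times> {1..n}"
  interpret product_prob_space "\<lambda>k. exponential_law (r k)" K
    by (rule product_prob_space_exponential[OF r])
  have restr: "distr (\<Pi>\<^sub>M k\<in>K. exponential_law (r k)) (\<Pi>\<^sub>M k\<in>?J. exponential_law (r k)) (\<lambda>x. restrict x ?J)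
     = (\<Pi>\<^sub>M k\<in>?J. exponential_law (r k))"
    by (rule distr_PiM_restrict_finite) (use K in auto)
  have m: "(\<lambda>x. restrict x ?J) \<in> (\<Pi>\<^sub>M k\<in>K. exponential_law (r k)) \<rightarrow>\<^sub>M (\<Pi>\<^sub>M k\<in>?J. exponential_law (r k))"
    by (rule measurable_restrict_subset[OF K])
  have "distr (\<Pi>\<^sub>M k\<in>?J. exponential_law (r k)) borel (\<lambda>x. lpp x m n)
      = distr (distr (\<Pi>\<^sub>M k\<in>K. exponential_law (r k)) (\<Pi>\<^sub>M k\<in>?J. exponential_law (r k)) (\<lambda>x. restrict x ?J)) borel (\<lambda>x. lpp x m n)"
    unfolding restr ..
  also have "\<dots> = distr (\<Pi>\<^sub>M k\<in>K. exponential_law (r k)) borel (\<lambda>x. lpp (restrict x ?J) m n)"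
    using m lpp_measurable[of m n ?J] by (subst distr_distr) (simp_all add: comp_def)
  also have "(\<lambda>x. lpp (restrict x ?J) m n) = (\<lambda>x. lpp x m n)"
    by (intro ext lpp_cong) auto
  finally show ?thesis ..
qed

lemma distr_lpp_quenched:
  assumes ab: "\<And>i. 1 \<le> i \<Longrightarrow> a i > 0" "\<And>j. 1 \<le> j \<Longrightarrow> b j > 0"
    and r: "\<And>k. r k > 0" "\<And>i j. 1 \<le> i \<Longrightarrow> 1 \<le> j \<Longrightarrow> r (i, j) = a i + b j"
  shows "distr (quenched_law (a, b)) borel (\<lambda>W. lpp W m n)
       = distr (\<Pi>\<^sub>M k\<in>{..m} \<times> {..n}. exponential_law (r k)) borel (\<lambda>x. lpp x m n)"
proof -
  have "quenched_law (a, b) = (\<Pi>\<^sub>M k\<in>sites. exponential_law (r k))"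
    unfolding quenched_law_def prod.case by (intro PiM_cong refl) (auto simp: r(2))
  then show ?thesis
    using distr_lpp_restrict[OF r(1), of m n sites] distr_lpp_restrict[OF r(1), of m n "{..m} \<times> {..n}"]
    by (force simp: subset_iff)
qed

lemma AE_quenched_nonneg:
  assumes ab: "\<And>i. 1 \<le> i \<Longrightarrow> a i > 0" "\<And>j. 1 \<le> j \<Longrightarrow> b j > 0"
  shows "AE W in quenched_law (a, b). \<forall>p\<in>sites. W p \<ge> 0"
proof -
  have r: "boundary_rate (\<lambda>i. a i) (\<lambda>j. b j) 0 k > 0" for k
    by (rule boundary_rate_pos) (use ab in auto)
  have "quenched_law (a, b) = (\<Pi>\<^sub>M k\<in>sites. exponential_law (boundary_rate a b 0 k))"
    unfolding quenched_law_def prod.case by (intro PiM_cong refl) auto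
  then show ?thesis by (simp only:) (rule AE_PiM_exponential_nonneg[OF r], simp)
qed

lemma sets_quenched_law: "sets (quenched_law ab) = sets (\<Pi>\<^sub>M p\<in>sites. borel)"
  unfolding quenched_law_def by (cases ab) (auto intro!: sets_PiM_cong)

lemma prob_space_quenched_law:
  assumes ab: "\<And>i. 1 \<le> i \<Longrightarrow> a i > 0" "\<And>j. 1 \<le> j \<Longrightarrow> b j > 0"
  shows "prob_space (quenched_law (a, b))"
  unfolding quenched_law_def prod.case
  using ab by (intro prob_space_PiM) (auto intro!: prob_space_exponential_density add_pos_pos)

lemma lpp_measurable_quenched:
  "(\<lambda>W. lpp W m n) \<in> borel_measurable (quenched_law ab)"
  unfolding measurable_cong_sets[OF sets_quenched_law refl] by (rule lpp_measurable) auto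

lemma measure_quenched_lpp:
  assumes ab: "\<And>i. 1 \<le> i \<Longrightarrow> a i > 0" "\<And>j. 1 \<le> j \<Longrightarrow> b j > 0"
    and r: "\<And>k. r k > 0" "\<And>i j. 1 \<le> i \<Longrightarrow> 1 \<le> j \<Longrightarrow> r (i, j) = a i + b j"
    and A: "A \<in> sets borel"
  shows "measure (quenched_law (a, b)) {W \<in> space (quenched_law (a, b)). lpp W m n \<in> A}
       = measure (\<Pi>\<^sub>M k\<in>{..m} \<times> {..n}. exponential_law (r k))
           {x \<in> space (\<Pi>\<^sub>M k\<in>{..m} \<times> {..n}. borel). lpp x m n \<in> A}"
proof -
  have "measure (distr (quenched_law (a, b)) borel (\<lambda>W. lpp W m n)) A
      = measure (distr (\<Pi>\<^sub>M k\<in>{..m} \<times> {..n}. exponential_law (r k)) borel (\<lambda>x. lpp x m n)) A"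
    by (subst distr_lpp_quenched[where r = r, OF ab r]) auto
  moreover have "(\<lambda>x. lpp x m n) \<in> borel_measurable (\<Pi>\<^sub>M k\<in>{..m} \<times> {..n}. borel)"
    by (rule lpp_measurable) auto
  ultimately show ?thesis
    using A by (subst (asm) (1 2) measure_distr)
      (auto simp: vimage_def Int_def conj_commute space_PiM intro: lpp_measurable_quenched)
qed

text \<open>The boundary model dominates the bulk model because additional nonnegative weights are available.\<close>

lemma quenched_upper_tail:
  assumes ab: "\<And>i. 1 \<le> i \<Longrightarrow> a i > 0" "\<And>j. 1 \<le> j \<Longrightarrow> b j > 0"
    and c: "c > 0" "\<And>i. 1 \<le> i \<Longrightarrow> a i + z \<ge> c" "\<And>j. 1 \<le> j \<Longrightarrow> b j - z \<ge> c" and e: "e > 0"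
  shows "measure (quenched_law (a, b)) {W \<in> space (quenched_law (a, b)). lpp W m n \<ge> stationary_mean a b z m n + 2 * e}
     \<le> (m + n) / (c\<^sup>2 * e\<^sup>2)"
proof -
  let ?r = "boundary_rate a b z"
  let ?B = "\<Pi>\<^sub>M k\<in>{..m} \<times> {..n}. (borel :: real measure)" and ?E = "\<Pi>\<^sub>M k\<in>{..m} \<times> {..n}. exponential_law (?r k)"
  have r: "?r k > 0" for k
    using less_le_trans[OF c(1) c(2)] less_le_trans[OF c(1) c(3)] by (intro boundary_rate_pos) auto
  interpret P: prob_space ?E
    by (intro prob_space_PiM prob_space_exponential_law r)
  let ?A = "{stationary_mean a b z m n + 2 * e..}"
  let ?S = "{x \<in> space ?B. \<bar>boundary_lpp x m n - stationary_mean a b z m n\<bar> \<ge> 2 * e}"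
  have sets_eq: "sets ?E = sets ?B" by (intro sets_PiM_cong) auto
  have [measurable]: "(\<lambda>x. boundary_lpp x m n) \<in> borel_measurable ?B" by (rule boundary_lpp_measurable) auto
  have S: "?S \<in> P.events" unfolding sets_eq by measurable
  have mean: "stationary_mean a b z m n = (\<Sum>i=1..m. 1 / ?r (i, 0)) + (\<Sum>j=1..n. 1 / ?r (0, j))"
    unfolding stationary_mean_def by (intro arg_cong2[where f="(+)"] sum.cong) auto
  have "measure (quenched_law (a, b)) {W \<in> space (quenched_law (a, b)). lpp W m n \<in> ?A}
     = P.prob {x \<in> space ?B. lpp x m n \<in> ?A}"
    by (rule measure_quenched_lpp[OF ab r]) auto
  also have "\<dots> \<le> P.prob ?S"
  proof (rule P.finite_measure_mono_AE[OF _ S])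
    have "AE x in ?E. \<forall>k\<in>{..m} \<times> {..n}. 0 \<le> x k"
      by (rule AE_PiM_exponential_nonneg[OF r]) (rule countable_finite, simp)
    then show "AE x in ?E. x \<in> {x \<in> space ?B. lpp x m n \<in> ?A} \<longrightarrow> x \<in> ?S"
    proof (eventually_elim, intro impI)
      fix x assume *: "\<forall>k\<in>{..m} \<times> {..n}. 0 \<le> x k" "x \<in> {x \<in> space ?B. lpp x m n \<in> ?A}"
      then have "lpp x m n \<le> boundary_lpp x m n" by (intro lpp_le_boundary_lpp) auto
      then show "x \<in> ?S" using * by auto
    qed
  qed
  also have "\<dots> \<le> (m + n) / (c\<^sup>2 * e\<^sup>2)"
    unfolding mean of_nat_add by (rule boundary_lpp_concentration[where r = ?r, OF r]) (use c e in auto)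
  finally show ?thesis by simp
qed


lemma measure_Un_bound:
  assumes "A \<in> sets M \<and> measure M A \<le> p * d" "B \<in> sets M \<and> measure M B \<le> q * (d::real)"
  shows "A \<union> B \<in> sets M \<and> measure M (A \<union> B) \<le> (p + q) * d"
  using measure_Un_le[of A M B] assms by (auto simp: algebra_simps)

text \<open>The two gap conditions make the last two alternatives of \<open>boundary_lpp_exit_bound\<close> impossible unless
  one of seven quantities is at least \<open>e\<close> or \<open>2 * e\<close> away from its mean: three boundary times and four
  partial sums along the axes. The rates \<open>a'\<close>, \<open>b'\<close> may exceed \<open>a\<close>, \<open>b\<close> since larger rates mean
  smaller weights.\<close>

lemma quenched_lower_tail:
  assumes ab: "\<And>i. 1 \<le> i \<Longrightarrow> a i > 0" "\<And>j. 1 \<le> j \<Longrightarrow> b j > 0"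
    and ab': "\<And>i. 1 \<le> i \<Longrightarrow> a i \<le> a' i" "\<And>j. 1 \<le> j \<Longrightarrow> b j \<le> b' j"
    and w: "w1 \<le> z" "z \<le> w2"
    and c: "c > 0" "\<And>i. 1 \<le> i \<Longrightarrow> a' i + w1 \<ge> c" "\<And>j. 1 \<le> j \<Longrightarrow> b' j - w2 \<ge> c" and e: "e > 0"
    and kl: "k \<le> m" "l \<le> n"
    and gap1: "stationary_mean a' b' w1 m n + 6 * e
      < stationary_mean a' b' z m n + ((\<Sum>i=1..k. 1 / (a' i + w1)) - (\<Sum>i=1..k. 1 / (a' i + z)))"
    and gap2: "stationary_mean a' b' w2 m n + 6 * e
      < stationary_mean a' b' z m n + ((\<Sum>j=1..l. 1 / (b' j - w2)) - (\<Sum>j=1..l. 1 / (b' j - z)))"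
  shows "measure (quenched_law (a, b)) {W \<in> space (quenched_law (a, b)).
       lpp W m n \<le> stationary_mean a' b' z m n - max (\<Sum>i=1..k. 1 / (a' i + z)) (\<Sum>j=1..l. 1 / (b' j - z)) - 3 * e}
     \<le> 7 * ((m + n) / (c\<^sup>2 * e\<^sup>2))"
proof -
  let ?G = "{..m} \<times> {..n}"
  let ?ra = "boundary_rate a b 0" and ?r = "boundary_rate a' b' z"
  let ?rv = "boundary_rate a' b' w1" and ?rw = "boundary_rate a' b' w2"
  let ?B = "\<Pi>\<^sub>M k\<in>?G. (borel :: real measure)"
  let ?U = "\<Pi>\<^sub>M k\<in>?G. exponential_law 1"
  let ?E = "\<lambda>r. \<Pi>\<^sub>M k\<in>?G. exponential_law (r k)"
  define V where "V r x = (\<lambda>k\<in>?G. x k / r k)" for r x :: "nat \<times> nat \<Rightarrow> real"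
  define d where "d = (m + n) / (c\<^sup>2 * e\<^sup>2)"
  define t where "t = stationary_mean a' b' z m n - max (\<Sum>i=1..k. 1 / (a' i + z)) (\<Sum>j=1..l. 1 / (b' j - z)) - 3 * e"
  interpret U: prob_space ?U
    by (intro prob_space_PiM prob_space_exponential_law) auto
  have sets_eq: "sets ?U = sets ?B" by (intro sets_PiM_cong) auto
  have sp: "space ?U = space ?B" "space (?E r) = space ?B" for r by (simp_all add: space_PiM)
  have ge_c: "c \<le> a' i + y" "c \<le> b' j - y" if "1 \<le> i" "1 \<le> j" "w1 \<le> y" "y \<le> w2" for i j y
    using c(2)[OF that(1)] c(3)[OF that(2)] that by auto
  have r0: "?ra k > 0" for k
    using ab by (intro boundary_rate_pos) auto
  have r_pos: "boundary_rate a' b' y k > 0" if "w1 \<le> y" "y \<le> w2" for y k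
    using less_le_trans[OF c(1) ge_c(1)[OF _ order_refl that]] less_le_trans[OF c(1) ge_c(2)[OF order_refl _ that]]
    by (intro boundary_rate_pos) auto
  have V_meas: "V r \<in> ?B \<rightarrow>\<^sub>M ?B" for r
    unfolding V_def by measurable
  have V_prob: "U.prob {x \<in> space ?B. V r x \<in> S} = measure (?E r) S"
    if "\<And>k. r k > 0" "S \<in> sets ?B" for r S
  proof -
    have "measure (?E r) S = measure (distr ?U ?B (V r)) S"
      unfolding V_def by (subst distr_PiM_exponential_scale[where r = r, OF that(1)]) auto
    also have "\<dots> = U.prob {x \<in> space ?B. V r x \<in> S}"
      using V_meas[of r] that(2) by (subst measure_distr) (auto simp: vimage_def Int_def conj_commute sp)
    finally show ?thesis ..
  qed
  have V_sets: "{x \<in> space ?B. V r x \<in> S} \<in> sets ?U" if "S \<in> sets ?B" for r S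
    unfolding sets_eq using measurable_sets[OF V_meas that, of r]
    by (simp add: vimage_def Int_def conj_commute)
  have [measurable]: "(\<lambda>x. boundary_lpp x m n) \<in> borel_measurable ?B" by (rule boundary_lpp_measurable) auto
  have lpp_meas: "(\<lambda>x. lpp x m n) \<in> borel_measurable ?B" by (rule lpp_measurable) auto
  define L where "L y = {x \<in> space ?B. V (boundary_rate a' b' y) x \<in>
      {x \<in> space ?B. \<bar>boundary_lpp x m n - stationary_mean a' b' y m n\<bar> \<ge> 2 * e}}" for y
  define S where "S y J = {x \<in> space ?B. V (boundary_rate a' b' y) x \<in>
      {x \<in> space ?B. \<bar>(\<Sum>k\<in>J. x k) - (\<Sum>k\<in>J. 1 / boundary_rate a' b' y k)\<bar> \<ge> e}}" for y J
  have L: "L y \<in> sets ?U" "U.prob (L y) \<le> 1 * d" if y: "w1 \<le> y" "y \<le> w2" for y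
  proof -
    have meas: "{x \<in> space ?B. \<bar>boundary_lpp x m n - stationary_mean a' b' y m n\<bar> \<ge> 2 * e} \<in> sets ?B"
      by measurable
    show "L y \<in> sets ?U" unfolding L_def by (rule V_sets[OF meas])
    have mean: "stationary_mean a' b' y m n = (\<Sum>i=1..m. 1 / boundary_rate a' b' y (i, 0)) + (\<Sum>j=1..n. 1 / boundary_rate a' b' y (0, j))"
      unfolding stationary_mean_def by (intro arg_cong2[where f="(+)"] sum.cong) auto
    have "U.prob (L y) = measure (?E (boundary_rate a' b' y))
       {x \<in> space ?B. \<bar>boundary_lpp x m n - stationary_mean a' b' y m n\<bar> \<ge> 2 * e}"
      unfolding L_def by (rule V_prob[OF r_pos[OF y] meas])
    also have "\<dots> \<le> d"
      unfolding mean d_def of_nat_add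
      by (rule boundary_lpp_concentration[where r = "boundary_rate a' b' y", OF r_pos[OF y]]) (use ge_c[OF _ _ y] c e in auto)
    finally show "U.prob (L y) \<le> 1 * d" by simp
  qed
  have S: "S y J \<in> sets ?U" "U.prob (S y J) \<le> 1 * d"
    if y: "w1 \<le> y" "y \<le> w2" and J: "J = (\<lambda>i. (i, 0)) ` {1..k} \<or> J = Pair 0 ` {1..l}" for y J
  proof -
    have JG: "J \<subseteq> ?G" using J kl by auto
    have [measurable]: "(\<lambda>x. \<Sum>k\<in>J. x k) \<in> borel_measurable ?B"
      using JG by (intro borel_measurable_sum measurable_component_singleton) auto
    have meas: "{x \<in> space ?B. \<bar>(\<Sum>k\<in>J. x k) - (\<Sum>k\<in>J. 1 / boundary_rate a' b' y k)\<bar> \<ge> e} \<in> sets ?B"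
      by measurable
    show "S y J \<in> sets ?U" unfolding S_def by (rule V_sets[OF meas])
    have card: "card J \<le> m + n" using J kl by (auto simp: card_image inj_on_def)
    have "U.prob (S y J) = measure (?E (boundary_rate a' b' y))
       {x \<in> space ?B. \<bar>(\<Sum>k\<in>J. x k) - (\<Sum>k\<in>J. 1 / boundary_rate a' b' y k)\<bar> \<ge> e}"
      unfolding S_def by (rule V_prob[OF r_pos[OF y] meas])
    also have "\<dots> \<le> card J / (c\<^sup>2 * e\<^sup>2)"
      by (rule exponential_sum_concentration[where r = "boundary_rate a' b' y", OF r_pos[OF y]]) (use J JG ge_c[OF _ _ y] c e in auto)
    also have "\<dots> \<le> d" unfolding d_def using card by (intro divide_right_mono) auto
    finally show "U.prob (S y J) \<le> 1 * d" by simp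
  qed
  let ?H = "(\<lambda>i. (i, 0)) ` {1..k}" and ?K = "Pair 0 ` {1..l}"
  have sum_H: "(\<Sum>k\<in>?H. f k) = (\<Sum>i=1..k. f (i, 0))" and sum_K: "(\<Sum>k\<in>?K. f k) = (\<Sum>j=1..l. f (0, j))"
    for f :: "nat \<times> nat \<Rightarrow> real"
    by (subst sum.reindex; auto simp: inj_on_def)+
  define bad where "bad = L z \<union> L w1 \<union> L w2 \<union> S z ?H \<union> S w1 ?H \<union> S z ?K \<union> S w2 ?K"
  have "bad \<in> sets ?U \<and> U.prob bad \<le> (1 + 1 + 1 + 1 + 1 + 1 + 1) * d"
    unfolding bad_def using w
    by (intro measure_Un_bound conjI[OF L] conjI[OF S]) auto
  then have bad: "bad \<in> sets ?U" "U.prob bad \<le> 7 * d" by auto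
  have "measure (quenched_law (a, b)) {W \<in> space (quenched_law (a, b)). lpp W m n \<in> {..t}}
     = measure (?E ?ra) {x \<in> space ?B. lpp x m n \<in> {..t}}"
    by (rule measure_quenched_lpp[where r = ?ra, OF ab r0]) auto
  also have "\<dots> = U.prob {x \<in> space ?B. V ?ra x \<in> {x \<in> space ?B. lpp x m n \<in> {..t}}}"
    using lpp_meas by (intro V_prob[OF r0, symmetric]) measurable
  also have "\<dots> \<le> U.prob bad"
  proof (rule U.finite_measure_mono_AE[OF _ bad(1)])
    have nn_AE: "AE x in ?U. \<forall>k\<in>?G. 0 \<le> x k"
      by (rule AE_PiM_exponential_nonneg) (auto intro: countable_finite)
    show "AE x in ?U. x \<in> {x \<in> space ?B. V ?ra x \<in> {x \<in> space ?B. lpp x m n \<in> {..t}}} \<longrightarrow> x \<in> bad"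
    proof (rule AE_mp[OF nn_AE], intro AE_I2 impI, rule ccontr)
      fix x assume nn: "\<forall>k\<in>?G. 0 \<le> x k" and x: "x \<in> {x \<in> space ?B. V ?ra x \<in> {x \<in> space ?B. lpp x m n \<in> {..t}}}"
        and good: "x \<notin> bad"
      have xB: "x \<in> space ?B" and le_t: "lpp (V ?ra x) m n \<le> t" using x by auto
      have VB: "V r x \<in> space ?B" for r using measurable_space[OF V_meas xB] .
      have Lg: "\<bar>boundary_lpp (V (boundary_rate a' b' y) x) m n - stationary_mean a' b' y m n\<bar> < 2 * e"
        if "y \<in> {z, w1, w2}" for y
        using good xB VB that unfolding bad_def L_def by auto
      have Sg: "\<bar>(\<Sum>i=1..k. V (boundary_rate a' b' y) x (i, 0)) - (\<Sum>i=1..k. 1 / (a' i + y))\<bar> < e"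
        if "y \<in> {z, w1}" for y
        using good xB VB that unfolding bad_def S_def sum_H by auto
      have Kg: "\<bar>(\<Sum>j=1..l. V (boundary_rate a' b' y) x (0, j)) - (\<Sum>j=1..l. 1 / (b' j - y))\<bar> < e"
        if "y \<in> {z, w2}" for y
        using good xB VB that unfolding bad_def S_def sum_K by auto
      have "boundary_lpp (V ?r x) m n
          \<le> max (max (\<Sum>i=1..k. V ?r x (i, 0)) (\<Sum>j=1..l. V ?r x (0, j)) + lpp (V ?r x) m n)
            (max (boundary_lpp (V ?rv x) m n - (\<Sum>i=1..k. V ?rv x (i, 0) - V ?r x (i, 0)))
              (boundary_lpp (V ?rw x) m n - (\<Sum>j=1..l. V ?rw x (0, j) - V ?r x (0, j))))"
      proof (rule boundary_lpp_exit_bound)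
        fix i j assume "i \<le> m" "j \<le> n"
        then show "V ?r x (i, j) \<ge> 0" using nn r_pos[OF w] by (auto simp: V_def intro!: divide_nonneg_pos)
      next
        fix i assume i: "1 \<le> i" "i \<le> m"
        then show "V ?r x (i, 0) \<le> V ?rv x (i, 0)"
          using nn w ge_c(1)[of i 1 w1] c(1) by (auto simp: V_def intro!: divide_left_mono mult_pos_pos)
      next
        fix j assume j: "1 \<le> j" "j \<le> n"
        then show "V ?r x (0, j) \<le> V ?rw x (0, j)"
          using nn w ge_c(2)[of 1 j w2] c(1) by (auto simp: V_def intro!: divide_left_mono mult_pos_pos)
      qed (use kl in \<open>auto simp: V_def\<close>)
      moreover have "lpp (V ?r x) m n \<le> lpp (V ?ra x) m n"
      proof (rule lpp_mono)
        fix i j assume "1 \<le> i" "i \<le> m" "1 \<le> j" "j \<le> n"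
        then show "V ?r x (i, j) \<le> V ?ra x (i, j)"
          using nn ab(1)[of i] ab(2)[of j] ab'(1)[of i] ab'(2)[of j]
          by (auto simp: V_def intro!: divide_left_mono mult_pos_pos)
      qed
      moreover have "(\<Sum>i=1..k. V ?r x (i, 0)) < (\<Sum>i=1..k. 1 / (a' i + z)) + e"
        "(\<Sum>j=1..l. V ?r x (0, j)) < (\<Sum>j=1..l. 1 / (b' j - z)) + e"
        using Sg[of z] Kg[of z] by (simp_all add: abs_less_iff)
      then have "max (\<Sum>i=1..k. V ?r x (i, 0)) (\<Sum>j=1..l. V ?r x (0, j))
          < max (\<Sum>i=1..k. 1 / (a' i + z)) (\<Sum>j=1..l. 1 / (b' j - z)) + e"
        by (auto simp: max_def)
      moreover have "boundary_lpp (V ?r x) m n > stationary_mean a' b' z m n - 2 * e"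
        using Lg[of z] by (simp add: abs_less_iff)
      moreover have "boundary_lpp (V ?rv x) m n - (\<Sum>i=1..k. V ?rv x (i, 0) - V ?r x (i, 0))
          < stationary_mean a' b' z m n - 2 * e"
        using Lg[of w1] Sg[of w1] Sg[of z] gap1 unfolding sum_subtractf abs_less_iff by simp
      moreover have "boundary_lpp (V ?rw x) m n - (\<Sum>j=1..l. V ?rw x (0, j) - V ?r x (0, j))
          < stationary_mean a' b' z m n - 2 * e"
        using Lg[of w2] Kg[of w2] Kg[of z] gap2 unfolding sum_subtractf abs_less_iff by simp
      ultimately show False
        using le_t unfolding t_def le_max_iff_disj by linarith
    qed
  qed
  finally show ?thesis using bad(2) unfolding t_def d_def by simp
qed

section \<open>The ergodic theorem\<close>

text \<open>\<open>max_partial_sum T f n\<close> is the maximum of the first \<open>n\<close> ergodic sums and \<open>0\<close>; the recursion is the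
  form in which it enters the maximal inequality.\<close>

fun max_partial_sum :: "('a \<Rightarrow> 'a) \<Rightarrow> ('a \<Rightarrow> real) \<Rightarrow> nat \<Rightarrow> 'a \<Rightarrow> real" where
  "max_partial_sum T f 0 x = 0"
| "max_partial_sum T f (Suc n) x = max 0 (f x + max_partial_sum T f n (T x))"

abbreviation ergodic_sum :: "('a \<Rightarrow> 'a) \<Rightarrow> ('a \<Rightarrow> real) \<Rightarrow> nat \<Rightarrow> 'a \<Rightarrow> real" where
  "ergodic_sum T f n x \<equiv> \<Sum>i<n. f ((T ^^ i) x)"

lemma ergodic_sum_Suc: "ergodic_sum T f (Suc n) x = f x + ergodic_sum T f n (T x)"
  by (simp only: sum.lessThan_Suc_shift funpow_Suc_right comp_apply funpow.simps(1) id_apply)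

lemma max_partial_sum_mono: "max_partial_sum T f n x \<le> max_partial_sum T f (Suc n) x"
proof (induction n arbitrary: x)
  case (Suc n)
  show ?case
    unfolding max_partial_sum.simps(2)[of T f n x] max_partial_sum.simps(2)[of T f "Suc n" x]
    by (intro max.mono add_left_mono order_refl Suc)
qed simp

lemma ergodic_sum_le_max_partial_sum: "ergodic_sum T f n x \<le> max_partial_sum T f n x"
proof (induction n arbitrary: x)
  case (Suc n)
  show ?case unfolding ergodic_sum_Suc using Suc[of "T x"] by (simp add: le_max_iff_disj)
qed simp

lemma max_partial_sum_nonneg: "max_partial_sum T f n x \<ge> 0"
  by (cases n) auto

declare max_partial_sum.simps(2) [simp del]

context prob_space begin

lemma integrable_max_partial_sum:
  assumes T: "T \<in> M \<rightarrow>\<^sub>M M" "distr M M T = M" and f: "integrable M f"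
  shows "integrable M (max_partial_sum T f n)"
proof (induction n)
  case (Suc n)
  have "integrable M (\<lambda>x. max_partial_sum T f n (T x))"
    using Suc T by (intro integrable_distr[OF T(1)]) simp
  then show ?case using f unfolding max_partial_sum.simps by (intro integrable_max) auto
qed simp

text \<open>Garsia's argument: where the maximum \<open>m\<close> is positive, \<open>f\<close> is at least \<open>m - m \<circ> T\<close>, elsewhere
  \<open>m - m \<circ> T\<close> is nonpositive, and its integral vanishes by invariance.\<close>

lemma maximal_ergodic_inequality:
  assumes T: "T \<in> M \<rightarrow>\<^sub>M M" "distr M M T = M" and f: "integrable M f"
  shows "(\<integral>x. indicator {x \<in> space M. max_partial_sum T f (Suc n) x > 0} x * f x \<partial>M) \<ge> 0"
proof -
  let ?m = "max_partial_sum T f (Suc n)"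
  let ?E = "{x \<in> space M. ?m x > 0}"
  have m: "integrable M ?m" by (rule integrable_max_partial_sum[OF T f])
  then have mT: "integrable M (\<lambda>x. ?m (T x))"
    using T by (intro integrable_distr[OF T(1)]) simp
  have E: "?E \<in> sets M" using borel_measurable_integrable[OF m] by measurable
  have "0 = (\<integral>x. ?m x \<partial>M) - (\<integral>x. ?m x \<partial>distr M M T)" by (simp add: T)
  also have "\<dots> = (\<integral>x. ?m x - ?m (T x) \<partial>M)"
    using m mT T(1) by (subst integral_distr) auto
  also have "\<dots> \<le> (\<integral>x. indicator ?E x * f x \<partial>M)"
  proof (rule integral_mono)
    show "integrable M (\<lambda>x. ?m x - ?m (T x))" using m mT by simp
    show "integrable M (\<lambda>x. indicator ?E x * f x)" 
      using integrable_real_mult_indicator[OF E f] by (simp add: mult.commute)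
    fix x assume x: "x \<in> space M"
    show "?m x - ?m (T x) \<le> indicator ?E x * f x"
    proof (cases "?m x > 0")
      case True
      then show ?thesis using x max_partial_sum_mono[of T f n "T x"] by (auto simp: max_partial_sum.simps(2)[of T f n x] max_def split: if_splits)
    next
      case False
      then show ?thesis using max_partial_sum_nonneg[of T f "Suc n" x] max_partial_sum_nonneg[of T f "Suc n" "T x"] by auto
    qed
  qed
  finally show ?thesis .
qed

text \<open>The event that the sums are unbounded above is exactly invariant, not only up to null sets, so
  ergodicity applies to it as it stands. If it had probability one, the maximal inequality would give
  a nonnegative mean in the limit.\<close>

lemma ergodic_sum_bounded_above:
  assumes erg: "ergodic_under M T" and f: "integrable M f" and neg: "(\<integral>x. f x \<partial>M) < 0"
  shows "AE x in M. \<exists>k::nat. \<forall>n. ergodic_sum T f n x \<le> k"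
proof -
  have T [measurable]: "T \<in> M \<rightarrow>\<^sub>M M" and TM: "distr M M T = M"
    and inv: "\<And>A. A \<in> sets M \<Longrightarrow> T -` A \<inter> space M = A \<Longrightarrow> prob A = 0 \<or> prob A = 1"
    using erg by (auto simp: ergodic_under_def)
  have [measurable]: "f \<in> borel_measurable M" using f by simp
  have [measurable]: "(T ^^ i) \<in> M \<rightarrow>\<^sub>M M" for i by (rule measurable_compose_n) (rule T)
  let ?A = "{x \<in> space M. \<forall>k::nat. \<exists>n. ergodic_sum T f n x > k}"
  have A: "?A \<in> sets M" by measurable
  have shift: "(\<forall>k::nat. \<exists>n. ergodic_sum T f n (T x) > k) \<longleftrightarrow> (\<forall>k::nat. \<exists>n. ergodic_sum T f n x > k)" for x
  proof safe
    fix k :: nat assume *: "\<forall>k::nat. \<exists>n. ergodic_sum T f n (T x) > k"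
    obtain k' :: nat where k': "k' \<ge> k - f x" using real_arch_simple by blast
    from * obtain n where "ergodic_sum T f n (T x) > k'" by blast
    then have "ergodic_sum T f (Suc n) x > k" unfolding ergodic_sum_Suc using k' by linarith
    then show "\<exists>n. ergodic_sum T f n x > k" ..
  next
    fix k :: nat assume *: "\<forall>k::nat. \<exists>n. ergodic_sum T f n x > k"
    obtain k' :: nat where k': "k' \<ge> k + f x" using real_arch_simple by blast
    from * obtain n where n: "ergodic_sum T f n x > max k' 0" by (metis max_0R)
    then obtain n' where "n = Suc n'" by (cases n) auto
    then have "ergodic_sum T f n' (T x) > k" using n k' unfolding ergodic_sum_Suc by (auto simp: ergodic_sum_Suc simp del: sum.lessThan_Suc)
    then show "\<exists>n. ergodic_sum T f n (T x) > k" ..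
  qed
  have "T -` ?A \<inter> space M = ?A"
    using shift measurable_space[OF T] by auto
  from inv[OF A this] have "prob ?A = 0"
  proof
    assume 1: "prob ?A = 1"
    let ?E = "\<lambda>n. {x \<in> space M. max_partial_sum T f (Suc n) x > 0}"
    have [measurable]: "max_partial_sum T f n \<in> borel_measurable M" for n
      using integrable_max_partial_sum[OF T TM f] by simp
    have "AE x in M. x \<in> ?A" using 1 A by (simp add: prob_eq_1)
    then have conv: "AE x in M. (\<lambda>n. indicator (?E n) x * f x) \<longlonglongrightarrow> f x"
    proof eventually_elim
      fix x assume x: "x \<in> ?A"
      then obtain n where "ergodic_sum T f n x > real 0" by blast
      then have n: "max_partial_sum T f n x > 0" using ergodic_sum_le_max_partial_sum[where T = T and f = f and n = n and x = x] by simp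
      have "max_partial_sum T f n x \<le> max_partial_sum T f n' x" if "n \<le> n'" for n'
        by (rule lift_Suc_mono_le[OF _ that, of "\<lambda>n. max_partial_sum T f n x"]) (rule max_partial_sum_mono)
      then have "x \<in> ?E n'" if "n \<le> n'" for n'
        using n x that by (auto intro: less_le_trans)
      then have "\<forall>\<^sub>F n' in sequentially. indicator (?E n') x * f x = f x"
        unfolding eventually_sequentially by (intro exI[of _ n]) auto
      then show "(\<lambda>n. indicator (?E n) x * f x) \<longlonglongrightarrow> f x" by (rule tendsto_eventually)
    qed
    have "(\<lambda>n. \<integral>x. indicator (?E n) x * f x \<partial>M) \<longlonglongrightarrow> (\<integral>x. f x \<partial>M)"
      by (rule integral_dominated_convergence[where w = "\<lambda>x. \<bar>f x\<bar>"])
        (use conv f in \<open>auto simp: indicator_def\<close>)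
    then have "(\<integral>x. f x \<partial>M) \<ge> 0"
      by (rule LIMSEQ_le_const) (use maximal_ergodic_inequality[OF T TM f] in auto)
    then show ?thesis using neg by simp
  qed
  then have "AE x in M. x \<notin> ?A"
    using A by (intro AE_not_in) (auto simp: null_sets_def emeasure_eq_measure)
  then show ?thesis by (rule AE_mp) (auto simp: not_less intro!: AE_I2)
qed

lemma ergodic_average_le:
  assumes erg: "ergodic_under M T" and f: "integrable M f" and e: "e > 0"
  shows "AE x in M. \<forall>\<^sub>F n in sequentially. ergodic_sum T f n x / n < (\<integral>x. f x \<partial>M) + e"
proof -
  let ?c = "(\<integral>x. f x \<partial>M) + e / 2"
  have "AE x in M. \<exists>k::nat. \<forall>n. ergodic_sum T (\<lambda>x. f x - ?c) n x \<le> k"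
    using f e by (intro ergodic_sum_bounded_above[OF erg]) (auto simp: prob_space)
  then show ?thesis
  proof eventually_elim
    fix x assume "\<exists>k::nat. \<forall>n. ergodic_sum T (\<lambda>x. f x - ?c) n x \<le> k"
    then obtain k :: nat where k: "\<And>n. ergodic_sum T (\<lambda>x. f x - ?c) n x \<le> k" by blast
    have "\<forall>\<^sub>F n::nat in sequentially. real k < n * (e / 2)"
      using e by real_asymp
    then show "\<forall>\<^sub>F n in sequentially. ergodic_sum T f n x / n < (\<integral>x. f x \<partial>M) + e"
      using eventually_gt_at_top[of 0]
    proof eventually_elim
      case (elim n)
      have "ergodic_sum T f n x - n * ?c \<le> k" using k[of n] by (simp add: sum_subtractf)
      then have "ergodic_sum T f n x < n * ((\<integral>x. f x \<partial>M) + e)" using elim by (simp add: algebra_simps)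
      then show ?case using elim by (simp add: divide_less_eq mult.commute)
    qed
  qed
qed

theorem ergodic_average_tendsto:
  assumes erg: "ergodic_under M T" and f: "integrable M f"
  shows "AE x in M. (\<lambda>n. ergodic_sum T f n x / n) \<longlonglongrightarrow> (\<integral>x. f x \<partial>M)"
proof -
  have upper: "AE x in M. \<forall>j. \<forall>\<^sub>F n in sequentially. ergodic_sum T f n x / n < (\<integral>x. f x \<partial>M) + inverse (real (Suc j))"
    by (subst AE_all_countable) (intro allI ergodic_average_le[OF erg f], simp)
  have lower: "AE x in M. \<forall>j. \<forall>\<^sub>F n in sequentially. ergodic_sum T (\<lambda>x. - f x) n x / n < (\<integral>x. - f x \<partial>M) + inverse (real (Suc j))"
    by (subst AE_all_countable) (use f in \<open>intro allI ergodic_average_le[OF erg], simp_all\<close>)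
  from upper lower show ?thesis
  proof eventually_elim
    case (elim x)
    show ?case
    proof (rule LIMSEQ_I)
      fix r :: real assume "r > 0"
      then obtain j where j: "inverse (real (Suc j)) < r" using reals_Archimedean by blast
      from elim[THEN spec, of j] have "\<forall>\<^sub>F n in sequentially. norm (ergodic_sum T f n x / n - (\<integral>x. f x \<partial>M)) < r"
        by eventually_elim (use j in \<open>auto simp: sum_negf abs_less_iff\<close>)
      then show "\<exists>no. \<forall>n\<ge>no. norm (ergodic_sum T f n x / n - (\<integral>x. f x \<partial>M)) < r"
        by (simp add: eventually_sequentially)
    qed
  qed
qed

end

section \<open>Quenched limits from averages of the rates\<close>

text \<open>Converts bounds in probability into statements on an almost sure limit.\<close>

lemma (in prob_space) AE_eventually_mem_not_vanishing:
  assumes E: "\<And>n. E n \<in> sets M" and AE: "AE x in M. \<forall>\<^sub>F n in sequentially. x \<in> E n"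
    and lim: "(\<lambda>n. prob (E n)) \<longlonglongrightarrow> 0"
  shows False
proof -
  let ?B = "\<lambda>N. \<Inter>n\<in>{N..}. E n"
  have B: "?B N \<in> sets M" for N
    using E by (intro sets.countable_INT') auto
  have "(\<Union>N. ?B N) \<in> sets M" using B by (intro sets.countable_UN) auto
  moreover have "AE x in M. x \<in> (\<Union>N. ?B N)"
    using AE by eventually_elim (unfold eventually_sequentially UN_iff INT_iff atLeast_iff, blast)
  ultimately have 1: "prob (\<Union>N. ?B N) = 1" using prob_eq_1 by blast
  have "incseq ?B" by (intro incseq_SucI) auto
  with B have "(\<lambda>N. prob (?B N)) \<longlonglongrightarrow> prob (\<Union>N. ?B N)"
    by (intro finite_Lim_measure_incseq) auto
  then have "(\<lambda>N. prob (?B N)) \<longlonglongrightarrow> 1" unfolding 1 .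
  moreover have "prob (?B N) \<le> prob (E N)" for N
    by (intro finite_measure_mono E) auto
  ultimately have "(1::real) \<le> 0"
    using lim by (intro LIMSEQ_le[of "\<lambda>N. prob (?B N)" 1 "\<lambda>n. prob (E n)" 0]) auto
  then show False by simp
qed

lemma floor_mult_ratio:
  fixes s :: real
  assumes "s > 0"
  shows "(\<lambda>N. real (nat \<lfloor>real N * s\<rfloor>) / real N) \<longlonglongrightarrow> s"
    and "filterlim (\<lambda>N. nat \<lfloor>real N * s\<rfloor>) sequentially sequentially"
proof -
  have eq: "real (nat \<lfloor>real N * s\<rfloor>) = of_int \<lfloor>real N * s\<rfloor>" for N
    using assms by simp
  show "(\<lambda>N. real (nat \<lfloor>real N * s\<rfloor>) / real N) \<longlonglongrightarrow> s"
    unfolding eq using assms by real_asymp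
  have "filterlim (\<lambda>N. real_of_int \<lfloor>real N * s\<rfloor>) at_top sequentially"
    using assms by real_asymp
  then show "filterlim (\<lambda>N. nat \<lfloor>real N * s\<rfloor>) sequentially sequentially"
    unfolding eq[symmetric] by (simp add: filterlim_sequentially_iff_filterlim_real)
qed

lemma eventually_floor_mult_pos:
  fixes s :: real
  assumes "s > 0"
  shows "\<forall>\<^sub>F N in sequentially. 1 \<le> nat \<lfloor>real N * s\<rfloor>"
  using eventually_compose_filterlim[OF eventually_ge_at_top floor_mult_ratio(2)[OF assms]] .

lemma average_floor:
  fixes f :: "nat \<Rightarrow> real"
  assumes f: "(\<lambda>N. (\<Sum>i=1..N. f i) / real N) \<longlonglongrightarrow> A" and s: "s > 0"
  shows "(\<lambda>N. (\<Sum>i=1..nat \<lfloor>real N * s\<rfloor>. f i) / real N) \<longlonglongrightarrow> s * A"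
proof -
  let ?m = "\<lambda>N. nat \<lfloor>real N * s\<rfloor>"
  have "(\<lambda>N. (real (?m N) / real N) * ((\<Sum>i=1..?m N. f i) / real (?m N))) \<longlonglongrightarrow> s * A"
    by (intro tendsto_mult floor_mult_ratio s filterlim_compose[OF f])
  moreover from eventually_floor_mult_pos[OF s] have "\<forall>\<^sub>F N in sequentially. (real (?m N) / real N) * ((\<Sum>i=1..?m N. f i) / real (?m N))
      = (\<Sum>i=1..?m N. f i) / real N"
    by eventually_elim (simp del: One_nat_def)
  ultimately show ?thesis by (simp add: tendsto_cong)
qed

lemma tail_bound_vanishes:
  fixes s t :: real
  assumes "s > 0" "t > 0" "c > 0" "\<kappa> > 0"
  shows "(\<lambda>N. C * ((nat \<lfloor>real N * s\<rfloor> + nat \<lfloor>real N * t\<rfloor>) / (c\<^sup>2 * (\<kappa> * real N)\<^sup>2))) \<longlonglongrightarrow> 0"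
proof -
  have "(\<lambda>N. C / (c\<^sup>2 * \<kappa>\<^sup>2) * ((real (nat \<lfloor>real N * s\<rfloor>) / real N + real (nat \<lfloor>real N * t\<rfloor>) / real N) * (1 / real N)))
     \<longlonglongrightarrow> C / (c\<^sup>2 * \<kappa>\<^sup>2) * ((s + t) * 0)"
    by (intro tendsto_mult tendsto_const tendsto_add floor_mult_ratio assms lim_1_over_n)
  moreover have "C / (c\<^sup>2 * \<kappa>\<^sup>2) * ((real (nat \<lfloor>real N * s\<rfloor>) / real N + real (nat \<lfloor>real N * t\<rfloor>) / real N) * (1 / real N))
     = C * ((nat \<lfloor>real N * s\<rfloor> + nat \<lfloor>real N * t\<rfloor>) / (c\<^sup>2 * (\<kappa> * real N)\<^sup>2))" for N
    by (simp add: power2_eq_square add_divide_distrib algebra_simps)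
  ultimately show ?thesis by simp
qed

lemma AE_quenched_lpp_limit:
  assumes ab: "\<And>i. 1 \<le> i \<Longrightarrow> a i > 0" "\<And>j. 1 \<le> j \<Longrightarrow> b j > 0"
    and st: "s > 0" "t > 0"
    and conv: "AE W in quenched_law (a, b).
      (\<lambda>N. ennreal (last_passage W (nat \<lfloor>real N * s\<rfloor>) (nat \<lfloor>real N * t\<rfloor>) / real N)) \<longlonglongrightarrow> \<gamma>"
  shows "AE W in quenched_law (a, b).
      (\<lambda>N. ennreal (lpp W (nat \<lfloor>real N * s\<rfloor>) (nat \<lfloor>real N * t\<rfloor>) / real N)) \<longlonglongrightarrow> \<gamma>"
proof -
  have "AE W in quenched_law (a, b). \<forall>p\<in>sites. W p \<ge> 0"
    by (rule AE_quenched_nonneg) (use ab in auto)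
  with conv show ?thesis
  proof eventually_elim
    case (elim W)
    from eventually_floor_mult_pos[OF st(1)] eventually_floor_mult_pos[OF st(2)]
    have "\<forall>\<^sub>F N in sequentially. ennreal (last_passage W (nat \<lfloor>real N * s\<rfloor>) (nat \<lfloor>real N * t\<rfloor>) / real N)
        = ennreal (lpp W (nat \<lfloor>real N * s\<rfloor>) (nat \<lfloor>real N * t\<rfloor>) / real N)"
      by eventually_elim (subst last_passage_eq_lpp; use elim(2) in auto)
    then show ?case using elim(1) by (simp add: tendsto_cong)
  qed
qed

lemma quenched_shape_le:
  assumes ab: "\<And>i. 1 \<le> i \<Longrightarrow> a i > 0" "\<And>j. 1 \<le> j \<Longrightarrow> b j > 0"
    and c: "c > 0" "\<And>i. 1 \<le> i \<Longrightarrow> a i + z \<ge> c" "\<And>j. 1 \<le> j \<Longrightarrow> b j - z \<ge> c"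
    and A: "(\<lambda>N. (\<Sum>i=1..N. 1 / (a i + z)) / real N) \<longlonglongrightarrow> A"
    and B: "(\<lambda>N. (\<Sum>j=1..N. 1 / (b j - z)) / real N) \<longlonglongrightarrow> B"
    and st: "s > 0" "t > 0"
    and conv: "AE W in quenched_law (a, b).
      (\<lambda>N. ennreal (last_passage W (nat \<lfloor>real N * s\<rfloor>) (nat \<lfloor>real N * t\<rfloor>) / real N)) \<longlonglongrightarrow> \<gamma>"
  shows "\<gamma> \<le> ennreal (s * A + t * B)"
proof (rule ccontr)
  assume "\<not> ?thesis"
  then obtain y' where y': "ennreal (s * A + t * B) < y'" "y' < \<gamma>" using dense[of "ennreal (s * A + t * B)" \<gamma>] by (auto simp: not_le)
  define y where "y = enn2real y'"
  have y: "ennreal y = y'" using y'(2) by (auto simp: y_def less_top[symmetric] intro!: ennreal_enn2real)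
  have y_gt: "s * A + t * B < y" "y \<ge> 0"
    using y' unfolding y[symmetric] by (auto simp: y_def ennreal_less_iff less_le not_le intro: ennreal_leI dest: leI)
  let ?m = "\<lambda>N. nat \<lfloor>real N * s\<rfloor>" and ?n = "\<lambda>N. nat \<lfloor>real N * t\<rfloor>"
  let ?Q = "quenched_law (a, b)"
  define E where "E N = {W \<in> space ?Q. lpp W (?m N) (?n N) > y * real N}" for N
  interpret Q: prob_space ?Q by (rule prob_space_quenched_law[OF ab])
  have lim: "AE W in ?Q. (\<lambda>N. ennreal (lpp W (?m N) (?n N) / real N)) \<longlonglongrightarrow> \<gamma>"
    by (rule AE_quenched_lpp_limit) (use ab st conv in auto)
  define \<kappa> where "\<kappa> = (y - (s * A + t * B)) / 3"
  have \<kappa>: "\<kappa> > 0" using y_gt by (simp add: \<kappa>_def)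
  have "(\<lambda>N. (\<Sum>i=1..?m N. 1 / (a i + z)) / real N + (\<Sum>j=1..?n N. 1 / (b j - z)) / real N) \<longlonglongrightarrow> s * A + t * B"
    by (intro tendsto_add average_floor A B st)
  then have mean: "(\<lambda>N. stationary_mean a b z (?m N) (?n N) / real N) \<longlonglongrightarrow> s * A + t * B"
    by (simp add: stationary_mean_def add_divide_distrib)
  show False
  proof (rule Q.AE_eventually_mem_not_vanishing)
    show "E N \<in> sets ?Q" for N
      unfolding E_def using lpp_measurable_quenched[of "?m N" "?n N" "(a, b)"] by measurable
    show "AE W in ?Q. \<forall>\<^sub>F N in sequentially. W \<in> E N"
      using lim AE_space
    proof eventually_elim
      case (elim W)
      from order_tendstoD(1)[OF elim(1) y'(2)] eventually_gt_at_top[of 0] show ?case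
      proof eventually_elim
        case (elim N)
        then have "y < lpp W (?m N) (?n N) / real N"
          unfolding y[symmetric] by (metis ennreal_leI not_le)
        then show ?case using \<open>W \<in> space ?Q\<close> elim by (simp add: E_def less_divide_eq)
      qed
    qed
    show "(\<lambda>N. Q.prob (E N)) \<longlonglongrightarrow> 0"
    proof (rule tendsto_sandwich[OF _ _ tendsto_const tail_bound_vanishes[OF st c(1) \<kappa>, of 1]])
      have "\<forall>\<^sub>F N in sequentially. stationary_mean a b z (?m N) (?n N) / real N < y - 2 * \<kappa>"
        using \<kappa> by (intro order_tendstoD(2)[OF mean]) (auto simp: \<kappa>_def field_simps)
      then show "\<forall>\<^sub>F N in sequentially. Q.prob (E N) \<le> 1 * ((?m N + ?n N) / (c\<^sup>2 * (\<kappa> * real N)\<^sup>2))"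
        using eventually_gt_at_top[of 0]
      proof eventually_elim
        case (elim N)
        then have "stationary_mean a b z (?m N) (?n N) < (y - 2 * \<kappa>) * real N"
          by (simp add: pos_divide_less_eq)
        then have "stationary_mean a b z (?m N) (?n N) + 2 * (\<kappa> * real N) \<le> y * real N"
          by (simp add: algebra_simps)
        then have "Q.prob (E N) \<le> Q.prob {W \<in> space ?Q. lpp W (?m N) (?n N) \<ge> stationary_mean a b z (?m N) (?n N) + 2 * (\<kappa> * real N)}"
          using lpp_measurable_quenched[of "?m N" "?n N" "(a, b)"]
          by (intro Q.finite_measure_mono) (auto simp: E_def)
        also have "\<dots> \<le> (?m N + ?n N) / (c\<^sup>2 * (\<kappa> * real N)\<^sup>2)"
          unfolding of_nat_add by (rule quenched_upper_tail) (use ab c \<kappa> elim(2) in auto)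
        finally show ?case by simp
      qed
    qed simp
  qed
qed

text \<open>The conditions \<open>gap1\<close> and \<open>gap2\<close> say that moving the parameter from \<open>z\<close> to \<open>w1\<close> or \<open>w2\<close> changes the
  mean of the boundary model by less than the gain that a path obtains on the first \<open>\<epsilon>N\<close> steps of an
  axis. The loss \<open>\<epsilon> * max (A z) (B z)\<close> is the boundary part of a path that leaves the axes earlier.\<close>

lemma quenched_shape_ge:
  assumes ab: "\<And>i. 1 \<le> i \<Longrightarrow> a i > 0" "\<And>j. 1 \<le> j \<Longrightarrow> b j > 0"
    and ab': "\<And>i. 1 \<le> i \<Longrightarrow> a i \<le> a' i" "\<And>j. 1 \<le> j \<Longrightarrow> b j \<le> b' j"
    and w: "w1 \<le> z" "z \<le> w2"
    and c: "c > 0" "\<And>i. 1 \<le> i \<Longrightarrow> a' i + w1 \<ge> c" "\<And>j. 1 \<le> j \<Longrightarrow> b' j - w2 \<ge> c"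
    and A: "\<And>y. y \<in> {w1, z, w2} \<Longrightarrow> (\<lambda>N. (\<Sum>i=1..N. 1 / (a' i + y)) / real N) \<longlonglongrightarrow> A y"
    and B: "\<And>y. y \<in> {w1, z, w2} \<Longrightarrow> (\<lambda>N. (\<Sum>j=1..N. 1 / (b' j - y)) / real N) \<longlonglongrightarrow> B y"
    and st: "s > 0" "t > 0" and \<epsilon>: "\<epsilon> > 0" "\<epsilon> \<le> s" "\<epsilon> \<le> t"
    and gap1: "s * A w1 + t * B w1 < s * A z + t * B z + \<epsilon> * (A w1 - A z)"
    and gap2: "s * A w2 + t * B w2 < s * A z + t * B z + \<epsilon> * (B w2 - B z)"
    and conv: "AE W in quenched_law (a, b).
      (\<lambda>N. ennreal (last_passage W (nat \<lfloor>real N * s\<rfloor>) (nat \<lfloor>real N * t\<rfloor>) / real N)) \<longlonglongrightarrow> \<gamma>"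
  shows "ennreal (s * A z + t * B z - \<epsilon> * max (A z) (B z)) \<le> \<gamma>"
proof (rule ccontr)
  define y0 where "y0 = s * A z + t * B z - \<epsilon> * max (A z) (B z)"
  assume "\<not> ?thesis"
  then obtain y' where y': "\<gamma> < y'" "y' < ennreal y0" using dense[of \<gamma> "ennreal y0"] by (auto simp: not_le y0_def)
  define y where "y = enn2real y'"
  have y: "ennreal y = y'" using y'(2) by (auto simp: y_def intro!: ennreal_enn2real elim: less_trans)
  have y_less: "y < y0" "y \<ge> 0"
    using y'(2) unfolding y[symmetric] by (auto simp: y_def ennreal_less_iff)
  let ?m = "\<lambda>N. nat \<lfloor>real N * s\<rfloor>" and ?n = "\<lambda>N. nat \<lfloor>real N * t\<rfloor>" and ?k = "\<lambda>N. nat \<lfloor>real N * \<epsilon>\<rfloor>"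
  let ?Q = "quenched_law (a, b)"
  define E where "E N = {W \<in> space ?Q. lpp W (?m N) (?n N) < y * real N}" for N
  interpret Q: prob_space ?Q by (rule prob_space_quenched_law[OF ab])
  have lim: "AE W in ?Q. (\<lambda>N. ennreal (lpp W (?m N) (?n N) / real N)) \<longlonglongrightarrow> \<gamma>"
    by (rule AE_quenched_lpp_limit) (use ab st conv in auto)
  define g1 where "g1 = s * A z + t * B z + \<epsilon> * (A w1 - A z) - (s * A w1 + t * B w1)"
  define g2 where "g2 = s * A z + t * B z + \<epsilon> * (B w2 - B z) - (s * A w2 + t * B w2)"
  define h where "h = min (min g1 g2) (y0 - y)"
  have h: "h > 0" "h \<le> g1" "h \<le> g2" "h \<le> y0 - y"
    using gap1 gap2 y_less by (auto simp: h_def g1_def g2_def)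
  \<comment> \<open>six deviations enter the gap conditions and three the threshold, so a seventh of the slack suffices\<close>
  define \<kappa> where "\<kappa> = h / 7"
  have \<kappa>: "\<kappa> > 0" "6 * \<kappa> < g1" "6 * \<kappa> < g2" "3 * \<kappa> < y0 - y"
    using h by (auto simp: \<kappa>_def)
  have mean: "(\<lambda>N. stationary_mean a' b' v (?m N) (?n N) / real N) \<longlonglongrightarrow> s * A v + t * B v"
    if "v \<in> {w1, z, w2}" for v
    unfolding stationary_mean_def add_divide_distrib by (intro tendsto_add average_floor A B that st)
  have lim1: "(\<lambda>N. stationary_mean a' b' z (?m N) (?n N) / real N
        + ((\<Sum>i=1..?k N. 1 / (a' i + w1)) / real N - (\<Sum>i=1..?k N. 1 / (a' i + z)) / real N)
        - stationary_mean a' b' w1 (?m N) (?n N) / real N) \<longlonglongrightarrow> s * A z + t * B z + (\<epsilon> * A w1 - \<epsilon> * A z) - (s * A w1 + t * B w1)"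
    by (intro tendsto_diff tendsto_add mean average_floor A \<epsilon>) auto
  have lim2: "(\<lambda>N. stationary_mean a' b' z (?m N) (?n N) / real N
        + ((\<Sum>j=1..?k N. 1 / (b' j - w2)) / real N - (\<Sum>j=1..?k N. 1 / (b' j - z)) / real N)
        - stationary_mean a' b' w2 (?m N) (?n N) / real N) \<longlonglongrightarrow> s * A z + t * B z + (\<epsilon> * B w2 - \<epsilon> * B z) - (s * A w2 + t * B w2)"
    by (intro tendsto_diff tendsto_add mean average_floor B \<epsilon>) auto
  have lim3: "(\<lambda>N. stationary_mean a' b' z (?m N) (?n N) / real N
        - max ((\<Sum>i=1..?k N. 1 / (a' i + z)) / real N) ((\<Sum>j=1..?k N. 1 / (b' j - z)) / real N))
      \<longlonglongrightarrow> s * A z + t * B z - max (\<epsilon> * A z) (\<epsilon> * B z)"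
    by (intro tendsto_diff tendsto_max mean average_floor A B \<epsilon>) auto
  show False
  proof (rule Q.AE_eventually_mem_not_vanishing)
    show "E N \<in> sets ?Q" for N
      unfolding E_def using lpp_measurable_quenched[of "?m N" "?n N" "(a, b)"] by measurable
    show "AE W in ?Q. \<forall>\<^sub>F N in sequentially. W \<in> E N"
      using lim AE_space
    proof eventually_elim
      case (elim W)
      from order_tendstoD(2)[OF elim(1) y'(1)] eventually_gt_at_top[of 0] show ?case
      proof eventually_elim
        case (elim N)
        then have "lpp W (?m N) (?n N) / real N < y"
          unfolding y[symmetric] by (metis ennreal_leI not_le)
        then show ?case using \<open>W \<in> space ?Q\<close> elim by (simp add: E_def divide_less_eq)
      qed
    qed
    show "(\<lambda>N. Q.prob (E N)) \<longlonglongrightarrow> 0"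
    proof (rule tendsto_sandwich[OF _ _ tendsto_const tail_bound_vanishes[OF st c(1) \<kappa>(1), of 7]])
      have ev1: "\<forall>\<^sub>F N in sequentially. 6 * \<kappa> < stationary_mean a' b' z (?m N) (?n N) / real N
        + ((\<Sum>i=1..?k N. 1 / (a' i + w1)) / real N - (\<Sum>i=1..?k N. 1 / (a' i + z)) / real N)
        - stationary_mean a' b' w1 (?m N) (?n N) / real N"
        using \<kappa>(2) by (intro order_tendstoD(1)[OF lim1]) (simp add: g1_def algebra_simps)
      have ev2: "\<forall>\<^sub>F N in sequentially. 6 * \<kappa> < stationary_mean a' b' z (?m N) (?n N) / real N
        + ((\<Sum>j=1..?k N. 1 / (b' j - w2)) / real N - (\<Sum>j=1..?k N. 1 / (b' j - z)) / real N)
        - stationary_mean a' b' w2 (?m N) (?n N) / real N"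
        using \<kappa>(3) by (intro order_tendstoD(1)[OF lim2]) (simp add: g2_def algebra_simps)
      have "y + 3 * \<kappa> < s * A z + t * B z - max (\<epsilon> * A z) (\<epsilon> * B z)"
        using \<kappa>(4) \<epsilon>(1) by (simp add: y0_def max_mult_distrib_left)
      then have ev3: "\<forall>\<^sub>F N in sequentially. y + 3 * \<kappa> < stationary_mean a' b' z (?m N) (?n N) / real N
        - max ((\<Sum>i=1..?k N. 1 / (a' i + z)) / real N) ((\<Sum>j=1..?k N. 1 / (b' j - z)) / real N)"
        by (rule order_tendstoD(1)[OF lim3])
      show "\<forall>\<^sub>F N in sequentially. Q.prob (E N) \<le> 7 * ((?m N + ?n N) / (c\<^sup>2 * (\<kappa> * real N)\<^sup>2))"
        using ev1 ev2 ev3 eventually_gt_at_top[of 0]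
      proof eventually_elim
        case (elim N)
        have N: "real N > 0" using elim(4) by simp
        have scale: "x * real N < p + (q - r) - u" if "x < p / real N + (q / real N - r / real N) - u / real N" for x p q r u
        proof -
          have "x < (p + (q - r) - u) / real N" using that by (simp only: add_divide_distrib diff_divide_distrib)
          then show ?thesis using N by (simp add: pos_less_divide_eq)
        qed
        have g1: "stationary_mean a' b' w1 (?m N) (?n N) + 6 * (\<kappa> * real N)
          < stationary_mean a' b' z (?m N) (?n N) + ((\<Sum>i=1..?k N. 1 / (a' i + w1)) - (\<Sum>i=1..?k N. 1 / (a' i + z)))"
          using scale[OF elim(1)] by simp
        have g2: "stationary_mean a' b' w2 (?m N) (?n N) + 6 * (\<kappa> * real N)
          < stationary_mean a' b' z (?m N) (?n N) + ((\<Sum>j=1..?k N. 1 / (b' j - w2)) - (\<Sum>j=1..?k N. 1 / (b' j - z)))"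
          using scale[OF elim(2)] by simp
        let ?H = "\<Sum>i=1..?k N. 1 / (a' i + z)" and ?K = "\<Sum>j=1..?k N. 1 / (b' j - z)"
        have "max (?H / real N) (?K / real N) = max ?H ?K / real N"
          using elim(4) by (simp add: max_divide_distrib_right)
        then have "y + 3 * \<kappa> < (stationary_mean a' b' z (?m N) (?n N) - max ?H ?K) / real N"
          using elim(3) by (simp only: diff_divide_distrib)
        then have g3: "y * real N \<le> stationary_mean a' b' z (?m N) (?n N) - max ?H ?K - 3 * (\<kappa> * real N)"
          using N by (simp add: pos_less_divide_eq algebra_simps)
        have kl: "?k N \<le> ?m N" "?k N \<le> ?n N"
          by (intro nat_mono floor_mono mult_left_mono \<epsilon>; simp)+
        have "Q.prob (E N) \<le> Q.prob {W \<in> space ?Q. lpp W (?m N) (?n N)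
            \<le> stationary_mean a' b' z (?m N) (?n N) - max ?H ?K - 3 * (\<kappa> * real N)}"
          using lpp_measurable_quenched[of "?m N" "?n N" "(a, b)"] g3
          by (intro Q.finite_measure_mono) (auto simp: E_def)
        also have "\<dots> \<le> 7 * ((?m N + ?n N) / (c\<^sup>2 * (\<kappa> * real N)\<^sup>2))"
          using quenched_lower_tail[OF ab ab' w c _ kl g1 g2] \<kappa>(1) elim(4) by simp
        finally show ?case .
      qed
    qed simp
  qed
qed

section \<open>Expected reciprocals and critical parameters\<close>

context prob_space begin

lemma integrable_reciprocal_power:
  fixes X :: "'a \<Rightarrow> real"
  assumes [measurable]: "X \<in> borel_measurable M" and X: "\<And>\<omega>. \<omega> \<in> space M \<Longrightarrow> X \<omega> \<ge> l" and z: "l + z > 0"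
  shows "integrable M (\<lambda>\<omega>. 1 / (X \<omega> + z) ^ n)"
proof (rule integrable_const_bound[where B = "1 / (l + z) ^ n"])
  show "AE \<omega> in M. norm (1 / (X \<omega> + z) ^ n) \<le> 1 / (l + z) ^ n"
  proof (rule AE_I2)
    fix \<omega> assume "\<omega> \<in> space M"
    then show "norm (1 / (X \<omega> + z) ^ n) \<le> 1 / (l + z) ^ n"
      using X[of \<omega>] z by (auto intro!: frac_le power_mono)
  qed
qed measurable

text \<open>Differentiation under the integral by hand: the difference quotient and the derivative of
  \<open>1 / y\<close> differ by exactly \<open>h / ((y + h) * y\<^sup>2)\<close>, which is uniformly of order \<open>h\<close>.\<close>

lemma DERIV_expectation_reciprocal:
  fixes X :: "'a \<Rightarrow> real"
  assumes [measurable]: "X \<in> borel_measurable M" and X: "\<And>\<omega>. \<omega> \<in> space M \<Longrightarrow> X \<omega> \<ge> l" and z: "l + z > 0"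
  shows "((\<lambda>z. \<integral>\<omega>. 1 / (X \<omega> + z) \<partial>M) has_real_derivative - (\<integral>\<omega>. 1 / (X \<omega> + z)\<^sup>2 \<partial>M)) (at z)"
proof -
  define F where "F z = (\<integral>\<omega>. 1 / (X \<omega> + z) \<partial>M)" for z
  define q where "q \<omega> = 1 / (X \<omega> + z)\<^sup>2" for \<omega>
  define K where "K = (\<integral>\<omega>. q \<omega> \<partial>M)"
  define c where "c = (l + z) / 2"
  have c: "c > 0" "l + z = 2 * c" using z by (auto simp: c_def)
  have int1: "integrable M (\<lambda>\<omega>. 1 / (X \<omega> + y))" if "l + y > 0" for y
    using integrable_reciprocal_power[OF assms(1) X that, of 1] by simp
  have int2: "integrable M q"
    unfolding q_def[abs_def] by (rule integrable_reciprocal_power[OF assms(1) X z])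
  have bound: "\<bar>(F (z + h) - F z) / h + K\<bar> \<le> \<bar>h\<bar> / c ^ 3" if h: "h \<noteq> 0" "\<bar>h\<bar> < c" for h
  proof -
    have lz: "l + (z + h) > 0" using h c by linarith
    let ?g = "\<lambda>\<omega>. 1 / (X \<omega> + (z + h)) - 1 / (X \<omega> + z) + h * q \<omega>"
    have g_int: "integrable M ?g" using int1[OF lz] int1[OF z] int2 by simp
    have g: "0 \<le> ?g \<omega> \<and> ?g \<omega> \<le> h\<^sup>2 / c ^ 3" if "\<omega> \<in> space M" for \<omega>
    proof -
      define y where "y = X \<omega> + z"
      have y: "y \<ge> c" "y + h \<ge> c" using X[OF that] c h by (auto simp: y_def)
      have "?g \<omega> = 1 / (y + h) - 1 / y + h * (1 / y\<^sup>2)" by (simp add: y_def q_def add.assoc)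
      also have "\<dots> = h\<^sup>2 / ((y + h) * y\<^sup>2)"
        using y c by (simp add: divide_simps power2_eq_square) (simp add: algebra_simps)
      finally have eq: "?g \<omega> = h\<^sup>2 / ((y + h) * y\<^sup>2)" .
      have "c * c\<^sup>2 \<le> (y + h) * y\<^sup>2" using y c by (intro mult_mono power_mono) auto
      then have "c ^ 3 \<le> (y + h) * y\<^sup>2" by (simp add: power3_eq_cube power2_eq_square)
      then show ?thesis unfolding eq using y c by (auto intro!: frac_le divide_nonneg_nonneg)
    qed
    have eq: "F (z + h) - F z + h * K = (\<integral>\<omega>. ?g \<omega> \<partial>M)"
      unfolding F_def K_def using int1[OF lz] int1[OF z] int2 by simp
    have "0 \<le> (\<integral>\<omega>. ?g \<omega> \<partial>M)"
      by (intro integral_nonneg_AE AE_I2) (use g in auto)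
    moreover have "(\<integral>\<omega>. ?g \<omega> \<partial>M) \<le> (\<integral>\<omega>. h\<^sup>2 / c ^ 3 \<partial>M)"
      by (intro integral_mono g_int) (use g in auto)
    ultimately have "\<bar>F (z + h) - F z + h * K\<bar> \<le> h\<^sup>2 / c ^ 3" unfolding eq by (simp add: prob_space)
    then have "\<bar>F (z + h) - F z + h * K\<bar> / \<bar>h\<bar> \<le> (h\<^sup>2 / c ^ 3) / \<bar>h\<bar>"
      by (rule divide_right_mono) simp
    moreover have "(F (z + h) - F z) / h + K = (F (z + h) - F z + h * K) / h" using h by (simp add: field_simps)
    moreover have "(h\<^sup>2 / c ^ 3) / \<bar>h\<bar> = \<bar>h\<bar> / c ^ 3"
      using h c by (auto simp: power2_eq_square abs_if divide_simps)
    ultimately show ?thesis by (simp only: abs_divide)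
  qed
  have "((\<lambda>h. (F (z + h) - F z) / h + K) \<longlongrightarrow> 0) (at 0)"
  proof (rule Lim_null_comparison)
    show "\<forall>\<^sub>F h in at 0. norm ((F (z + h) - F z) / h + K) \<le> \<bar>h\<bar> / c ^ 3"
      unfolding eventually_at using c bound by (intro exI[of _ c]) (auto simp: dist_real_def)
    have "((\<lambda>h. \<bar>h\<bar> / c ^ 3) \<longlongrightarrow> \<bar>0\<bar> / c ^ 3) (at 0)" by (intro tendsto_intros) (use c in auto)
    then show "((\<lambda>h. \<bar>h\<bar> / c ^ 3) \<longlongrightarrow> 0) (at 0)" by simp
  qed
  then have "((\<lambda>h. (F (z + h) - F z) / h - (- K)) \<longlongrightarrow> 0) (at 0)" by simp
  then have "((\<lambda>h. (F (z + h) - F z) / h) \<longlongrightarrow> - K) (at 0)" by (rule LIM_zero_cancel)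
  then show ?thesis unfolding F_def[symmetric] q_def[symmetric] K_def[symmetric] DERIV_def .
qed

lemma DERIV_expectation_reciprocal_minus:
  fixes Y :: "'a \<Rightarrow> real"
  assumes Y: "Y \<in> borel_measurable M" "\<And>\<omega>. \<omega> \<in> space M \<Longrightarrow> Y \<omega> \<ge> m" and z: "z < m"
  shows "((\<lambda>z. \<integral>\<omega>. 1 / (Y \<omega> - z) \<partial>M) has_real_derivative (\<integral>\<omega>. 1 / (Y \<omega> - z)\<^sup>2 \<partial>M)) (at z)"
proof -
  have "((\<lambda>z. \<integral>\<omega>. 1 / (Y \<omega> + z) \<partial>M) has_real_derivative - (\<integral>\<omega>. 1 / (Y \<omega> + (- z))\<^sup>2 \<partial>M)) (at (- z))"
    using z by (intro DERIV_expectation_reciprocal[OF Y]) auto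
  from DERIV_mirror[THEN iffD1, OF this] show ?thesis by simp
qed

lemma expectation_reciprocal_square_pos:
  fixes X :: "'a \<Rightarrow> real"
  assumes [measurable]: "X \<in> borel_measurable M" and X: "\<And>\<omega>. \<omega> \<in> space M \<Longrightarrow> X \<omega> \<ge> l" and z: "l + z > 0"
  shows "(\<integral>\<omega>. 1 / (X \<omega> + z)\<^sup>2 \<partial>M) > 0"
proof -
  have "\<not> (AE \<omega> in M. 1 / (X \<omega> + z)\<^sup>2 = 0)"
  proof
    assume "AE \<omega> in M. 1 / (X \<omega> + z)\<^sup>2 = 0"
    then have "AE \<omega> in M. False"
      using AE_space by eventually_elim (use X z in force)
    then show False using prob_space by simp
  qed
  moreover have nonneg: "AE \<omega> in M. 0 \<le> 1 / (X \<omega> + z)\<^sup>2" by simp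
  ultimately have "(\<integral>\<omega>. 1 / (X \<omega> + z)\<^sup>2 \<partial>M) \<noteq> 0"
    using integral_nonneg_eq_0_iff_AE[OF integrable_reciprocal_power[OF assms(1) X z] nonneg] by blast
  moreover have "(\<integral>\<omega>. 1 / (X \<omega> + z)\<^sup>2 \<partial>M) \<ge> 0"
    by (rule integral_nonneg_AE[OF nonneg])
  ultimately show ?thesis by (metis order_less_le)
qed

lemma expectation_reciprocal_atom:
  fixes X :: "'a \<Rightarrow> real"
  assumes [measurable]: "X \<in> borel_measurable M" and X: "\<And>\<omega>. \<omega> \<in> space M \<Longrightarrow> X \<omega> \<ge> l" and z: "l + z > 0"
  shows "(\<integral>\<omega>. 1 / (X \<omega> + z) \<partial>M) \<ge> prob {\<omega> \<in> space M. X \<omega> = l} / (l + z)"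
proof -
  have "prob {\<omega> \<in> space M. X \<omega> = l} / (l + z) = (\<integral>\<omega>. indicator {\<omega> \<in> space M. X \<omega> = l} \<omega> / (l + z) \<partial>M)"
    by simp
  also have "\<dots> \<le> (\<integral>\<omega>. 1 / (X \<omega> + z) \<partial>M)"
  proof (rule integral_mono)
    show "integrable M (\<lambda>\<omega>. 1 / (X \<omega> + z))"
      using integrable_reciprocal_power[OF assms(1) X z, of 1] by simp
    show "integrable M (\<lambda>\<omega>. indicator {\<omega> \<in> space M. X \<omega> = l} \<omega> / (l + z))"
      by (intro integrable_divide integrable_real_indicator) (auto simp: emeasure_eq_measure)
  next
    fix \<omega> assume "\<omega> \<in> space M"
    from X[OF this] z show "indicator {\<omega> \<in> space M. X \<omega> = l} \<omega> / (l + z) \<le> 1 / (X \<omega> + z)"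
      by (auto simp: indicator_def)
  qed
  finally show ?thesis .
qed

text \<open>The atoms make the two expectations blow up at \<open>-l\<close> and \<open>m\<close> respectively, so the minimum over the
  open interval is attained. The condition displayed is the vanishing of the derivative of
  \<open>s * A + t * B\<close>.\<close>

lemma critical_parameter:
  fixes X Y :: "'a \<Rightarrow> real"
  assumes X: "X \<in> borel_measurable M" "\<And>\<omega>. \<omega> \<in> space M \<Longrightarrow> X \<omega> \<ge> l" "prob {\<omega> \<in> space M. X \<omega> = l} > 0"
    and Y: "Y \<in> borel_measurable M" "\<And>\<omega>. \<omega> \<in> space M \<Longrightarrow> Y \<omega> \<ge> m" "prob {\<omega> \<in> space M. Y \<omega> = m} > 0"
    and lm: "l + m > 0" and st: "s > 0" "t > 0"
  shows "\<exists>z. -l < z \<and> z < m \<and>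
    s * (\<integral>\<omega>. 1 / (X \<omega> + z)\<^sup>2 \<partial>M) = t * (\<integral>\<omega>. 1 / (Y \<omega> - z)\<^sup>2 \<partial>M)"
proof -
  define A where "A z = (\<integral>\<omega>. 1 / (X \<omega> + z) \<partial>M)" for z
  define B where "B z = (\<integral>\<omega>. 1 / (Y \<omega> - z) \<partial>M)" for z
  define \<phi> where "\<phi> z = s * A z + t * B z" for z
  define p q where "p = prob {\<omega> \<in> space M. X \<omega> = l}" and "q = prob {\<omega> \<in> space M. Y \<omega> = m}"
  have pq: "p > 0" "q > 0" using X(3) Y(3) by (simp_all add: p_def q_def)
  have D: "(\<phi> has_real_derivative s * - (\<integral>\<omega>. 1 / (X \<omega> + z)\<^sup>2 \<partial>M) + t * (\<integral>\<omega>. 1 / (Y \<omega> - z)\<^sup>2 \<partial>M)) (at z)"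
    if z: "-l < z" "z < m" for z
  proof -
    have A: "(A has_real_derivative - (\<integral>\<omega>. 1 / (X \<omega> + z)\<^sup>2 \<partial>M)) (at z)"
      unfolding A_def[abs_def] using z by (intro DERIV_expectation_reciprocal[OF X(1,2)]) auto
    have B: "(B has_real_derivative (\<integral>\<omega>. 1 / (Y \<omega> - z)\<^sup>2 \<partial>M)) (at z)"
      unfolding B_def[abs_def] by (rule DERIV_expectation_reciprocal_minus[OF Y(1,2) z(2)])
    show ?thesis unfolding \<phi>_def[abs_def] by (intro DERIV_add DERIV_cmult A B)
  qed
  have A_ge: "A z \<ge> p / (l + z)" "A z \<ge> 0" if "-l < z" for z
  proof -
    show "A z \<ge> p / (l + z)"
      unfolding A_def p_def using that by (intro expectation_reciprocal_atom[OF X(1,2)]) auto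
    then show "A z \<ge> 0" using pq that by (auto intro: order_trans[rotated])
  qed
  have B_ge: "B z \<ge> q / (m - z)" "B z \<ge> 0" if "z < m" for z
  proof -
    have "(\<integral>\<omega>. 1 / (Y \<omega> + (- z)) \<partial>M) \<ge> q / (m + (- z))"
      unfolding q_def using that by (intro expectation_reciprocal_atom[OF Y(1,2)]) auto
    then show "B z \<ge> q / (m - z)" by (simp add: B_def)
    then show "B z \<ge> 0" using pq that by (auto intro: order_trans[rotated])
  qed
  define z0 where "z0 = (m - l) / 2"
  have z0: "-l < z0" "z0 < m" using lm by (auto simp: z0_def)
  have \<phi>0: "\<phi> z0 \<ge> 0" using A_ge[OF z0(1)] B_ge[OF z0(2)] st by (simp add: \<phi>_def)
  \<comment> \<open>beyond these points the atom alone pushes the function above its value at the midpoint \<open>z0\<close>\<close>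
  define u where "u = -l + min ((l + m) / 2) (s * p / (\<phi> z0 + 1))"
  define v where "v = m - min ((l + m) / 2) (t * q / (\<phi> z0 + 1))"
  have u: "-l < u" "u \<le> z0" and v: "v < m" "z0 \<le> v"
    using lm st pq \<phi>0 by (auto simp: u_def v_def z0_def field_simps min_def divide_simps)
  have u_big: "\<phi> z > \<phi> z0" if "-l < z" "z \<le> u" for z
  proof -
    have "l + z \<le> s * p / (\<phi> z0 + 1)" using that by (simp add: u_def)
    then have "(\<phi> z0 + 1) * (l + z) \<le> s * p" using \<phi>0 by (simp add: pos_le_divide_eq mult.commute)
    then have "\<phi> z0 + 1 \<le> s * (p / (l + z))" using that by (simp add: pos_le_divide_eq)
    also have "\<dots> \<le> s * A z" using A_ge[of z] that st by (intro mult_left_mono) auto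
    also have "\<dots> \<le> \<phi> z" using B_ge[of z] that u v st by (simp add: \<phi>_def)
    finally show ?thesis by simp
  qed
  have v_big: "\<phi> z > \<phi> z0" if "v \<le> z" "z < m" for z
  proof -
    have "m - z \<le> t * q / (\<phi> z0 + 1)" using that by (simp add: v_def)
    then have "(\<phi> z0 + 1) * (m - z) \<le> t * q" using \<phi>0 by (simp add: pos_le_divide_eq mult.commute)
    then have "\<phi> z0 + 1 \<le> t * (q / (m - z))" using that by (simp add: pos_le_divide_eq)
    also have "\<dots> \<le> t * B z" using B_ge[of z] that st by (intro mult_left_mono) auto
    also have "\<dots> \<le> \<phi> z" using A_ge[of z] that u v st by (simp add: \<phi>_def)
    finally show ?thesis by simp
  qed
  have "continuous_on {u..v} \<phi>"
    by (intro continuous_at_imp_continuous_on ballI DERIV_isCont[OF D]) (use u v in auto)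
  then obtain z where z: "z \<in> {u..v}" "\<And>y. y \<in> {u..v} \<Longrightarrow> \<phi> z \<le> \<phi> y"
    using continuous_attains_inf[of "{u..v}" \<phi>] u v by auto
  have "\<phi> z \<le> \<phi> z0" using z(2) u v by auto
  then have z_in: "u < z" "z < v"
    using u_big[of z] v_big[of z] z(1) u v by (auto simp: not_le[symmetric])
  have "s * - (\<integral>\<omega>. 1 / (X \<omega> + z)\<^sup>2 \<partial>M) + t * (\<integral>\<omega>. 1 / (Y \<omega> - z)\<^sup>2 \<partial>M) = 0"
  proof (rule DERIV_local_min)
    show "(\<phi> has_real_derivative s * - (\<integral>\<omega>. 1 / (X \<omega> + z)\<^sup>2 \<partial>M) + t * (\<integral>\<omega>. 1 / (Y \<omega> - z)\<^sup>2 \<partial>M)) (at z)"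
      using z_in u v by (intro D) auto
    show "0 < min (z - u) (v - z)" using z_in by simp
    show "\<forall>y. \<bar>z - y\<bar> < min (z - u) (v - z) \<longrightarrow> \<phi> z \<le> \<phi> y"
      using z(2) by (auto simp: abs_less_iff)
  qed
  then show ?thesis using z_in u v by (intro exI[of _ z]) auto
qed

text \<open>At a critical point of \<open>s * A + t * B\<close> the perturbed functions \<open>(s - \<epsilon>) * A + t * B\<close> and
  \<open>s * A + (t - \<epsilon>) * B\<close> have positive and negative derivative, so they take smaller values slightly to
  the left and to the right. These are the two gap conditions.\<close>

lemma critical_parameter_neighbours:
  fixes X Y :: "'a \<Rightarrow> real"
  assumes X: "X \<in> borel_measurable M" "\<And>\<omega>. \<omega> \<in> space M \<Longrightarrow> X \<omega> \<ge> l"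
    and Y: "Y \<in> borel_measurable M" "\<And>\<omega>. \<omega> \<in> space M \<Longrightarrow> Y \<omega> \<ge> m"
    and z: "-l < z" "z < m" and \<epsilon>: "\<epsilon> > 0"
    and crit: "s * (\<integral>\<omega>. 1 / (X \<omega> + z)\<^sup>2 \<partial>M) = t * (\<integral>\<omega>. 1 / (Y \<omega> - z)\<^sup>2 \<partial>M)"
  defines "A \<equiv> \<lambda>z. \<integral>\<omega>. 1 / (X \<omega> + z) \<partial>M" and "B \<equiv> \<lambda>z. \<integral>\<omega>. 1 / (Y \<omega> - z) \<partial>M"
  shows "\<exists>w1 w2. -l < w1 \<and> w1 \<le> z \<and> z \<le> w2 \<and> w2 < m \<and>
    s * A w1 + t * B w1 < s * A z + t * B z + \<epsilon> * (A w1 - A z) \<and>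
    s * A w2 + t * B w2 < s * A z + t * B z + \<epsilon> * (B w2 - B z)"
proof -
  define K where "K = (\<integral>\<omega>. 1 / (X \<omega> + z)\<^sup>2 \<partial>M)"
  define L where "L = (\<integral>\<omega>. 1 / (Y \<omega> - z)\<^sup>2 \<partial>M)"
  have K: "K > 0" unfolding K_def using z by (intro expectation_reciprocal_square_pos[OF X]) auto
  have "(\<integral>\<omega>. 1 / (Y \<omega> + (- z))\<^sup>2 \<partial>M) > 0"
    using z by (intro expectation_reciprocal_square_pos[OF Y]) auto
  then have L: "L > 0" by (simp add: L_def)
  have DA: "(A has_real_derivative - K) (at z)"
    unfolding A_def K_def using z by (intro DERIV_expectation_reciprocal[OF X]) auto
  have DB: "(B has_real_derivative L) (at z)"
    unfolding B_def L_def by (rule DERIV_expectation_reciprocal_minus[OF Y z(2)])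
  have sKtL: "s * K = t * L" using crit by (simp add: K_def L_def)
  have "((\<lambda>w. (s - \<epsilon>) * A w + t * B w) has_real_derivative (s - \<epsilon>) * - K + t * L) (at z)"
    by (intro DERIV_add DERIV_cmult DA DB)
  moreover have "0 < (s - \<epsilon>) * - K + t * L" using \<epsilon> K sKtL by (simp add: algebra_simps)
  ultimately obtain d1 where d1: "d1 > 0"
    "\<And>h. h > 0 \<Longrightarrow> h < d1 \<Longrightarrow> (s - \<epsilon>) * A (z - h) + t * B (z - h) < (s - \<epsilon>) * A z + t * B z"
    using DERIV_pos_inc_left by blast
  have "((\<lambda>w. s * A w + (t - \<epsilon>) * B w) has_real_derivative s * - K + (t - \<epsilon>) * L) (at z)"
    by (intro DERIV_add DERIV_cmult DA DB)
  moreover have "s * - K + (t - \<epsilon>) * L < 0" using \<epsilon> L sKtL by (simp add: algebra_simps)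
  ultimately obtain d2 where d2: "d2 > 0"
    "\<And>h. h > 0 \<Longrightarrow> h < d2 \<Longrightarrow> s * A (z + h) + (t - \<epsilon>) * B (z + h) < s * A z + (t - \<epsilon>) * B z"
    using DERIV_neg_dec_right by blast
  \<comment> \<open>halving keeps both perturbed parameters strictly inside the admissible interval\<close>
  define h1 where "h1 = min (d1 / 2) ((z + l) / 2)"
  define h2 where "h2 = min (d2 / 2) ((m - z) / 2)"
  have h1: "h1 > 0" "h1 < d1" "-l < z - h1" using d1(1) z by (auto simp: h1_def min_def field_simps)
  have h2: "h2 > 0" "h2 < d2" "z + h2 < m" using d2(1) z by (auto simp: h2_def min_def field_simps)
  show ?thesis
    using d1(2)[OF h1(1,2)] d2(2)[OF h2(1,2)] h1 h2
    by (intro exI[of _ "z - h1"] exI[of _ "z + h2"]) (simp add: algebra_simps)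
qed

end

section \<open>Stationary parameter sequences\<close>

text \<open>By second countability the complement of the support is a countable union of open null sets.\<close>

lemma AE_measure_support:
  fixes M :: "'a::second_countable_topology measure"
  assumes "sets M = sets borel"
  shows "AE x in M. x \<in> measure_support M"
proof -
  define F where "F = {U. open U \<and> emeasure M U = 0}"
  obtain F' where F': "F' \<subseteq> F" "countable F'" "\<Union>F' = \<Union>F"
    using Lindelof[of F] by (auto simp: F_def)
  have "emeasure M U = 0" "U \<in> sets M" if "U \<in> F'" for U
    using that F'(1) assms by (auto simp: F_def)
  then have null: "(\<Union>U\<in>F'. U) \<in> null_sets M"
    by (intro null_sets_UN'[OF F'(2)]) (auto simp: null_sets_def)
  have "x \<in> measure_support M" if "x \<notin> \<Union>F'" for x
    using that unfolding F'(3) by (auto simp: measure_support_def F_def zero_less_iff_neq_zero)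
  then show ?thesis
    using AE_not_in[OF null] by (auto elim!: eventually_mono)
qed

lemma left_endpoint_facts:
  fixes M :: "real measure"
  assumes "prob_space M" and sets: "sets M = sets borel" and pos: "AE x in M. x > 0"
  shows "AE x in M. x \<ge> left_endpoint M"
    and "\<delta> > 0 \<Longrightarrow> measure M {..<left_endpoint M + \<delta>} > 0"
proof -
  interpret prob_space M by fact
  have supp: "AE x in M. x \<in> measure_support M" by (rule AE_measure_support[OF sets])
  have ne: "measure_support M \<noteq> {}"
  proof
    assume "measure_support M = {}"
    then have "AE x in M. False" using supp by simp
    then show False using prob_space by simp
  qed
  have nonneg: "x \<ge> 0" if "x \<in> measure_support M" for x
  proof (rule ccontr)
    assume "\<not> x \<ge> 0"
    then have "emeasure M {..<0} > 0" using that by (auto simp: measure_support_def)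
    moreover have "emeasure M {..<0} = 0"
      using pos by (subst AE_iff_measurable[symmetric, where P = "\<lambda>x. \<not> x < 0"])
        (auto simp: sets sets_eq_imp_space_eq[OF sets] elim!: eventually_mono)
    ultimately show False by simp
  qed
  then have bdd: "bdd_below (measure_support M)" by (auto simp: bdd_below_def)
  show "AE x in M. x \<ge> left_endpoint M"
    using supp by eventually_elim (auto simp: left_endpoint_def intro: cInf_lower bdd)
  assume "\<delta> > 0"
  then obtain x where "x \<in> measure_support M" "x < left_endpoint M + \<delta>"
    using cInf_lessD[OF ne, of "left_endpoint M + \<delta>"] by (auto simp: left_endpoint_def)
  then have "emeasure M {..<left_endpoint M + \<delta>} > 0" by (auto simp: measure_support_def)
  then show "measure M {..<left_endpoint M + \<delta>} > 0" by (simp add: emeasure_eq_measure)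
qed

lemma (in prob_space) left_endpoint_distr:
  fixes f :: "'a \<Rightarrow> real"
  assumes f: "f \<in> borel_measurable M" and pos: "\<And>x. x \<in> space M \<Longrightarrow> f x > 0"
  shows "AE x in M. left_endpoint (distr M borel f) \<le> f x"
    and "\<delta> > 0 \<Longrightarrow> prob {x \<in> space M. f x < left_endpoint (distr M borel f) + \<delta>} > 0"
proof -
  have "{x \<in> space (borel :: real measure). x > 0} \<in> sets borel" by measurable
  then have D: "AE y in distr M borel f. y > 0"
    using pos by (intro AE_distr_iff[OF f, THEN iffD2] AE_I2)
  note facts = left_endpoint_facts[OF prob_space_distr[OF f] sets_distr D]
  show "AE x in M. left_endpoint (distr M borel f) \<le> f x"
    by (rule AE_distrD[OF f facts(1)])
  assume "\<delta> > 0"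
  from facts(2)[OF this]
  have "0 < prob (f -` {..<left_endpoint (distr M borel f) + \<delta>} \<inter> space M)"
    by (subst (asm) measure_distr[OF f]) auto
  also have "f -` {..<left_endpoint (distr M borel f) + \<delta>} \<inter> space M
      = {x \<in> space M. f x < left_endpoint (distr M borel f) + \<delta>}"
    by auto
  finally show "prob {x \<in> space M. f x < left_endpoint (distr M borel f) + \<delta>} > 0" .
qed

context parameter_law begin

lemma space_pos:
  assumes "p \<in> space \<mu>" "1 \<le> i"
  shows "fst p i > 0" "snd p i > 0"
proof -
  have "p \<in> space (pos_seqs \<Otimes>\<^sub>M pos_seqs)"
    by (subst sets_eq_imp_space_eq[OF sets_\<mu>, symmetric]) (rule assms(1))
  then have "fst p \<in> space pos_seqs" "snd p \<in> space pos_seqs"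
    unfolding space_pair_measure mem_Times_iff by blast+
  moreover have "c i > 0" if "c \<in> space pos_seqs" for c
  proof -
    have "c i \<in> space (restrict_space borel {0<..} :: real measure)"
      by (rule PiE_mem[OF that[unfolded pos_seqs_def space_PiM]]) (use assms(2) in simp)
    then show ?thesis unfolding space_restrict_space by blast
  qed
  ultimately show "fst p i > 0" "snd p i > 0" by blast+
qed

lemma measurable_coordinate:
  assumes "1 \<le> i"
  shows "(\<lambda>p. fst p i) \<in> borel_measurable \<mu>" "(\<lambda>p. snd p i) \<in> borel_measurable \<mu>"
proof -
  have "(\<lambda>c. c i) \<in> pos_seqs \<rightarrow>\<^sub>M restrict_space borel {0<..}"
    unfolding pos_seqs_def by (rule measurable_component_singleton) (use assms in auto)
  then have comp: "(\<lambda>c. c i) \<in> borel_measurable pos_seqs"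
    by (rule measurable_restrict_space2_iff[THEN iffD1, THEN conjunct1])
  show "(\<lambda>p. fst p i) \<in> borel_measurable \<mu>" "(\<lambda>p. snd p i) \<in> borel_measurable \<mu>"
    unfolding measurable_cong_sets[OF sets_\<mu> refl]
    by (rule measurable_compose[OF measurable_fst comp], rule measurable_compose[OF measurable_snd comp])
qed

lemma shift_iterate:
  assumes "1 \<le> i"
  shows "fst ((map_prod (seq_shift 1) (seq_shift 1) ^^ n) p) i = fst p (i + n)"
    and "snd ((map_prod (seq_shift 1) (seq_shift 1) ^^ n) p) i = snd p (i + n)"
  using assms by (induction n arbitrary: i) (auto simp: seq_shift_def)

text \<open>A law of large numbers along the diagonal \<open>(a\<^sub>i, b\<^sub>i)\<close>, from ergodicity under the simultaneous shift;
  functions of one coordinate give the averages of \<open>a\<close> and of \<open>b\<close>.\<close>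

lemma coordinate_average:
  assumes "integrable \<mu> (\<lambda>p. h (fst p 1, snd p 1))"
  shows "AE p in \<mu>. (\<lambda>N. (\<Sum>i=1..N. h (fst p i, snd p i)) / real N) \<longlonglongrightarrow> (\<integral>p. h (fst p 1, snd p 1) \<partial>\<mu>)"
proof -
  have erg: "ergodic_under \<mu> (map_prod (seq_shift 1) (seq_shift 1))"
    using totally_ergodic by (auto simp: totally_ergodic_def)
  have "ergodic_sum (map_prod (seq_shift 1) (seq_shift 1)) (\<lambda>p. h (fst p 1, snd p 1)) N p
      = (\<Sum>i=1..N. h (fst p i, snd p i))" for N p
    by (simp add: shift_iterate[OF order_refl, unfolded One_nat_def] sum.atLeast1_atMost_eq)
  then show ?thesis using ergodic_average_tendsto[OF erg assms] by simp
qed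

lemma AE_all_coordinates:
  assumes "AE p in \<mu>. P (fst p 1, snd p 1)"
  shows "AE p in \<mu>. \<forall>i\<ge>1. P (fst p i, snd p i)"
proof -
  have "AE p in \<mu>. P (fst p (Suc k), snd p (Suc k))" for k
  proof (cases "k = 0")
    case False
    let ?T = "map_prod (seq_shift k) (seq_shift k)"
    have T: "?T \<in> \<mu> \<rightarrow>\<^sub>M \<mu>" "distr \<mu> \<mu> ?T = \<mu>"
      using totally_ergodic False by (auto simp: totally_ergodic_def ergodic_under_def)
    have "AE p in distr \<mu> \<mu> ?T. P (fst p 1, snd p 1)" unfolding T(2) by (rule assms)
    from AE_distrD[OF T(1) this] show ?thesis by (simp add: seq_shift_def)
  qed (use assms in simp)
  then have "AE p in \<mu>. \<forall>k. P (fst p (Suc k), snd p (Suc k))" by (simp add: AE_all_countable)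
  then show ?thesis
    by eventually_elim (metis One_nat_def Suc_le_D)
qed

lemma AE_quenched:
  assumes "AE W in annealed_law \<mu>. P W"
  shows "AE p in \<mu>. AE W in quenched_law p. P W"
proof -
  have sets: "sets (annealed_law \<mu>) = sets (\<Pi>\<^sub>M p\<in>sites. borel)"
    unfolding annealed_law_def by (rule sets_bind[OF sets_quenched_law not_empty])
  obtain N where N: "{W \<in> space (annealed_law \<mu>). \<not> P W} \<subseteq> N" "emeasure (annealed_law \<mu>) N = 0" "N \<in> sets (annealed_law \<mu>)"
    by (rule AE_E[OF assms])
  have N': "N \<in> sets (\<Pi>\<^sub>M p\<in>sites. borel)" using N(3) sets by simp
  have "quenched_law \<in> \<mu> \<rightarrow>\<^sub>M subprob_algebra (\<Pi>\<^sub>M p\<in>sites. borel)"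
    using measurable_prob_algebraD[OF quenched_law_measurable] sets_\<mu> by (simp cong: measurable_cong_sets)
  then have meas: "(\<lambda>p. emeasure (quenched_law p) N) \<in> borel_measurable \<mu>"
    using N' by (rule measurable_emeasure_kernel)
  have "(\<integral>\<^sup>+p. emeasure (quenched_law p) N \<partial>\<mu>) = 0"
    using emeasure_annealed_law[OF parameter_law_axioms N'] N(2) by simp
  then have "AE p in \<mu>. emeasure (quenched_law p) N = 0"
    using meas by (simp add: nn_integral_0_iff_AE)
  then show ?thesis
  proof eventually_elim
    case (elim p)
    show ?case
    proof (rule AE_I[OF _ elim])
      show "N \<in> sets (quenched_law p)" using N' sets_quenched_law by simp
      have "space (quenched_law p) = space (annealed_law \<mu>)"
        by (rule sets_eq_imp_space_eq) (simp add: sets sets_quenched_law)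
      then show "{W \<in> space (quenched_law p). \<not> P W} \<subseteq> N" using N(1) by simp
    qed
  qed
qed

abbreviation "\<alpha> \<equiv> left_endpoint (a_distr \<mu>)"
abbreviation "\<beta> \<equiv> left_endpoint (b_distr \<mu>)"

lemma endpoint_coordinate:
  "AE p in \<mu>. fst p 1 \<ge> \<alpha> \<and> snd p 1 \<ge> \<beta>"
  "\<delta> > 0 \<Longrightarrow> prob {p \<in> space \<mu>. fst p 1 < \<alpha> + \<delta>} > 0"
  "\<delta> > 0 \<Longrightarrow> prob {p \<in> space \<mu>. snd p 1 < \<beta> + \<delta>} > 0"
proof -
  have a: "distr \<mu> borel (\<lambda>p. fst p 1) = a_distr \<mu>" and b: "distr \<mu> borel (\<lambda>p. snd p 1) = b_distr \<mu>"
    by (simp_all only: a_distr_def b_distr_def case_prod_beta')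
  have meas: "(\<lambda>p. fst p 1) \<in> borel_measurable \<mu>" "(\<lambda>p. snd p 1) \<in> borel_measurable \<mu>"
    by (rule measurable_coordinate[OF order_refl])+
  have pos: "fst p 1 > 0" "snd p 1 > 0" if "p \<in> space \<mu>" for p
    by (rule space_pos[OF that order_refl])+
  have "AE p in \<mu>. left_endpoint (distr \<mu> borel (\<lambda>p. fst p 1)) \<le> fst p 1"
    by (rule left_endpoint_distr(1)[OF meas(1)]) (rule pos)
  moreover have "AE p in \<mu>. left_endpoint (distr \<mu> borel (\<lambda>p. snd p 1)) \<le> snd p 1"
    by (rule left_endpoint_distr(1)[OF meas(2)]) (rule pos)
  ultimately show "AE p in \<mu>. fst p 1 \<ge> \<alpha> \<and> snd p 1 \<ge> \<beta>"
    unfolding a b by (rule AE_conjI)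
  assume \<delta>: "\<delta> > 0"
  have "prob {p \<in> space \<mu>. fst p 1 < left_endpoint (distr \<mu> borel (\<lambda>p. fst p 1)) + \<delta>} > 0"
    by (rule left_endpoint_distr(2)[OF meas(1) _ \<delta>]) (rule pos)
  then show "prob {p \<in> space \<mu>. fst p 1 < \<alpha> + \<delta>} > 0" unfolding a .
  have "prob {p \<in> space \<mu>. snd p 1 < left_endpoint (distr \<mu> borel (\<lambda>p. snd p 1)) + \<delta>} > 0"
    by (rule left_endpoint_distr(2)[OF meas(2) _ \<delta>]) (rule pos)
  then show "prob {p \<in> space \<mu>. snd p 1 < \<beta> + \<delta>} > 0" unfolding b .
qed

end

section \<open>The variational formula\<close>

text \<open>The truncated parameter \<open>x'\<close> lies at most \<open>\<delta>\<close> above \<open>x\<close>, and its critical point \<open>z\<close> may lie outside the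
  original interval; \<open>z'\<close> is \<open>z\<close> pushed into the interval with margin \<open>\<eta>\<close>. If \<open>z\<close> is not moved down, the
  argument of the reciprocal is at least \<open>\<eta>\<close> and only \<open>\<delta>\<close> is lost; if it is moved down, the argument is
  at least half of the length of the interval and \<open>2 * \<delta> + \<eta>\<close> is lost. Used with \<open>l\<close>, \<open>m\<close> and the sign
  of \<open>z\<close> exchanged for the vertical parameters.\<close>

lemma reciprocal_comparison:
  fixes x x' :: real
  assumes "x \<ge> l" "x' \<le> x + \<delta>" "x' + z > 0" "z < m + \<delta>" "\<eta> > 0" "2 * \<eta> \<le> l + m" "\<delta> > 0"
  defines "z' \<equiv> max (- l + \<eta>) (min (m - \<eta>) z)"
  shows "1 / (x + z') - (\<delta> / \<eta>\<^sup>2 + 4 * (2 * \<delta> + \<eta>) / (l + m)\<^sup>2) \<le> 1 / (x' + z)"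
proof -
  have sub: "1 / u - r / c\<^sup>2 \<le> 1 / v" if "u \<ge> c" "c > 0" "r \<ge> 0" "0 < v" "v \<le> u + r" for u v r c :: real
  proof -
    have "1 / u - 1 / (u + r) = r / (u * (u + r))" using that by (simp add: field_simps)
    also have "\<dots> \<le> r / c\<^sup>2" unfolding power2_eq_square using that by (intro frac_le mult_mono) auto
    finally have "1 / u - r / c\<^sup>2 \<le> 1 / (u + r)" by simp
    also have "\<dots> \<le> 1 / v" using that by (intro frac_le) auto
    finally show ?thesis .
  qed
  show ?thesis
  proof (cases "z \<le> z'")
    case True
    have "1 / (x + z') - \<delta> / \<eta>\<^sup>2 \<le> 1 / (x' + z)"
      using assms True by (intro sub) auto
    moreover have "0 \<le> 4 * (2 * \<delta> + \<eta>) / (l + m)\<^sup>2" using assms by simp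
    ultimately show ?thesis by simp
  next
    case False
    then have "z' = m - \<eta>" using assms(5,6) by (auto simp: z'_def)
    then have "1 / (x + z') - (2 * \<delta> + \<eta>) / ((l + m) / 2)\<^sup>2 \<le> 1 / (x' + z)"
      using assms by (intro sub) auto
    moreover have "(2 * \<delta> + \<eta>) / ((l + m) / 2)\<^sup>2 = 4 * (2 * \<delta> + \<eta>) / (l + m)\<^sup>2"
      by (simp add: power_divide)
    moreover have "0 \<le> \<delta> / \<eta>\<^sup>2" using assms by simp
    ultimately show ?thesis by simp
  qed
qed

context parameter_law begin

definition mean_time :: "real \<Rightarrow> real \<Rightarrow> real \<Rightarrow> real" where
  "mean_time s t z = s * (\<integral>p. 1 / (fst p 1 + z) \<partial>\<mu>) + t * (\<integral>p. 1 / (snd p 1 - z) \<partial>\<mu>)"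

lemma integrable_reciprocal_coordinate:
  "- \<alpha> < z \<Longrightarrow> integrable \<mu> (\<lambda>p. 1 / (fst p 1 + z))"
  "z < \<beta> \<Longrightarrow> integrable \<mu> (\<lambda>p. 1 / (snd p 1 - z))"
proof -
  note m [measurable] = measurable_coordinate[OF order_refl]
  note [measurable] = m[unfolded One_nat_def]
  show "integrable \<mu> (\<lambda>p. 1 / (fst p 1 + z))" if "- \<alpha> < z"
  proof (rule integrable_const_bound[where B = "1 / (\<alpha> + z)"])
    show "AE p in \<mu>. norm (1 / (fst p 1 + z)) \<le> 1 / (\<alpha> + z)"
      using endpoint_coordinate(1) by eventually_elim (use that in \<open>auto intro!: frac_le\<close>)
  qed measurable
  show "integrable \<mu> (\<lambda>p. 1 / (snd p 1 - z))" if "z < \<beta>"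
  proof (rule integrable_const_bound[where B = "1 / (\<beta> - z)"])
    show "AE p in \<mu>. norm (1 / (snd p 1 - z)) \<le> 1 / (\<beta> - z)"
      using endpoint_coordinate(1) by eventually_elim (use that in \<open>auto intro!: frac_le\<close>)
  qed measurable
qed

definition quenched_limit :: "real \<Rightarrow> real \<Rightarrow> ennreal \<Rightarrow> bool" where
  "quenched_limit s t \<gamma> \<longleftrightarrow> (AE p in \<mu>. AE W in quenched_law p.
     (\<lambda>n. ennreal (last_passage W (nat \<lfloor>real n * s\<rfloor>) (nat \<lfloor>real n * t\<rfloor>) / real n)) \<longlonglongrightarrow> \<gamma>)"

lemma quenched_limit_le:
  assumes \<gamma>: "quenched_limit s t \<gamma>" and st: "s > 0" "t > 0" and z: "- \<alpha> < z" "z < \<beta>"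
  shows "\<gamma> \<le> ennreal (mean_time s t z)"
proof -
  have "AE p in \<mu>. (\<lambda>N. (\<Sum>i=1..N. 1 / (fst p i + z)) / real N) \<longlonglongrightarrow> (\<integral>p. 1 / (fst p 1 + z) \<partial>\<mu>)"
    using coordinate_average[of "\<lambda>(x, y). 1 / (x + z)"] integrable_reciprocal_coordinate(1)[OF z(1)] by simp
  moreover have "AE p in \<mu>. (\<lambda>N. (\<Sum>i=1..N. 1 / (snd p i - z)) / real N) \<longlonglongrightarrow> (\<integral>p. 1 / (snd p 1 - z) \<partial>\<mu>)"
    using coordinate_average[of "\<lambda>(x, y). 1 / (y - z)"] integrable_reciprocal_coordinate(2)[OF z(2)] by simp
  moreover have "AE p in \<mu>. \<forall>i\<ge>1. fst p i \<ge> \<alpha> \<and> snd p i \<ge> \<beta>"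
    using AE_all_coordinates[of "\<lambda>(x, y). x \<ge> \<alpha> \<and> y \<ge> \<beta>"] endpoint_coordinate(1) by simp
  ultimately have "AE p in \<mu>. \<gamma> \<le> ennreal (mean_time s t z)"
    using \<gamma>[unfolded quenched_limit_def] AE_space
  proof eventually_elim
    case (elim p)
    obtain a b where p: "p = (a, b)" by (cases p)
    show ?case
      unfolding mean_time_def
    proof (rule quenched_shape_le[where a = a and b = b and z = z and c = "min (\<alpha> + z) (\<beta> - z)"])
      show "min (\<alpha> + z) (\<beta> - z) \<le> a i + z" "min (\<alpha> + z) (\<beta> - z) \<le> b i - z" if "1 \<le> i" for i
        using elim(3) that by (auto simp: p min_le_iff_disj)
      show "AE W in quenched_law (a, b).
          (\<lambda>N. ennreal (last_passage W (nat \<lfloor>real N * s\<rfloor>) (nat \<lfloor>real N * t\<rfloor>) / real N)) \<longlonglongrightarrow> \<gamma>"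
        using elim(4) by (simp only: p)
    qed (use elim z st space_pos[OF elim(5)] in \<open>auto simp: p\<close>)
  qed
  then show ?thesis by simp
qed

text \<open>The parameters \<open>w1\<close>, \<open>w2\<close> depend on \<open>\<epsilon>\<close>, so the law of large numbers is invoked anew for every \<open>\<epsilon>\<close>,
  each time at finitely many points; the limit \<open>\<epsilon> \<rightarrow> 0\<close> is taken in the deterministic inequality.\<close>

lemma quenched_limit_ge_truncated:
  assumes \<gamma>: "quenched_limit s t \<gamma>" and st: "s > 0" "t > 0"
    and \<delta>: "\<delta> > 0" and pos: "\<alpha> + \<beta> > 0"
  defines "X \<equiv> \<lambda>p. max (fst p 1) (\<alpha> + \<delta>)" and "Y \<equiv> \<lambda>p. max (snd p 1) (\<beta> + \<delta>)"
  shows "\<exists>z. - \<alpha> - \<delta> < z \<and> z < \<beta> + \<delta> \<and>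
    ennreal (s * (\<integral>p. 1 / (X p + z) \<partial>\<mu>) + t * (\<integral>p. 1 / (Y p - z) \<partial>\<mu>)) \<le> \<gamma>"
proof -
  note m [measurable] = measurable_coordinate[OF order_refl]
  note [measurable] = m[unfolded One_nat_def]
  let ?l = "\<alpha> + \<delta>" and ?m = "\<beta> + \<delta>"
  have X: "X \<in> borel_measurable \<mu>" "\<And>p. p \<in> space \<mu> \<Longrightarrow> X p \<ge> ?l"
    and Y: "Y \<in> borel_measurable \<mu>" "\<And>p. p \<in> space \<mu> \<Longrightarrow> Y p \<ge> ?m"
    unfolding X_def Y_def by auto
  have "prob {p \<in> space \<mu>. fst p 1 < ?l} \<le> prob {p \<in> space \<mu>. X p = ?l}"
    using X(1) by (intro finite_measure_mono) (auto simp: X_def)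
  then have atom_X: "prob {p \<in> space \<mu>. X p = ?l} > 0"
    using endpoint_coordinate(2)[OF \<delta>] by linarith
  have "prob {p \<in> space \<mu>. snd p 1 < ?m} \<le> prob {p \<in> space \<mu>. Y p = ?m}"
    using Y(1) by (intro finite_measure_mono) (auto simp: Y_def)
  then have atom_Y: "prob {p \<in> space \<mu>. Y p = ?m} > 0"
    using endpoint_coordinate(3)[OF \<delta>] by linarith
  have "?l + ?m > 0" using pos \<delta> by simp
  from critical_parameter[OF X atom_X Y atom_Y this st] obtain z where z: "- ?l < z" "z < ?m"
    and crit: "s * (\<integral>p. 1 / (X p + z)\<^sup>2 \<partial>\<mu>) = t * (\<integral>p. 1 / (Y p - z)\<^sup>2 \<partial>\<mu>)" by blast
  define A where "A y = (\<integral>p. 1 / (X p + y) \<partial>\<mu>)" for y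
  define B where "B y = (\<integral>p. 1 / (Y p - y) \<partial>\<mu>)" for y
  have avg_A: "AE p in \<mu>. (\<lambda>N. (\<Sum>i=1..N. 1 / (max (fst p i) ?l + y)) / real N) \<longlonglongrightarrow> A y" if "- ?l < y" for y
  proof -
    have "integrable \<mu> (\<lambda>p. 1 / (X p + y))"
      using integrable_reciprocal_power[OF X, of y 1] that by simp
    then show ?thesis
      using coordinate_average[of "\<lambda>(u, v). 1 / (max u ?l + y)"] by (simp add: X_def A_def)
  qed
  have avg_B: "AE p in \<mu>. (\<lambda>N. (\<Sum>i=1..N. 1 / (max (snd p i) ?m - y)) / real N) \<longlonglongrightarrow> B y" if "y < ?m" for y
  proof -
    have "integrable \<mu> (\<lambda>p. 1 / (Y p - y))"
      using integrable_reciprocal_power[OF Y, of "- y" 1] that by simp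
    then show ?thesis
      using coordinate_average[of "\<lambda>(u, v). 1 / (max v ?m - y)"] by (simp add: Y_def B_def)
  qed
  have step: "ennreal (s * A z + t * B z - \<epsilon> * max (A z) (B z)) \<le> \<gamma>" if \<epsilon>: "\<epsilon> > 0" "\<epsilon> \<le> s" "\<epsilon> \<le> t" for \<epsilon>
  proof -
    from critical_parameter_neighbours[OF X Y z \<epsilon>(1) crit, folded A_def B_def] obtain w1 w2
      where w: "- ?l < w1" "w1 \<le> z" "z \<le> w2" "w2 < ?m"
        and gap1: "s * A w1 + t * B w1 < s * A z + t * B z + \<epsilon> * (A w1 - A z)"
        and gap2: "s * A w2 + t * B w2 < s * A z + t * B z + \<epsilon> * (B w2 - B z)" by blast
    have range: "- ?l < y" "y < ?m" if "y \<in> {w1, z, w2}" for y using that w z by auto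
    have "AE p in \<mu>. \<forall>y\<in>{w1, z, w2}. (\<lambda>N. (\<Sum>i=1..N. 1 / (max (fst p i) ?l + y)) / real N) \<longlonglongrightarrow> A y"
      by (intro AE_finite_allI ballI avg_A range) auto
    moreover have "AE p in \<mu>. \<forall>y\<in>{w1, z, w2}. (\<lambda>N. (\<Sum>i=1..N. 1 / (max (snd p i) ?m - y)) / real N) \<longlonglongrightarrow> B y"
      by (intro AE_finite_allI ballI avg_B range) auto
    ultimately have "AE p in \<mu>. ennreal (s * A z + t * B z - \<epsilon> * max (A z) (B z)) \<le> \<gamma>"
      using \<gamma>[unfolded quenched_limit_def] AE_space
    proof eventually_elim
      case (elim p)
      obtain a b where p: "p = (a, b)" by (cases p)
      show ?case
      proof (rule quenched_shape_ge[of a b "\<lambda>i. max (a i) ?l" "\<lambda>j. max (b j) ?m" w1 z w2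
            "min (?l + w1) (?m - w2)"])
        show "AE W in quenched_law (a, b).
            (\<lambda>N. ennreal (last_passage W (nat \<lfloor>real N * s\<rfloor>) (nat \<lfloor>real N * t\<rfloor>) / real N)) \<longlonglongrightarrow> \<gamma>"
          using elim(3) by (simp only: p)
        show "(\<lambda>N. (\<Sum>i=1..N. 1 / (max (a i) ?l + y)) / real N) \<longlonglongrightarrow> A y" if "y \<in> {w1, z, w2}" for y
          using elim(1) that by (simp only: p fst_conv)
        show "(\<lambda>N. (\<Sum>j=1..N. 1 / (max (b j) ?m - y)) / real N) \<longlonglongrightarrow> B y" if "y \<in> {w1, z, w2}" for y
          using elim(2) that by (simp only: p snd_conv)
        show "0 < a i" "0 < b i" if "1 \<le> i" for i
          using space_pos[OF elim(4) that] by (simp_all add: p)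
        show "s * A w1 + t * B w1 < s * A z + t * B z + \<epsilon> * (A w1 - A z)" by (rule gap1)
        show "s * A w2 + t * B w2 < s * A z + t * B z + \<epsilon> * (B w2 - B z)" by (rule gap2)
        show "min (?l + w1) (?m - w2) \<le> max (a i) ?l + w1" "min (?l + w1) (?m - w2) \<le> max (b i) ?m - w2" for i
          by linarith+
        show "0 < min (?l + w1) (?m - w2)" using w by linarith
      qed (use w st \<epsilon> in simp_all)
    qed
    then show ?thesis by simp
  qed
  have "((\<lambda>\<epsilon>. ennreal (s * A z + t * B z - \<epsilon> * max (A z) (B z))) \<longlongrightarrow> ennreal (s * A z + t * B z - 0 * max (A z) (B z))) (at_right 0)"
    by (intro tendsto_intros)
  moreover have "\<forall>\<^sub>F \<epsilon> in at_right 0. ennreal (s * A z + t * B z - \<epsilon> * max (A z) (B z)) \<le> \<gamma>"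
    unfolding eventually_at_right_field using step st by (intro exI[of _ "min s t"]) auto
  ultimately have "ennreal (s * A z + t * B z - 0 * max (A z) (B z)) \<le> \<gamma>"
    by (intro tendsto_upperbound) auto
  then show ?thesis using z by (intro exI[of _ z]) (auto simp: A_def B_def)
qed

text \<open>Removal of the truncation at level \<open>\<delta> = \<eta> ^ 3\<close>, which is small compared with the square of the margin
  \<open>\<eta>\<close> and hence makes both error terms of \<open>reciprocal_comparison\<close> vanish.\<close>

lemma quenched_limit_ge:
  assumes \<gamma>: "quenched_limit s t \<gamma>" and st: "s > 0" "t > 0" and pos: "\<alpha> + \<beta> > 0" and e: "e > 0"
  shows "\<exists>z. - \<alpha> < z \<and> z < \<beta> \<and> ennreal (mean_time s t z - e) \<le> \<gamma>"
proof -
  note m [measurable] = measurable_coordinate[OF order_refl]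
  note [measurable] = m[unfolded One_nat_def]
  define err where "err \<eta> = \<eta> ^ 3 / \<eta>\<^sup>2 + 4 * (2 * \<eta> ^ 3 + \<eta>) / (\<alpha> + \<beta>)\<^sup>2" for \<eta> :: real
  have "((\<lambda>\<eta>. (s + t) * (\<eta> + 4 * (2 * \<eta> ^ 3 + \<eta>) / (\<alpha> + \<beta>)\<^sup>2)) \<longlongrightarrow> (s + t) * (0 + 4 * (2 * 0 ^ 3 + 0) / (\<alpha> + \<beta>)\<^sup>2)) (at_right 0)"
    using pos by (intro tendsto_intros) auto
  then have "\<forall>\<^sub>F \<eta> in at_right 0. (s + t) * (\<eta> + 4 * (2 * \<eta> ^ 3 + \<eta>) / (\<alpha> + \<beta>)\<^sup>2) < e"
    using e by (intro order_tendstoD(2)) auto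
  moreover have "\<forall>\<^sub>F \<eta> in at_right (0::real). 0 < \<eta> \<and> 2 * \<eta> < \<alpha> + \<beta>"
    unfolding eventually_at_right_field using pos by (intro exI[of _ "(\<alpha> + \<beta>) / 2"]) auto
  ultimately have "\<forall>\<^sub>F \<eta> in at_right 0. 0 < \<eta> \<and> 2 * \<eta> < \<alpha> + \<beta> \<and> (s + t) * err \<eta> < e"
    by eventually_elim (auto simp: err_def power3_eq_cube power2_eq_square)
  then obtain \<eta> where \<eta>: "0 < \<eta>" "2 * \<eta> < \<alpha> + \<beta>" "(s + t) * err \<eta> < e"
    using eventually_happens'[OF trivial_limit_at_right_real] by blast
  define \<delta> where "\<delta> = \<eta> ^ 3"
  have \<delta>: "\<delta> > 0" using \<eta> by (simp add: \<delta>_def)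
  define X where "X p = max (fst p 1) (\<alpha> + \<delta>)" for p :: "(nat \<Rightarrow> real) \<times> (nat \<Rightarrow> real)"
  define Y where "Y p = max (snd p 1) (\<beta> + \<delta>)" for p :: "(nat \<Rightarrow> real) \<times> (nat \<Rightarrow> real)"
  obtain z where z: "- \<alpha> - \<delta> < z" "z < \<beta> + \<delta>"
    and ge: "ennreal (s * (\<integral>p. 1 / (X p + z) \<partial>\<mu>) + t * (\<integral>p. 1 / (Y p - z) \<partial>\<mu>)) \<le> \<gamma>"
    using quenched_limit_ge_truncated[OF \<gamma> st \<delta> pos] unfolding X_def Y_def by blast
  have XY_meas: "X \<in> borel_measurable \<mu>" "Y \<in> borel_measurable \<mu>"
    unfolding X_def[abs_def] Y_def[abs_def] by measurable
  define z' where "z' = max (- \<alpha> + \<eta>) (min (\<beta> - \<eta>) z)"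
  have z'_neg: "- z' = max (- \<beta> + \<eta>) (min (\<alpha> - \<eta>) (- z))"
    using \<eta> by (auto simp: z'_def max_def min_def)
  have z': "- \<alpha> < z'" "z' < \<beta>" using \<eta> by (auto simp: z'_def)
  have int_X: "integrable \<mu> (\<lambda>p. 1 / (X p + z))"
    using integrable_reciprocal_power[OF XY_meas(1), of "\<alpha> + \<delta>" z 1] z by (simp add: X_def)
  have int_Y: "integrable \<mu> (\<lambda>p. 1 / (Y p - z))"
    using integrable_reciprocal_power[OF XY_meas(2), of "\<beta> + \<delta>" "- z" 1] z by (simp add: Y_def)
  have A: "(\<integral>p. 1 / (fst p 1 + z') \<partial>\<mu>) - err \<eta> \<le> (\<integral>p. 1 / (X p + z) \<partial>\<mu>)"
  proof -
    have "(\<integral>p. 1 / (fst p 1 + z') - err \<eta> \<partial>\<mu>) \<le> (\<integral>p. 1 / (X p + z) \<partial>\<mu>)"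
    proof (rule integral_mono_AE)
      show "AE p in \<mu>. 1 / (fst p 1 + z') - err \<eta> \<le> 1 / (X p + z)"
        using endpoint_coordinate(1)
      proof eventually_elim
        case (elim p)
        show ?case
          unfolding err_def \<delta>_def[symmetric] z'_def
          using elim z \<eta> \<delta> by (intro reciprocal_comparison) (auto simp: X_def)
      qed
    qed (use int_X integrable_reciprocal_coordinate(1)[OF z'(1)] in auto)
    then show ?thesis using integrable_reciprocal_coordinate(1)[OF z'(1)] by (simp add: prob_space)
  qed
  have B: "(\<integral>p. 1 / (snd p 1 - z') \<partial>\<mu>) - err \<eta> \<le> (\<integral>p. 1 / (Y p - z) \<partial>\<mu>)"
  proof -
    have "(\<integral>p. 1 / (snd p 1 - z') - err \<eta> \<partial>\<mu>) \<le> (\<integral>p. 1 / (Y p - z) \<partial>\<mu>)"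
    proof (rule integral_mono_AE)
      show "AE p in \<mu>. 1 / (snd p 1 - z') - err \<eta> \<le> 1 / (Y p - z)"
        using endpoint_coordinate(1)
      proof eventually_elim
        case (elim p)
        have "1 / (snd p 1 + (- z')) - (\<delta> / \<eta>\<^sup>2 + 4 * (2 * \<delta> + \<eta>) / (\<beta> + \<alpha>)\<^sup>2) \<le> 1 / (Y p + (- z))"
          unfolding z'_neg
          using elim z \<eta> \<delta> by (intro reciprocal_comparison) (auto simp: Y_def)
        then show ?case by (simp add: err_def \<delta>_def add.commute)
      qed
    qed (use int_Y integrable_reciprocal_coordinate(2)[OF z'(2)] in auto)
    then show ?thesis using integrable_reciprocal_coordinate(2)[OF z'(2)] by (simp add: prob_space)
  qed
  have "s * ((\<integral>p. 1 / (fst p 1 + z') \<partial>\<mu>) - err \<eta>) + t * ((\<integral>p. 1 / (snd p 1 - z') \<partial>\<mu>) - err \<eta>)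
      \<le> s * (\<integral>p. 1 / (X p + z) \<partial>\<mu>) + t * (\<integral>p. 1 / (Y p - z) \<partial>\<mu>)"
    using st A B by (intro add_mono mult_left_mono) auto
  then have "mean_time s t z' - e \<le> s * (\<integral>p. 1 / (X p + z) \<partial>\<mu>) + t * (\<integral>p. 1 / (Y p - z) \<partial>\<mu>)"
    using \<eta>(3) by (simp add: mean_time_def algebra_simps)
  then have "ennreal (mean_time s t z' - e) \<le> \<gamma>"
    using ge by (meson ennreal_leI order_trans)
  then show ?thesis using z' by blast
qed

end

theorem mainTheorem1:
  fixes \<mu> :: "((nat \<Rightarrow> real) \<times> (nat \<Rightarrow> real)) measure"
    and g :: "real \<Rightarrow> real \<Rightarrow> ennreal"
  assumes "parameter_law \<mu>"
    and "is_shape_function \<mu> g"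
    and "left_endpoint (a_distr \<mu>) + left_endpoint (b_distr \<mu>) > 0"
  shows "\<forall>s>0. \<forall>t>0. g s t =
    (INF z\<in>{- left_endpoint (a_distr \<mu>)<..<left_endpoint (b_distr \<mu>)}.
       ennreal (s * (\<integral>(a, b). 1 / (a 1 + z) \<partial>\<mu>) + t * (\<integral>(a, b). 1 / (b 1 - z) \<partial>\<mu>)))"
proof (intro allI impI)
  fix s t :: real assume st: "s > 0" "t > 0"
  interpret parameter_law \<mu> by fact
  have "AE W in annealed_law \<mu>.
      (\<lambda>n. ennreal (last_passage W (nat \<lfloor>real n * s\<rfloor>) (nat \<lfloor>real n * t\<rfloor>) / real n)) \<longlonglongrightarrow> g s t"
    using assms(2) unfolding is_shape_function_def by eventually_elim (use st in simp)
  then have lim: "quenched_limit s t (g s t)"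
    unfolding quenched_limit_def by (rule AE_quenched)
  have mean: "s * (\<integral>(a, b). 1 / (a 1 + z) \<partial>\<mu>) + t * (\<integral>(a, b). 1 / (b 1 - z) \<partial>\<mu>) = mean_time s t z" for z
    by (simp add: mean_time_def case_prod_beta')
  show "g s t = (INF z\<in>{- \<alpha><..<\<beta>}.
       ennreal (s * (\<integral>(a, b). 1 / (a 1 + z) \<partial>\<mu>) + t * (\<integral>(a, b). 1 / (b 1 - z) \<partial>\<mu>)))"
    unfolding mean
  proof (rule antisym)
    show "g s t \<le> (INF z\<in>{- \<alpha><..<\<beta>}. ennreal (mean_time s t z))"
      by (rule INF_greatest) (use quenched_limit_le[OF lim st] in auto)
    show "(INF z\<in>{- \<alpha><..<\<beta>}. ennreal (mean_time s t z)) \<le> g s t"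
    proof (rule ennreal_le_epsilon)
      fix e :: real assume "e > 0"
      from quenched_limit_ge[OF lim st assms(3) this] obtain z
        where z: "- \<alpha> < z" "z < \<beta>" "ennreal (mean_time s t z - e) \<le> g s t" by blast
      have "(INF z\<in>{- \<alpha><..<\<beta>}. ennreal (mean_time s t z)) \<le> ennreal (mean_time s t z)"
        using z by (intro INF_lower) auto
      also have "\<dots> \<le> ennreal (mean_time s t z - e) + ennreal e"
        using \<open>e > 0\<close>
        by (cases "mean_time s t z \<ge> e") (auto simp: ennreal_plus[symmetric] ennreal_neg intro!: ennreal_leI simp del: ennreal_plus)
      also have "\<dots> \<le> g s t + ennreal e" using z(3) by (rule add_right_mono)
      finally show "(INF z\<in>{- \<alpha><..<\<beta>}. ennreal (mean_time s t z)) \<le> g s t + ennreal e" .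
    qed
  qed
qed

end
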